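(* Let $n,N$ be positive integers, $\lambda\in\mathcal{O}(n,N)$, $\Lambda,\Lambda'\in\mathcal{L}(\lambda,n)$ and $k\in\{1,\dots,n-1\}$. Suppose that $\Lambda(k-1)\neq\Lambda(k+1)$, $v(\Lambda')\in V(\Lambda,k)$ and $\Lambda\neq\Lambda'$. Then $$s_k(\Lambda,\Lambda')\,s_k(\Lambda',\Lambda)=1-\bigl(x_{k+1}(\Lambda)-x_k(\Lambda)\bigr)^{-2}.$$
   Context: Brauer algebra. For $n\ge1$ let $\mathcal{G}(n)$ be the set of partitions of $\{1,\dots,n,\bar1,\dots,\bar n\}$ into pairs (graphs with $n$ edges). $B(n,N)$ is the complex associative algebra with basis $b(\gamma)$, $\gamma\in\mathcal{G}(n)$, and product $b(\gamma)b(\gamma')=N^{q}b(\gamma\circ\gamma')$: identify the vertices $\bar1,\dots,\bar n$ of $\gamma$ with $1,\dots,n$ of $\gamma'$, let $q$ be the number of loops, remove the loops and replace the other components by single edges joining their terminal vertices to get $\gamma\circ\gamma'$. A permutation $s\in S(n)$ is identified with $b(\gamma)$, $\gamma$ having edges $\{s(m),\bar m\}$. For $k\neq l$, $(k,l)$ is the transposition and $\overline{(k,l)}=b(\gamma)$ with $\gamma$ having edges $\{k,l\},\{\bar k,\bar l\}$ and $\{m,\bar m\}$, $m\ne k,l$. Put $s_k=(k,k+1)$. $B(n-1,N)\subset B(n,N)$ is spanned by the $b(\gamma)$ with $\{n,\bar n\}\in\gamma$. For $k=1,\dots,n$, $x_k=\frac{N-1}{2}+\sum_{l=1}^{k-1}\bigl((k,l)-\overline{(k,l)}\bigr)$.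 Representations. $N$ is a positive integer, $U=\mathbb{C}^N$ with standard orthonormal basis $u(1),\dots,u(N)$, $G=O(N,\mathbb{C})$, $C(n,N)=\operatorname{End}_G(U^{\otimes n})$. $B(n,N)$ maps onto $C(n,N)$: $(k,l)$ permutes the $k$-th and $l$-th tensor factors, and $\overline{(k,l)}$ sends $u(i_1)\otimes\cdots\otimes u(i_n)$ to $\delta_{i_k i_l}\sum_{i=1}^N$ of the same tensor with both the $k$-th and $l$-th factors replaced by $u(i)$. $\mathcal{O}(n,N)$ is the set of Young diagrams with at most $N$ boxes in the first two columns together and with $n-2r$ boxes in total, $r=0,1,\dots,[n/2]$. For such a diagram $\lambda$ with $m$ boxes, $U(\lambda,N)$ is Weyl's irreducible representation of $G$: the space of traceless tensors in $U^{\otimes m}$ (those killed by all $\overline{(k,l)}$) decomposes under $G\times S(m)$ as $\bigoplus_\lambda U(\lambda,N)\otimes S^\lambda$, over diagrams $\lambda$ with $m$ boxes and at most $N$ boxes in the first two columns, $S^\lambda$ being the irreducible $S(m)$-module of $\lambda$ (trivial for a one-row diagram). One has $U^{\otimes n}=\bigoplus_{\lambda\in\mathcal{O}(n,N)}U(\lambda,N)\otimes V(\lambda,n)$ with $V(\lambda,n)$ the irreducible $C(n,N)$-modules, also regarded as $B(n,N)$-modules. The restriction of $V(\lambda,n)$ to $C(n-1,N)$ is the multiplicity-free direct sum of $V(\mu,n-1)$ over $\mu\in\mathcal{O}(n-1,N)$ obtained from $\lambda$ by removing or adding one box. Canonical basis. $\mathcal{L}(\lambda,n)$ is the set of sequences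 $\Lambda=(\Lambda(1),\dots,\Lambda(n))\in\mathcal{O}(1,N)\times\cdots\times\mathcal{O}(n,N)$ with $\Lambda(n)=\lambda$ and neighbouring terms differing by exactly one box; $\Lambda(0)$ is the empty diagram. The canonical basis of $V(\lambda,n)$ consists of vectors $v(\Lambda)$, $\Lambda\in\mathcal{L}(\lambda,n)$, determined up to nonzero scalars by: $v(\Lambda)$ lies in the component $V(\Lambda(k),k)$ of the restriction of $V(\lambda,n)$ to $C(k,N)$ for every $k=1,\dots,n-1$. Each $v(\Lambda)$ is an eigenvector of $x_1,\dots,x_n$; $x_k(\Lambda)$ denotes the eigenvalue of $x_k$ on $v(\Lambda)$ (one has $x_k(\Lambda)\ne x_{k+1}(\Lambda)$ when $\Lambda(k-1)\ne\Lambda(k+1)$). $V(\Lambda,k)$ is the subspace of $V(\lambda,n)$ spanned by the vectors $v(\Lambda')$ with $\Lambda'(l)=\Lambda(l)$ for all $l\ne k$. Matrix elements are defined by $s_k\cdot v(\Lambda)=\sum_{\Lambda'\in\mathcal{L}(\lambda,n)}s_k(\Lambda,\Lambda')\,v(\Lambda')$. *)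

theory Defs
  imports "HOL-Analysis.Analysis" "HOL-Library.Function_Algebras" "HOL-Combinatorics.Permutations"
begin

section \<open>Complex vector spaces\<close>

class complex_vector = ab_group_add +
  fixes scaleC :: "complex \<Rightarrow> 'a \<Rightarrow> 'a"  (infixr "*\<^sub>C" 75)
  assumes scaleC_right_distrib: "c *\<^sub>C (x + y) = c *\<^sub>C x + c *\<^sub>C y"
    and scaleC_left_distrib: "(c + d) *\<^sub>C x = c *\<^sub>C x + d *\<^sub>C x"
    and scaleC_scaleC: "c *\<^sub>C d *\<^sub>C x = (c * d) *\<^sub>C x"
    and scaleC_one: "1 *\<^sub>C x = x"

instantiation complex :: complex_vector
begin

definition scaleC_complex :: "complex \<Rightarrow> complex \<Rightarrow> complex"
  where "scaleC_complex c x = c * x"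

instance
  by standard (simp_all add: scaleC_complex_def algebra_simps)

end

instantiation "fun" :: (type, complex_vector) complex_vector
begin

definition scaleC_fun :: "complex \<Rightarrow> ('a \<Rightarrow> 'b) \<Rightarrow> 'a \<Rightarrow> 'b"
  where "scaleC_fun c f = (\<lambda>x. c *\<^sub>C f x)"

instance
  by standard
    (simp_all add: scaleC_fun_def fun_eq_iff scaleC_right_distrib scaleC_left_distrib
      scaleC_scaleC scaleC_one)

end

global_interpretation complex_vector: vector_space "scaleC :: complex \<Rightarrow> 'a \<Rightarrow> 'a::complex_vector"
  by standard (simp_all add: scaleC_right_distrib scaleC_left_distrib scaleC_scaleC scaleC_one)

definition linear_on :: "'a::complex_vector set \<Rightarrow> ('a \<Rightarrow> 'b::complex_vector) \<Rightarrow> bool"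
  where "linear_on V f \<longleftrightarrow>
    (\<forall>x\<in>V. \<forall>y\<in>V. f (x + y) = f x + f y) \<and> (\<forall>c. \<forall>x\<in>V. f (c *\<^sub>C x) = c *\<^sub>C f x)"

text \<open>
  A module is given by a set \<open>G\<close> of operator names, a map \<open>\<rho>\<close> from names to operators and a
  subspace \<open>V\<close>. Homomorphisms are extended by zero outside \<open>V\<close>, so that \<open>Hom G \<rho> V \<sigma> W\<close> is itself a
  subspace of the space of all functions.
\<close>

definition Hom :: "'g set \<Rightarrow> ('g \<Rightarrow> 'a \<Rightarrow> 'a) \<Rightarrow> 'a::complex_vector set \<Rightarrow>
    ('g \<Rightarrow> 'b \<Rightarrow> 'b) \<Rightarrow> 'b::complex_vector set \<Rightarrow> ('a \<Rightarrow> 'b) set"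
  where "Hom G \<rho> V \<sigma> W =
    {f. linear_on V f \<and> f ` V \<subseteq> W \<and> (\<forall>g\<in>G. \<forall>x\<in>V. f (\<rho> g x) = \<sigma> g (f x)) \<and> (\<forall>x. x \<notin> V \<longrightarrow> f x = 0)}"

definition submodule :: "'g set \<Rightarrow> ('g \<Rightarrow> 'a \<Rightarrow> 'a) \<Rightarrow> 'a::complex_vector set \<Rightarrow> 'a set \<Rightarrow> bool"
  where "submodule G \<rho> V X \<longleftrightarrow>
    complex_vector.subspace X \<and> X \<subseteq> V \<and> (\<forall>g\<in>G. \<rho> g ` X \<subseteq> X)"

definition isomorphic_modules :: "'g set \<Rightarrow> ('g \<Rightarrow> 'a \<Rightarrow> 'a) \<Rightarrow> 'a::complex_vector set \<Rightarrow>
    ('g \<Rightarrow> 'b \<Rightarrow> 'b) \<Rightarrow> 'b::complex_vector set \<Rightarrow> bool"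
  where "isomorphic_modules G \<rho> V \<sigma> W \<longleftrightarrow> (\<exists>f\<in>Hom G \<rho> V \<sigma> W. bij_betw f V W)"

definition isotypic_component :: "'g set \<Rightarrow> ('g \<Rightarrow> 'a \<Rightarrow> 'a) \<Rightarrow> 'a::complex_vector set \<Rightarrow>
    ('g \<Rightarrow> 'b \<Rightarrow> 'b) \<Rightarrow> 'b::complex_vector set \<Rightarrow> 'b set"
  where "isotypic_component G \<rho> V \<sigma> W =
    complex_vector.span (\<Union>{X. submodule G \<sigma> W X \<and> isomorphic_modules G \<rho> V \<sigma> X})"


section \<open>Young diagrams and Specht modules\<close>

text \<open>A diagram is its set of boxes (row, column), both counted from 0.\<close>

type_synonym diagram = "(nat \<times> nat) set"

definition young_diagram :: "diagram \<Rightarrow> bool"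
  where "young_diagram D \<longleftrightarrow>
    finite D \<and> (\<forall>i j i' j'. (i, j) \<in> D \<and> i' \<le> i \<and> j' \<le> j \<longrightarrow> (i', j') \<in> D)"

definition young_diagrams :: "nat \<Rightarrow> nat \<Rightarrow> diagram set"  (\<open>\<O>\<close>)
  where "\<O> n N =
    {D. young_diagram D \<and> card {b \<in> D. snd b < 2} \<le> N \<and> (\<exists>r. 2 * r \<le> n \<and> card D = n - 2 * r)}"

definition differ_by_box :: "diagram \<Rightarrow> diagram \<Rightarrow> bool"
  where "differ_by_box D E \<longleftrightarrow> (\<exists>b. b \<notin> D \<and> E = insert b D \<or> b \<notin> E \<and> D = insert b E)"

text \<open>
  A tableau of shape \<open>D\<close> is a bijection from the entries \<open>1, \<dots>, card D\<close> to the boxes, and its tabloid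
  records the row of each entry. The Specht module lies in the space of functions on tabloids.
\<close>

definition symmetric_group :: "nat \<Rightarrow> (nat \<Rightarrow> nat) set"
  where "symmetric_group m = {p. p permutes {1..m}}"

definition tabloid :: "nat \<Rightarrow> (nat \<Rightarrow> nat \<times> nat) \<Rightarrow> nat \<Rightarrow> nat"
  where "tabloid m t = (\<lambda>p. if p \<in> {1..m} then fst (t p) else 0)"

definition column_group :: "nat \<Rightarrow> (nat \<Rightarrow> nat \<times> nat) \<Rightarrow> (nat \<Rightarrow> nat) set"
  where "column_group m t = {q \<in> symmetric_group m. \<forall>p\<in>{1..m}. snd (t (q p)) = snd (t p)}"

definition polytabloid :: "nat \<Rightarrow> (nat \<Rightarrow> nat \<times> nat) \<Rightarrow> (nat \<Rightarrow> nat) \<Rightarrow> complex"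
  where "polytabloid m t =
    (\<lambda>r. \<Sum>q\<in>column_group m t. of_int (sign q) * of_bool (r = tabloid m (t \<circ> inv q)))"

definition specht :: "diagram \<Rightarrow> ((nat \<Rightarrow> nat) \<Rightarrow> complex) set"
  where "specht D = complex_vector.span (polytabloid (card D) ` {t. bij_betw t {1..card D} D})"

definition specht_act :: "(nat \<Rightarrow> nat) \<Rightarrow> ((nat \<Rightarrow> nat) \<Rightarrow> complex) \<Rightarrow> (nat \<Rightarrow> nat) \<Rightarrow> complex"
  where "specht_act s F = (\<lambda>r. F (r \<circ> s))"


section \<open>Tensors over the orthogonal group\<close>

text \<open>
  The number \<open>N\<close> is \<open>CARD('N)\<close>, and \<open>'N\<close> indexes the standard basis of \<open>U\<close>. A tensor in the \<open>n\<close>-th power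
  of \<open>U\<close> is its array of coordinates: a function on index lists of length \<open>n\<close>, extended by zero to
  lists of other lengths.
\<close>

type_synonym 'N tensor = "'N list \<Rightarrow> complex"

definition tensors :: "nat \<Rightarrow> 'N tensor set"
  where "tensors n = {t. \<forall>is. length is \<noteq> n \<longrightarrow> t is = 0}"

definition pure_tensor :: "'N list \<Rightarrow> 'N tensor"
  where "pure_tensor js = (\<lambda>is. of_bool (is = js))"

definition orthogonal_group :: "(complex^'N^'N) set"
  where "orthogonal_group = {g. orthogonal_matrix g}"

definition tensor_act :: "complex^'N^'N \<Rightarrow> 'N::finite tensor \<Rightarrow> 'N tensor"
  where "tensor_act g t =
    (\<lambda>is. \<Sum>js | length js = length is. (\<Prod>p<length is. g $ (is ! p) $ (js ! p)) * t js)"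

definition centralizer_algebra :: "nat \<Rightarrow> ('N::finite tensor \<Rightarrow> 'N tensor) set"
  where "centralizer_algebra n = Hom orthogonal_group tensor_act (tensors n) tensor_act (tensors n)"

text \<open>The operator \<open>A \<otimes> 1 \<otimes> \<dots> \<otimes> 1\<close>, where \<open>A\<close> acts on the first \<open>k\<close> tensor factors.\<close>

definition extend_op :: "nat \<Rightarrow> ('N tensor \<Rightarrow> 'N tensor) \<Rightarrow> 'N tensor \<Rightarrow> 'N tensor"
  where "extend_op k A t =
    (\<lambda>is. A (\<lambda>js. of_bool (length js = k) * t (js @ drop k is)) (take k is))"


section \<open>The Brauer algebra\<close>

datatype vertex = Vtx nat | Bar nat

type_synonym graph = "vertex set set"

definition brauer_graphs :: "nat \<Rightarrow> graph set"
  where "brauer_graphs n =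
    {\<gamma>. partition_on (Vtx ` {1..n} \<union> Bar ` {1..n}) \<gamma> \<and> (\<forall>e\<in>\<gamma>. card e = 2)}"

text \<open>
  For the product, the vertices of the upper graph are placed on levels 0 and 1, and those of the
  lower graph on levels 1 and 2.
\<close>

fun upper :: "vertex \<Rightarrow> nat \<times> nat" where
  "upper (Vtx i) = (0, i)"
| "upper (Bar i) = (1, i)"

fun lower :: "vertex \<Rightarrow> nat \<times> nat" where
  "lower (Vtx i) = (1, i)"
| "lower (Bar i) = (2, i)"

definition components :: "nat \<Rightarrow> graph \<Rightarrow> graph \<Rightarrow> (nat \<times> nat) set set"
  where "components n \<gamma> \<gamma>' =
    ({0, 1, 2} \<times> {1..n}) // {(a, b). \<exists>e \<in> image upper ` \<gamma> \<union> image lower ` \<gamma>'. a \<in> e \<and> b \<in> e}\<^sup>*"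

definition loops :: "nat \<Rightarrow> graph \<Rightarrow> graph \<Rightarrow> nat"
  where "loops n \<gamma> \<gamma>' = card {C \<in> components n \<gamma> \<gamma>'. C \<subseteq> {1} \<times> {1..n}}"

definition compose_graphs :: "nat \<Rightarrow> graph \<Rightarrow> graph \<Rightarrow> graph"
  where "compose_graphs n \<gamma> \<gamma>' =
    (\<lambda>C. {Vtx i |i. (0, i) \<in> C} \<union> {Bar i |i. (2, i) \<in> C}) `
      {C \<in> components n \<gamma> \<gamma>'. \<not> C \<subseteq> {1} \<times> {1..n}}"

text \<open>Elements of the Brauer algebra are coefficient functions supported on \<open>brauer_graphs n\<close>.\<close>

type_synonym brauer = "graph \<Rightarrow> complex"

definition brauer_algebra :: "nat \<Rightarrow> brauer set"
  where "brauer_algebra n = {a. \<forall>\<gamma>. \<gamma> \<notin> brauer_graphs n \<longrightarrow> a \<gamma> = 0}"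

definition brauer_basis :: "graph \<Rightarrow> brauer"
  where "brauer_basis \<gamma> = (\<lambda>\<delta>. of_bool (\<delta> = \<gamma>))"

definition brauer_mult :: "nat \<Rightarrow> nat \<Rightarrow> brauer \<Rightarrow> brauer \<Rightarrow> brauer"
  where "brauer_mult n N a b =
    (\<Sum>\<gamma>\<in>brauer_graphs n. \<Sum>\<gamma>'\<in>brauer_graphs n.
      (a \<gamma> * b \<gamma>' * of_nat N ^ loops n \<gamma> \<gamma>') *\<^sub>C brauer_basis (compose_graphs n \<gamma> \<gamma>'))"

definition perm_graph :: "nat \<Rightarrow> (nat \<Rightarrow> nat) \<Rightarrow> graph"
  where "perm_graph n s = {{Vtx (s m), Bar m} |m. m \<in> {1..n}}"

definition bar_graph :: "nat \<Rightarrow> nat \<Rightarrow> nat \<Rightarrow> graph"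
  where "bar_graph n k l =
    {{Vtx k, Vtx l}, {Bar k, Bar l}} \<union> {{Vtx m, Bar m} |m. m \<in> {1..n} - {k, l}}"

definition brauer_perm :: "nat \<Rightarrow> (nat \<Rightarrow> nat) \<Rightarrow> brauer"
  where "brauer_perm n s = brauer_basis (perm_graph n s)"

definition brauer_bar :: "nat \<Rightarrow> nat \<Rightarrow> nat \<Rightarrow> brauer"
  where "brauer_bar n k l = brauer_basis (bar_graph n k l)"

definition brauer_s :: "nat \<Rightarrow> nat \<Rightarrow> brauer"
  where "brauer_s n k = brauer_perm n (Transposition.transpose k (k + 1))"

definition brauer_x :: "nat \<Rightarrow> nat \<Rightarrow> nat \<Rightarrow> brauer"
  where "brauer_x n N k =
    ((of_nat N - 1) / 2) *\<^sub>C brauer_perm n id +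
    (\<Sum>l\<in>{1..<k}. brauer_perm n (Transposition.transpose k l) - brauer_bar n k l)"

text \<open>
  In the matrix of \<open>b(\<gamma>)\<close> the unbarred vertices carry the row index \<open>is\<close> and the barred ones the
  column index \<open>js\<close>; the entry is 1 if both ends of every edge carry the same label, and 0 otherwise.
\<close>

fun vertex_label :: "'N list \<Rightarrow> 'N list \<Rightarrow> vertex \<Rightarrow> 'N" where
  "vertex_label is js (Vtx i) = is ! (i - 1)"
| "vertex_label is js (Bar i) = js ! (i - 1)"

definition compatible :: "graph \<Rightarrow> 'N list \<Rightarrow> 'N list \<Rightarrow> bool"
  where "compatible \<gamma> is js \<longleftrightarrow>
    (\<forall>e\<in>\<gamma>. \<forall>a\<in>e. \<forall>b\<in>e. vertex_label is js a = vertex_label is js b)"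

definition graph_op :: "nat \<Rightarrow> graph \<Rightarrow> 'N::finite tensor \<Rightarrow> 'N tensor"
  where "graph_op n \<gamma> t =
    (\<lambda>is. of_bool (length is = n) * (\<Sum>js | length js = n. of_bool (compatible \<gamma> is js) * t js))"

definition brauer_op :: "nat \<Rightarrow> brauer \<Rightarrow> 'N::finite tensor \<Rightarrow> 'N tensor"
  where "brauer_op n a t = (\<Sum>\<gamma>\<in>brauer_graphs n. a \<gamma> *\<^sub>C graph_op n \<gamma> t)"


text \<open>
  The following facts confirm the conventions: permutations and the elements \<open>brauer_bar n k l\<close> act on
  pure tensors by the classical formulas, and \<open>graph_op\<close> turns the product of graphs into composition.
\<close>

lemma brauer_op_basis:
  assumes "\<gamma> \<in> brauer_graphs n"
  shows "brauer_op n (brauer_basis \<gamma>) t = graph_op n \<gamma> t"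
proof -
  have fin: "finite (brauer_graphs n)"
  proof (rule finite_subset)
    show "brauer_graphs n \<subseteq> Pow (Pow (Vtx ` {1..n} \<union> Bar ` {1..n}))"
      by (auto simp: brauer_graphs_def partition_on_def)
  qed simp
  have "brauer_op n (brauer_basis \<gamma>) t = (\<Sum>\<delta>\<in>brauer_graphs n. if \<delta> = \<gamma> then graph_op n \<gamma> t else 0)"
    unfolding brauer_op_def brauer_basis_def
    by (intro sum.cong) (auto simp: scaleC_one)
  then show ?thesis
    using assms fin by simp
qed

lemma graph_op_pure_tensor:
  fixes js :: "'a::finite list"
  assumes "length js = n"
  shows "graph_op n \<gamma> (pure_tensor js) = (\<lambda>is. of_bool (length is = n \<and> compatible \<gamma> is js))"
proof
  fix "is" :: "'a list"
  have fin: "finite {js'::'a list. length js' = n}"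
    using finite_lists_length_eq[of "UNIV :: 'a set" n] by simp
  have "(\<Sum>js' | length js' = n. of_bool (compatible \<gamma> is js') * pure_tensor js js')
      = (\<Sum>js' | length js' = n. if js' = js then of_bool (compatible \<gamma> is js) else (0::complex))"
    by (intro sum.cong) (auto simp: pure_tensor_def)
  also have "\<dots> = of_bool (compatible \<gamma> is js)"
    using assms fin by simp
  finally show "graph_op n \<gamma> (pure_tensor js) is = of_bool (length is = n \<and> compatible \<gamma> is js)"
    by (simp add: graph_op_def)
qed

lemma perm_graph_in_brauer_graphs:
  assumes "s permutes {1..n}"
  shows "perm_graph n s \<in> brauer_graphs n"
proof -
  have sin: "s m \<in> {1..n}" if "m \<in> {1..n}" for m
    using assms that by (metis permutes_in_image)
  have inj: "s m = s m' \<Longrightarrow> m = m'" for m m'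
    using assms by (metis permutes_inv_o(2) comp_apply id_apply)
  have surj: "\<exists>m\<in>{1..n}. i = s m" if "i \<in> {1..n}" for i
    using assms that by (metis permutes_image imageE)
  have "partition_on (Vtx ` {1..n} \<union> Bar ` {1..n}) (perm_graph n s)"
  proof (rule partition_onI)
    show "\<Union> (perm_graph n s) = Vtx ` {1..n} \<union> Bar ` {1..n}"
    proof (intro equalityI subsetI)
      fix x assume "x \<in> \<Union> (perm_graph n s)"
      then show "x \<in> Vtx ` {1..n} \<union> Bar ` {1..n}"
        using sin unfolding perm_graph_def by blast
    next
      fix x assume "x \<in> Vtx ` {1..n} \<union> Bar ` {1..n}"
      then show "x \<in> \<Union> (perm_graph n s)"
        using surj unfolding perm_graph_def by blast
    qed
  qed (auto simp: perm_graph_def disjnt_def dest: inj)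
  then show ?thesis
    by (auto simp: brauer_graphs_def perm_graph_def)
qed

lemma bar_graph_in_brauer_graphs:
  assumes "k \<in> {1..n}" "l \<in> {1..n}" "k \<noteq> l"
  shows "bar_graph n k l \<in> brauer_graphs n"
proof -
  have "partition_on (Vtx ` {1..n} \<union> Bar ` {1..n}) (bar_graph n k l)"
  proof (rule partition_onI)
    show "\<Union> (bar_graph n k l) = Vtx ` {1..n} \<union> Bar ` {1..n}"
    proof (intro equalityI subsetI)
      fix x assume "x \<in> Vtx ` {1..n} \<union> Bar ` {1..n}"
      then show "x \<in> \<Union> (bar_graph n k l)"
        unfolding bar_graph_def by blast
    qed (use assms in \<open>auto simp: bar_graph_def\<close>)
  qed (use assms in \<open>auto simp: bar_graph_def disjnt_def\<close>)
  then show ?thesis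
    using assms by (auto simp: brauer_graphs_def bar_graph_def)
qed

lemma compatible_perm_graph:
  "compatible (perm_graph n s) is js \<longleftrightarrow> (\<forall>m\<in>{1..n}. is ! (s m - 1) = js ! (m - 1))"
proof -
  have "perm_graph n s = (\<lambda>m. {Vtx (s m), Bar m}) ` {1..n}"
    by (auto simp: perm_graph_def)
  then show ?thesis
    unfolding compatible_def by (simp only: ball_simps) (auto simp del: One_nat_def)
qed

lemma compatible_bar_graph:
  "compatible (bar_graph n k l) is js \<longleftrightarrow>
    is ! (k - 1) = is ! (l - 1) \<and> js ! (k - 1) = js ! (l - 1) \<and>
    (\<forall>m\<in>{1..n} - {k, l}. is ! (m - 1) = js ! (m - 1))"
proof -
  have "bar_graph n k l =
      insert {Vtx k, Vtx l} (insert {Bar k, Bar l} ((\<lambda>m. {Vtx m, Bar m}) ` ({1..n} - {k, l})))"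
    unfolding bar_graph_def by blast
  then show ?thesis
    unfolding compatible_def by (simp only: ball_simps) (auto simp del: One_nat_def)
qed

lemma brauer_op_perm:
  assumes "s permutes {1..n}" "length js = n"
  shows "brauer_op n (brauer_perm n s) (pure_tensor js) =
    pure_tensor (map (\<lambda>m. js ! (inv s m - 1)) [1..<n + 1])"
proof -
  have sin: "s m \<in> {1..n}" if "m \<in> {1..n}" for m
    using assms that by (metis permutes_in_image)
  have iin: "inv s m \<in> {1..n}" if "m \<in> {1..n}" for m
    using assms that by (metis permutes_in_image permutes_inv)
  have "length is = n \<and> compatible (perm_graph n s) is js \<longleftrightarrow> is = map (\<lambda>m. js ! (inv s m - 1)) [1..<n + 1]"
    (is "?L \<longleftrightarrow> ?R") for "is"
  proof
    assume L: ?L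
    then have c: "is ! (s m - 1) = js ! (m - 1)" if "m \<in> {1..n}" for m
      using that unfolding compatible_perm_graph by blast
    show ?R
    proof (rule nth_equalityI)
      fix p assume "p < length is"
      then have p: "p + 1 \<in> {1..n}" using L by auto
      have "is ! p = js ! (inv s (p + 1) - 1)"
        using c[OF iin[OF p]] assms by (simp add: permutes_inverses)
      then show "is ! p = map (\<lambda>m. js ! (inv s m - 1)) [1..<n + 1] ! p"
        using p by (simp del: upt_Suc)
    qed (use L in simp)
  next
    assume R: ?R
    have c: "is ! (s m - 1) = js ! (m - 1)" if "m \<in> {1..n}" for m
    proof -
      have "1 \<le> s m" "s m \<le> n" using sin[OF that] by auto
      then have "s m - 1 < n" "[1..<n + 1] ! (s m - 1) = s m"
        using nth_upt[of 1 "s m - 1" "n + 1"] by auto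
      then show ?thesis
        unfolding R using permutes_inverses(2)[OF assms(1)] by (simp del: upt_Suc)
    qed
    then have "compatible (perm_graph n s) is js"
      unfolding compatible_perm_graph by blast
    then show ?L using R by simp
  qed
  then show ?thesis
    unfolding brauer_perm_def brauer_op_basis[OF perm_graph_in_brauer_graphs[OF assms(1)]]
      graph_op_pure_tensor[OF assms(2)]
    by (auto simp: pure_tensor_def fun_eq_iff)
qed

lemma brauer_op_bar:
  fixes js :: "'N::finite list"
  assumes kl: "k \<in> {1..n}" "l \<in> {1..n}" "k \<noteq> l" and len: "length js = n"
  shows "brauer_op n (brauer_bar n k l) (pure_tensor js) =
    of_bool (js ! (k - 1) = js ! (l - 1)) *\<^sub>C (\<Sum>i\<in>UNIV. pure_tensor (js[k - 1 := i, l - 1 := i]))"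
proof
  fix "is" :: "'N list"
  let ?J = "\<lambda>i. js[k - 1 := i, l - 1 := i]"
  have b: "k - 1 < n" "l - 1 < n" "k - 1 \<noteq> l - 1" using kl by auto
  have eq: "length is = n \<and> compatible (bar_graph n k l) is js \<longleftrightarrow>
      js ! (k - 1) = js ! (l - 1) \<and> is = ?J (is ! (k - 1))" (is "?L \<longleftrightarrow> ?R")
  proof
    assume L: ?L
    then have c: "is ! (k - 1) = is ! (l - 1)" "js ! (k - 1) = js ! (l - 1)"
      unfolding compatible_bar_graph by blast+
    have d: "is ! (m - 1) = js ! (m - 1)" if "m \<in> {1..n} - {k, l}" for m
      using L that unfolding compatible_bar_graph by blast
    have "is = ?J (is ! (k - 1))"
    proof (rule nth_equalityI)
      fix p assume "p < length is"
      then have "p < n" using L by simp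
      then have "is ! p = js ! p" if "p \<noteq> k - 1" "p \<noteq> l - 1"
        using d[of "p + 1"] that by fastforce
      then show "is ! p = ?J (is ! (k - 1)) ! p"
        using c b len \<open>p < n\<close> by (cases "p = k - 1"; cases "p = l - 1") auto
    qed (use L len in simp)
    then show ?R using c by simp
  next
    assume R: ?R
    then have l: "length is = n" using len by (metis length_list_update)
    define i where "i = is ! (k - 1)"
    have R2: "is = ?J i" using R i_def by simp
    have c: "is ! (k - 1) = i" "is ! (l - 1) = i"
      using b len unfolding R2 by auto
    have d: "is ! (m - 1) = js ! (m - 1)" if "m \<in> {1..n} - {k, l}" for m
    proof -
      have "m - 1 \<noteq> k - 1" "m - 1 \<noteq> l - 1" using that kl by auto
      then show ?thesis unfolding R2 by simp
    qed
    have "compatible (bar_graph n k l) is js"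
      using c d R unfolding compatible_bar_graph by auto
    then show ?L using l by simp
  qed
  have "(\<Sum>i\<in>UNIV. pure_tensor (?J i)) is = (\<Sum>i\<in>UNIV. pure_tensor (?J i) is)"
    by (induction rule: infinite_finite_induct[of _ UNIV]) simp_all
  also have "\<dots> = (\<Sum>i\<in>UNIV. if i = is ! (k - 1) then of_bool (is = ?J (is ! (k - 1))) else 0)"
    using b len by (intro sum.cong) (auto simp: pure_tensor_def nth_list_update)
  finally show "brauer_op n (brauer_bar n k l) (pure_tensor js) is =
      (of_bool (js ! (k - 1) = js ! (l - 1)) *\<^sub>C (\<Sum>i\<in>UNIV. pure_tensor (?J i))) is"
    unfolding brauer_bar_def brauer_op_basis[OF bar_graph_in_brauer_graphs[OF kl]]
      graph_op_pure_tensor[OF len] eq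
    by (simp add: scaleC_fun_def scaleC_complex_def of_bool_conj)
qed

lemma graph_op_compose:
  fixes t :: "'N::finite tensor"
  assumes G: "\<gamma> \<in> brauer_graphs n" "\<gamma>' \<in> brauer_graphs n"
  shows "graph_op n \<gamma> (graph_op n \<gamma>' t) =
    (of_nat CARD('N) ^ loops n \<gamma> \<gamma>') *\<^sub>C graph_op n (compose_graphs n \<gamma> \<gamma>') t"
proof -
  define V :: "(nat \<times> nat) set" where "V = {0, 1, 2} \<times> {1..n}"
  define R where "R = {(a, b). \<exists>e \<in> image upper ` \<gamma> \<union> image lower ` \<gamma>'. a \<in> e \<and> b \<in> e}"
  define cl where "cl a = R\<^sup>* `` {a}" for a
  define K where "K = components n \<gamma> \<gamma>'"
  define L where "L = {C \<in> K. C \<subseteq> {1} \<times> {1..n}}"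
  have K: "K = cl ` V"
    unfolding K_def components_def R_def V_def cl_def quotient_def by blast
  have RV: "R \<subseteq> V \<times> V"
  proof -
    have "\<Union>\<gamma> \<subseteq> Vtx ` {1..n} \<union> Bar ` {1..n}" "\<Union>\<gamma>' \<subseteq> Vtx ` {1..n} \<union> Bar ` {1..n}"
      using G by (auto simp: brauer_graphs_def partition_on_def)
    moreover have "upper ` (Vtx ` {1..n} \<union> Bar ` {1..n}) \<subseteq> V" "lower ` (Vtx ` {1..n} \<union> Bar ` {1..n}) \<subseteq> V"
      by (auto simp: V_def)
    ultimately have "e \<subseteq> V" if "e \<in> image upper ` \<gamma> \<union> image lower ` \<gamma>'" for e
      using that by (elim UnE imageE) (meson Union_upper image_mono subset_trans)+
    then show ?thesis unfolding R_def by blast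
  qed
  have "sym R" unfolding R_def sym_def by blast
  then have symR: "sym (R\<^sup>*)" by (rule sym_rtrancl)
  have cl_eq: "cl a = cl b" if "(a, b) \<in> R\<^sup>*" for a b
  proof -
    have "(b, a) \<in> R\<^sup>*" using that symR by (metis symD)
    then have "(a, c) \<in> R\<^sup>* \<longleftrightarrow> (b, c) \<in> R\<^sup>*" for c using that by (metis rtrancl_trans)
    then show ?thesis unfolding cl_def by auto
  qed
  have self: "a \<in> cl a" for a by (simp add: cl_def)
  have mem_cl: "cl b = cl a" if "b \<in> cl a" for a b
    using cl_eq that unfolding cl_def by blast
  have memK: "cl a = C" if "C \<in> K" "a \<in> C" for a C
  proof -
    obtain c where "C = cl c" using \<open>C \<in> K\<close> K by blast
    then show ?thesis using mem_cl \<open>a \<in> C\<close> by simp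
  qed
  have clV: "cl a \<subseteq> V" if "a \<in> V" for a
  proof
    fix b assume "b \<in> cl a"
    then have "(a, b) \<in> R\<^sup>*" by (simp add: cl_def)
    then show "b \<in> V" by (cases rule: rtranclE) (use that RV in auto)
  qed
  have finL: "finite L" unfolding L_def K V_def by simp
  have count: "card {js :: 'N list. length js = n \<and> compatible \<gamma> is js \<and> compatible \<gamma>' js ks} =
      (if compatible (compose_graphs n \<gamma> \<gamma>') is ks then CARD('N) ^ card L else 0)"
    if len: "length is = n" "length ks = n" for "is" ks :: "'N list"
  proof -
    define f where "f js a = (if fst a = 0 then is else if fst a = 1 then js else ks) ! (snd a - 1)"
      for js :: "'N list" and a :: "nat \<times> nat"
    define J where "J = {js :: 'N list. length js = n \<and> compatible \<gamma> is js \<and> compatible \<gamma>' js ks}"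
    have fu: "f js (upper a) = vertex_label is js a" for js a by (cases a) (simp_all add: f_def)
    have fl: "f js (lower a) = vertex_label js ks a" for js a by (cases a) (simp_all add: f_def)
    have comp: "compatible \<gamma> is js \<and> compatible \<gamma>' js ks \<longleftrightarrow> (\<forall>a b. cl a = cl b \<longrightarrow> f js a = f js b)" for js
    proof -
      have "compatible \<gamma> is js \<and> compatible \<gamma>' js ks \<longleftrightarrow> (\<forall>(a, b)\<in>R. f js a = f js b)"
        unfolding compatible_def R_def fu[symmetric] fl[symmetric] by blast
      also have "\<dots> \<longleftrightarrow> (\<forall>a b. (a, b) \<in> R\<^sup>* \<longrightarrow> f js a = f js b)"
      proof
        assume h: "\<forall>(a, b)\<in>R. f js a = f js b"
        show "\<forall>a b. (a, b) \<in> R\<^sup>* \<longrightarrow> f js a = f js b"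
        proof (intro allI impI)
          fix a b assume "(a, b) \<in> R\<^sup>*"
          then show "f js a = f js b"
            by (induction rule: rtrancl_induct) (use h in auto)
        qed
      next
        assume h: "\<forall>a b. (a, b) \<in> R\<^sup>* \<longrightarrow> f js a = f js b"
        have "f js a = f js b" if "(a, b) \<in> R" for a b
          using h r_into_rtrancl[OF that] by blast
        then show "\<forall>(a, b)\<in>R. f js a = f js b" by blast
      qed
      also have "\<dots> \<longleftrightarrow> (\<forall>a b. cl a = cl b \<longrightarrow> f js a = f js b)"
      proof -
        have "cl a = cl b \<longleftrightarrow> (a, b) \<in> R\<^sup>*" for a b
          using cl_eq[of a b] self[of b] by (auto simp: cl_def)
        then show ?thesis by simp
      qed
      finally show ?thesis .
    qed
    define B where "B = {a \<in> V. fst a \<noteq> 1}"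
    have fB: "f js a = f js' a" if "a \<in> B" for js js' a
      using that by (simp add: B_def f_def)
    have bnd: "compatible (compose_graphs n \<gamma> \<gamma>') is ks \<longleftrightarrow> (\<forall>a\<in>B. \<forall>b\<in>B. cl a = cl b \<longrightarrow> f [] a = f [] b)"
    proof -
      define ends where "ends C = {Vtx i |i. (0, i) \<in> C} \<union> {Bar i |i. (2, i) \<in> C}" for C :: "(nat \<times> nat) set"
      define pos where "pos a = (case a of Vtx i \<Rightarrow> (0, i) | Bar i \<Rightarrow> (2::nat, i))" for a
      have lab: "vertex_label is ks a = f [] (pos a)" for a
        by (cases a) (simp_all add: pos_def f_def)
      have pe: "a \<in> ends C \<longleftrightarrow> pos a \<in> C" for a C
        by (cases a) (auto simp: pos_def ends_def)
      have pB: "a \<in> B \<Longrightarrow> \<exists>x. a = pos x" for a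
      proof -
        assume "a \<in> B"
        then have "a = pos (Vtx (snd a)) \<or> a = pos (Bar (snd a))"
          by (auto simp: B_def V_def pos_def)
        then show ?thesis by blast
      qed
      have posB: "pos x \<in> V \<Longrightarrow> pos x \<in> B" for x
        by (cases x) (auto simp: B_def pos_def)
      have "compatible (compose_graphs n \<gamma> \<gamma>') is ks \<longleftrightarrow>
          (\<forall>C\<in>K - L. \<forall>a\<in>ends C. \<forall>b\<in>ends C. vertex_label is ks a = vertex_label is ks b)"
        unfolding compatible_def compose_graphs_def ends_def[symmetric] K_def L_def by blast
      also have "\<dots> \<longleftrightarrow> (\<forall>C\<in>K - L. \<forall>a\<in>C \<inter> B. \<forall>b\<in>C \<inter> B. f [] a = f [] b)"
      proof -
        have "(\<forall>a\<in>ends C. \<forall>b\<in>ends C. vertex_label is ks a = vertex_label is ks b) \<longleftrightarrow>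
            (\<forall>a\<in>C \<inter> B. \<forall>b\<in>C \<inter> B. f [] a = f [] b)" if "C \<in> K - L" for C
        proof -
          have "C \<subseteq> V" using that K clV by auto
          then show ?thesis unfolding lab pe Ball_def using pB posB by blast
        qed
        then show ?thesis by (rule ball_cong[OF refl])
      qed
      also have "\<dots> \<longleftrightarrow> (\<forall>a\<in>B. \<forall>b\<in>B. cl a = cl b \<longrightarrow> f [] a = f [] b)"
      proof (intro iffI ballI impI)
        fix a b assume h: "\<forall>C\<in>K - L. \<forall>a\<in>C \<inter> B. \<forall>b\<in>C \<inter> B. f [] a = f [] b"
          and ab: "a \<in> B" "b \<in> B" "cl a = cl b"
        have "cl a \<in> K" using ab K by (auto simp: B_def)
        moreover have "cl a \<notin> L" using ab self[of a] by (auto simp: L_def B_def)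
        ultimately show "f [] a = f [] b" using h ab self by blast
      next
        fix C a b assume h: "\<forall>a\<in>B. \<forall>b\<in>B. cl a = cl b \<longrightarrow> f [] a = f [] b"
          and C: "C \<in> K - L" "a \<in> C \<inter> B" "b \<in> C \<inter> B"
        then have "cl a = C" "cl b = C" using memK by blast+
        then have "cl a = cl b" by simp
        then show "f [] a = f [] b" using h C by blast
      qed
      finally show ?thesis .
    qed
    show ?thesis
    proof (cases "compatible (compose_graphs n \<gamma> \<gamma>') is ks")
      case False
      then obtain a b where ab: "a \<in> B" "b \<in> B" "cl a = cl b" "f [] a \<noteq> f [] b"
        using bnd by blast
      have "js \<notin> J" for js
      proof
        assume "js \<in> J"
        then have "f js a = f js b" using ab(3) unfolding J_def comp by blast
        then show False using fB[OF ab(1), of js "[]"] fB[OF ab(2), of js "[]"] ab(4) by simp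
      qed
      then have "J = {}" by blast
      then show ?thesis using False unfolding J_def[symmetric] by simp
    next
      case True
      define \<Phi> where "\<Phi> js = (\<lambda>C\<in>L. f js (SOME a. a \<in> C))" for js
      define val where "val h a = (if cl a \<in> L then h (cl a) else f [] (SOME b. b \<in> B \<and> cl b = cl a))"
        for h :: "(nat \<times> nat) set \<Rightarrow> 'N" and a
      define \<Psi> where "\<Psi> h = map (\<lambda>i. val h (1, i)) [1..<n + 1]" for h
      have someL: "cl (SOME a. a \<in> C) = C" if "C \<in> L" for C
      proof -
        obtain a where "C = cl a" using \<open>C \<in> L\<close> unfolding L_def K by blast
        then have "(SOME a. a \<in> C) \<in> C" using self[of a] someI[of "\<lambda>a. a \<in> C" a] by blast
        then show ?thesis using memK that by (simp add: L_def)
      qed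
      have ex: "\<exists>b. b \<in> B \<and> cl b = cl a" if "a \<in> V" "cl a \<notin> L" for a
      proof -
        have "cl a \<in> K" using that K by blast
        then obtain b where b: "b \<in> cl a" "b \<notin> {1} \<times> {1..n}" using \<open>cl a \<notin> L\<close> unfolding L_def by blast
        then have "b \<in> B" using clV[OF that(1)] by (cases b) (auto simp: B_def V_def)
        then show ?thesis using b mem_cl by blast
      qed
      have some: "(SOME b. b \<in> B \<and> cl b = cl a) \<in> B \<and> cl (SOME b. b \<in> B \<and> cl b = cl a) = cl a"
        if "a \<in> V" "cl a \<notin> L" for a
        using someI_ex[OF ex[OF that]] .
      have mid: "\<exists>i\<in>{1..n}. a = (1, i)" if "a \<in> V - B" for a
        using that by (cases a) (auto simp: B_def V_def)
      have f\<Psi>: "f (\<Psi> h) a = val h a" if "a \<in> V" for h a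
      proof (cases "a \<in> B")
        case aB: True
        then have L: "cl a \<notin> L" using self[of a] by (auto simp: L_def B_def)
        have "f [] (SOME b. b \<in> B \<and> cl b = cl a) = f [] a"
          using True[unfolded bnd, rule_format, of "SOME b. b \<in> B \<and> cl b = cl a" a]
            aB some[OF that L] by blast
        then show ?thesis using fB[OF aB, of "\<Psi> h" "[]"] L by (simp add: val_def)
      next
        case False
        then obtain i where i: "i \<in> {1..n}" "a = (1, i)" using mid[of a] \<open>a \<in> V\<close> by blast
        then have "i - 1 < n" "1 + (i - 1) = i" by auto
        then show ?thesis using i by (simp add: f_def \<Psi>_def nth_upt del: upt_Suc)
      qed
      have fV: "cl a = cl b \<Longrightarrow> a \<notin> V \<Longrightarrow> a = b" for a b
      proof -
        assume h: "cl a = cl b" "a \<notin> V"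
        then have "b \<in> cl a" using self[of b] by simp
        then have "(a, b) \<in> R\<^sup>*" by (simp add: cl_def)
        then show "a = b" by (cases rule: converse_rtranclE) (use h RV in auto)
      qed
      have "bij_betw \<Phi> J (L \<rightarrow>\<^sub>E UNIV)"
      proof (rule bij_betw_byWitness[where f' = \<Psi>])
        show "\<forall>js\<in>J. \<Psi> (\<Phi> js) = js"
        proof
          fix js assume js: "js \<in> J"
          then have c: "cl a = cl b \<Longrightarrow> f js a = f js b" for a b
            unfolding J_def comp by blast
          show "\<Psi> (\<Phi> js) = js"
          proof (rule nth_equalityI)
            show "length (\<Psi> (\<Phi> js)) = length js" using js by (simp add: J_def \<Psi>_def)
          next
            fix p assume "p < length (\<Psi> (\<Phi> js))"
            then have p: "(1, p + 1) \<in> V" by (simp add: V_def \<Psi>_def del: upt_Suc)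
            let ?a = "(1, p + 1) :: nat \<times> nat"
            have "val (\<Phi> js) ?a = f js ?a"
            proof (cases "cl ?a \<in> L")
              case True
              then show ?thesis using c[OF someL[OF True]] by (simp add: val_def \<Phi>_def)
            next
              case False
              let ?b = "SOME b. b \<in> B \<and> cl b = cl ?a"
              have "f js ?b = f [] ?b" by (rule fB) (use some[OF p False] in blast)
              moreover have "f js ?b = f js ?a" by (rule c) (use some[OF p False] in blast)
              ultimately show ?thesis using False by (simp add: val_def)
            qed
            then show "\<Psi> (\<Phi> js) ! p = js ! p"
              using f\<Psi>[OF p, of "\<Phi> js"] by (simp add: f_def)
          qed
        qed
        show "\<forall>h\<in>L \<rightarrow>\<^sub>E UNIV. \<Phi> (\<Psi> h) = h"
        proof (intro ballI ext)
          fix h C assume h: "h \<in> L \<rightarrow>\<^sub>E (UNIV :: 'N set)"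
          show "\<Phi> (\<Psi> h) C = h C"
          proof (cases "C \<in> L")
            case True
            let ?a = "SOME a. a \<in> C"
            obtain a where a: "a \<in> V" "C = cl a" using True unfolding L_def K by blast
            have "?a \<in> V" using someL[OF True] self[of ?a] clV[OF a(1)] a(2) by auto
            then show ?thesis
              using True someL[OF True] f\<Psi>[of ?a h] by (simp add: \<Phi>_def val_def)
          next
            case False
            then show ?thesis using h by (auto simp: \<Phi>_def PiE_def extensional_def)
          qed
        qed
        show "\<Phi> ` J \<subseteq> L \<rightarrow>\<^sub>E UNIV" by (auto simp: \<Phi>_def)
        show "\<Psi> ` (L \<rightarrow>\<^sub>E UNIV) \<subseteq> J"
        proof
          fix js assume "js \<in> \<Psi> ` (L \<rightarrow>\<^sub>E UNIV)"
          then obtain h where h: "js = \<Psi> h" by blast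
          have "f js a = f js b" if "cl a = cl b" for a b
          proof (cases "a \<in> V \<and> b \<in> V")
            case True
            then show ?thesis using f\<Psi>[of a h] f\<Psi>[of b h] that by (simp add: h val_def)
          next
            case False
            then show ?thesis using fV that by metis
          qed
          then have "\<forall>a b. cl a = cl b \<longrightarrow> f js a = f js b" by (intro allI impI)
          moreover have "length js = n" by (simp add: h \<Psi>_def del: upt_Suc)
          ultimately show "js \<in> J" unfolding J_def comp mem_Collect_eq by (intro conjI)
        qed
      qed
      then have "card J = card (L \<rightarrow>\<^sub>E (UNIV :: 'N set))" by (rule bij_betw_same_card)
      then show ?thesis using True finL unfolding J_def[symmetric] by (simp add: card_PiE)
    qed
  qed
  have loops: "loops n \<gamma> \<gamma>' = card L" by (simp add: loops_def L_def K_def)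
  have fin: "finite {js :: 'N list. length js = n}"
    using finite_lists_length_eq[of "UNIV :: 'N set" n] by simp
  show ?thesis
  proof
    fix "is" :: "'N list"
    show "graph_op n \<gamma> (graph_op n \<gamma>' t) is =
        (of_nat CARD('N) ^ loops n \<gamma> \<gamma>' *\<^sub>C graph_op n (compose_graphs n \<gamma> \<gamma>') t) is"
    proof (cases "length is = n")
      case True
      have "graph_op n \<gamma> (graph_op n \<gamma>' t) is =
          (\<Sum>js | length js = n. \<Sum>ks | length ks = n.
            of_bool (compatible \<gamma> is js \<and> compatible \<gamma>' js ks) * t ks)"
        unfolding graph_op_def using True
        by (simp add: sum_distrib_left of_bool_conj mult.assoc)
      also have "\<dots> = (\<Sum>ks | length ks = n. \<Sum>js | length js = n.
            of_bool (compatible \<gamma> is js \<and> compatible \<gamma>' js ks) * t ks)"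
        by (rule sum.swap)
      also have "\<dots> = (\<Sum>ks | length ks = n.
          of_nat CARD('N) ^ card L * (of_bool (compatible (compose_graphs n \<gamma> \<gamma>') is ks) * t ks))"
      proof (intro sum.cong refl)
        fix ks :: "'N list" assume ks: "ks \<in> {ks. length ks = n}"
        have "(\<Sum>js | length js = n. of_bool (compatible \<gamma> is js \<and> compatible \<gamma>' js ks)) =
            (of_nat (card {js :: 'N list. length js = n \<and> compatible \<gamma> is js \<and> compatible \<gamma>' js ks}) :: complex)"
          using fin by (simp add: of_bool_def sum.If_cases Int_def conj_assoc)
        then show "(\<Sum>js | length js = n. of_bool (compatible \<gamma> is js \<and> compatible \<gamma>' js ks) * t ks) =
            of_nat CARD('N) ^ card L * (of_bool (compatible (compose_graphs n \<gamma> \<gamma>') is ks) * t ks)"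
          using count[OF True, of ks] ks by (simp add: sum_distrib_right[symmetric])
      qed
      also have "\<dots> = (of_nat CARD('N) ^ loops n \<gamma> \<gamma>' *\<^sub>C graph_op n (compose_graphs n \<gamma> \<gamma>') t) is"
        using True by (simp add: graph_op_def scaleC_fun_def scaleC_complex_def loops sum_distrib_left)
      finally show ?thesis .
    qed (simp add: graph_op_def scaleC_fun_def scaleC_complex_def)
  qed
qed


section \<open>The modules \<open>U(\<lambda>, N)\<close> and \<open>V(\<lambda>, n)\<close>\<close>

definition traceless :: "nat \<Rightarrow> 'N::finite tensor set"
  where "traceless m =
    {t \<in> tensors m. \<forall>k\<in>{1..m}. \<forall>l\<in>{1..m}. k \<noteq> l \<longrightarrow> brauer_op m (brauer_bar m k l) t = 0}"

text \<open>
  The multiplicity space of the Specht module in the traceless tensors; the orthogonal group acts on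
  it by composition.
\<close>

type_synonym 'N weyl = "((nat \<Rightarrow> nat) \<Rightarrow> complex) \<Rightarrow> 'N tensor"

definition weyl_module :: "diagram \<Rightarrow> 'N::finite weyl set"
  where "weyl_module D =
    Hom (symmetric_group (card D)) specht_act (specht D)
      (\<lambda>s. brauer_op (card D) (brauer_perm (card D) s)) (traceless (card D))"

definition weyl_act :: "complex^'N^'N \<Rightarrow> 'N::finite weyl \<Rightarrow> 'N weyl"
  where "weyl_act g f = tensor_act g \<circ> f"

text \<open>
  The multiplicity space of \<open>weyl_module D\<close> in \<open>tensors n\<close>, on which operators on tensors act by
  composition.
\<close>

type_synonym 'N mult = "'N weyl \<Rightarrow> 'N tensor"

definition mult_module :: "nat \<Rightarrow> diagram \<Rightarrow> 'N::finite mult set"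
  where "mult_module n D = Hom orthogonal_group weyl_act (weyl_module D) tensor_act (tensors n)"

definition centralizer_act :: "nat \<Rightarrow> ('N tensor \<Rightarrow> 'N tensor) \<Rightarrow> 'N mult \<Rightarrow> 'N mult"
  where "centralizer_act k A f = extend_op k A \<circ> f"

definition brauer_act :: "nat \<Rightarrow> brauer \<Rightarrow> 'N::finite mult \<Rightarrow> 'N mult"
  where "brauer_act n a f = brauer_op n a \<circ> f"

text \<open>
  The component \<open>V(\<mu>, k)\<close> in the restriction of \<open>V(\<lambda>, n)\<close> to \<open>C(k, N)\<close>. For \<open>k < n - 1\<close> the module
  \<open>V(\<mu>, k)\<close> may occur several times there, and the component contains all its copies.
\<close>

definition restriction_component :: "nat \<Rightarrow> diagram \<Rightarrow> nat \<Rightarrow> diagram \<Rightarrow> 'N::finite mult set"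
  where "restriction_component n D k E =
    isotypic_component (centralizer_algebra k) (centralizer_act k) (mult_module k E)
      (centralizer_act k) (mult_module n D)"


section \<open>The canonical basis\<close>

text \<open>
  Paths carry the additional term \<open>\<Lambda>(0)\<close>, which is the empty diagram as \<open>\<O> 0 N = {{}}\<close>; above \<open>n\<close> they
  take the dummy value \<open>undefined\<close>.
\<close>

type_synonym path = "nat \<Rightarrow> diagram"

definition paths :: "nat \<Rightarrow> nat \<Rightarrow> diagram \<Rightarrow> path set"  (\<open>\<L>\<close>)
  where "\<L> n N D =
    {\<Lambda> \<in> (\<Pi>\<^sub>E k\<in>{0..n}. \<O> k N). \<Lambda> n = D \<and> (\<forall>k<n. differ_by_box (\<Lambda> k) (\<Lambda> (k + 1)))}"

definition canonical_basis :: "nat \<Rightarrow> diagram \<Rightarrow> (path \<Rightarrow> 'N::finite mult) \<Rightarrow> bool"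
  where "canonical_basis n D v \<longleftrightarrow>
    inj_on v (\<L> n CARD('N) D) \<and>
    complex_vector.independent (v ` \<L> n CARD('N) D) \<and>
    complex_vector.span (v ` \<L> n CARD('N) D) = mult_module n D \<and>
    (\<forall>\<Lambda>\<in>\<L> n CARD('N) D. \<forall>k\<in>{1..<n}. v \<Lambda> \<in> restriction_component n D k (\<Lambda> k))"

definition x_eigenvalue :: "nat \<Rightarrow> (path \<Rightarrow> 'N::finite mult) \<Rightarrow> nat \<Rightarrow> path \<Rightarrow> complex"
  where "x_eigenvalue n v k \<Lambda> =
    (THE c. brauer_act n (brauer_x n CARD('N) k) (v \<Lambda>) = c *\<^sub>C v \<Lambda>)"

definition local_space :: "nat \<Rightarrow> diagram \<Rightarrow> (path \<Rightarrow> 'N::finite mult) \<Rightarrow> path \<Rightarrow> nat \<Rightarrow> 'N mult set"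
  where "local_space n D v \<Lambda> k =
    complex_vector.span (v ` {\<Lambda>' \<in> \<L> n CARD('N) D. \<forall>l. l \<noteq> k \<longrightarrow> \<Lambda>' l = \<Lambda> l})"

text \<open>
  The coefficient of \<open>v(\<Lambda>')\<close> in the expansion of \<open>s\<^sub>k \<cdot> v(\<Lambda>)\<close>; the first path is thus the column index.
\<close>

definition s_coeff :: "nat \<Rightarrow> diagram \<Rightarrow> (path \<Rightarrow> 'N::finite mult) \<Rightarrow> nat \<Rightarrow> path \<Rightarrow> path \<Rightarrow> complex"
  where "s_coeff n D v k \<Lambda> \<Lambda>' =
    complex_vector.representation (v ` \<L> n CARD('N) D) (brauer_act n (brauer_s n k) (v \<Lambda>)) (v \<Lambda>')"

end

theory Submission
  imports Defs
begin

text \<open>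
  In the Brauer algebra \<open>s\<^sub>k x\<^sub>k - x\<^sub>k\<^sub>+\<^sub>1 s\<^sub>k = \<epsilon> - 1\<close> with \<open>\<epsilon> = \<epsilon> s\<^sub>k\<close> the bar element of \<open>k, k+1\<close>. The
  map \<open>\<epsilon>\<close> factors through the tensor power of order \<open>k-1\<close>, so on \<open>v(\<Lambda>)\<close> it is an equivariant map between
  the types \<open>\<Lambda>(k-1)\<close> and \<open>\<Lambda>(k+1)\<close>, which is \<open>0\<close> as these differ. Since \<open>s\<^sub>k\<close> commutes with \<open>C(l,N)\<close> for
  \<open>l < k\<close> and belongs to it for \<open>l > k\<close>, only paths that agree with \<open>\<Lambda>\<close> off \<open>k\<close> occur in \<open>s\<^sub>k v(\<Lambda>)\<close>; there
  are at most two, because the two boxes in which \<open>\<Lambda>(k-1)\<close> and \<open>\<Lambda>(k+1)\<close> differ can be passed in two orders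
  only. The relation gives the diagonal entry \<open>1/(x\<^sub>k\<^sub>+\<^sub>1(\<Lambda>) - x\<^sub>k(\<Lambda>))\<close> of \<open>s\<^sub>k\<close>, and then \<open>s\<^sub>k\<^sup>2 = 1\<close> gives the
  product of the other two.

  That the isotypic components of different diagrams are disjoint is proved from the first fundamental
  theorem for \<open>O(N)\<close> (invariant tensors are spanned by pairings): an equivariant form on traceless
  tensors only sees permutations, and products of Young symmetrizers of different shapes vanish.
  Since \<open>G\<close> is closed under adjoints, orthogonal projections replace complete reducibility throughout.
\<close>

section \<open>Orthogonal projections\<close>

text \<open>The canonical basis is described by \<open>C(l,N)\<close>-isotypic components, whereas
  disjointness is a statement about \<open>O(N)\<close>-types of tensors. The bridge is the
  orthogonal projection onto the tensors of type E in the l-th power: it lies in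
  \<open>C(l,N)\<close>, is the identity on V(E,l) and therefore on every copy of it, and it kills
  the other types. Components thus turn into fixed-point equations, one for each level l, and a path
  is determined by the equations that its vector satisfies. The x_k commute with the projections of
  all levels, which is why the v(\<Lambda>) are eigenvectors; s_k commutes with those of all levels
  except k. The standard Hermitian form is invariant under real orthogonal matrices only, while G is
  complex. Projections cope with this through adjoints. The fundamental theorem copes with it by
  using only real generators, the diagonal reflections and the derivatives E_ij - E_ji of rotations.
  After the part in the span of pairings is split off, induction makes all contractions of the
  remainder vanish, and a norm estimate in the spirit of a Casimir element shows that a traceless
  invariant of positive degree is zero.\<close>

lemma scaleC_apply: "(c *\<^sub>C f) x = c * f x" for f :: "'a \<Rightarrow> complex"
  by (simp add: scaleC_fun_def scaleC_complex_def)

text \<open>One encoding of a finite-dimensional coordinate space serves for tensors, for arrays on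
  labelings and for functions on tabloids. For finite \<open>I\<close> the form
  \<open>cinner I\<close> is positive definite on it.\<close>

definition supp_on :: "'a set \<Rightarrow> ('a \<Rightarrow> complex) set"
  where "supp_on I = {f. \<forall>i. i \<notin> I \<longrightarrow> f i = 0}"

definition cinner :: "'a set \<Rightarrow> ('a \<Rightarrow> complex) \<Rightarrow> ('a \<Rightarrow> complex) \<Rightarrow> complex"
  where "cinner I f g = (\<Sum>i\<in>I. f i * cnj (g i))"

lemma cinner_add_left: "cinner I (f + g) h = cinner I f h + cinner I g h"
  and cinner_diff_left: "cinner I (f - g) h = cinner I f h - cinner I g h"
  and cinner_add_right: "cinner I h (f + g) = cinner I h f + cinner I h g"
  and cinner_diff_right: "cinner I h (f - g) = cinner I h f - cinner I h g"
  and cinner_scaleC_left: "cinner I (c *\<^sub>C f) h = c * cinner I f h"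
  and cinner_scaleC_right: "cinner I h (c *\<^sub>C f) = cnj c * cinner I h f"
  and cinner_zero_left: "cinner I 0 h = 0"
  and cinner_zero_right: "cinner I h 0 = 0"
  by (simp_all add: cinner_def scaleC_apply algebra_simps sum.distrib sum_subtractf sum_distrib_left)

lemma fun_sum_apply [simp]: "(\<Sum>a\<in>A. f a) x = (\<Sum>a\<in>A. f a x)"
  by (induction A rule: infinite_finite_induct) simp_all

lemma cinner_sum_left: "cinner I (\<Sum>a\<in>A. f a) h = (\<Sum>a\<in>A. cinner I (f a) h)"
  unfolding cinner_def by (subst sum.swap) (simp add: sum_distrib_right)

lemma cinner_sum_right: "cinner I h (\<Sum>a\<in>A. f a) = (\<Sum>a\<in>A. cinner I h (f a))"
  unfolding cinner_def by (subst sum.swap) (simp add: sum_distrib_left)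

lemma cinner_commute: "cinner I g f = cnj (cinner I f g)"
  by (simp add: cinner_def mult.commute)

lemma cinner_self: "cinner I f f = of_real (\<Sum>i\<in>I. (cmod (f i))\<^sup>2)"
  by (simp add: cinner_def complex_norm_square flip: of_real_power)

lemma cinner_self_eq_0:
  assumes "finite I" "cinner I f f = 0" "i \<in> I"
  shows "f i = 0"
proof -
  have "(\<Sum>i\<in>I. (cmod (f i))\<^sup>2) = 0"
    using assms(2) unfolding cinner_self of_real_eq_0_iff .
  then show ?thesis
    using assms(1,3) by (simp add: sum_nonneg_eq_0_iff)
qed

lemma supp_on_eq_0: "f \<in> supp_on I \<Longrightarrow> finite I \<Longrightarrow> cinner I f f = 0 \<Longrightarrow> f = 0"
  using cinner_self_eq_0[of I f] by (auto simp: supp_on_def fun_eq_iff)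

lemma subspace_supp_on: "complex_vector.subspace (supp_on I)"
  by (simp add: complex_vector.subspace_def supp_on_def scaleC_apply)

lemma cinner_span_right:
  assumes "\<And>b. b \<in> B \<Longrightarrow> cinner I t b = 0" "s \<in> complex_vector.span B"
  shows "cinner I t s = 0"
proof -
  have "complex_vector.subspace {s. cinner I t s = 0}"
    by (simp add: complex_vector.subspace_def cinner_zero_right cinner_add_right cinner_scaleC_right)
  then show ?thesis
    using complex_vector.span_minimal[of B "{s. cinner I t s = 0}"] assms by blast
qed

lemma cinner_span_left:
  assumes "\<And>b. b \<in> B \<Longrightarrow> cinner I b t = 0" "s \<in> complex_vector.span B"
  shows "cinner I s t = 0"
proof -
  have "cinner I t s = 0"
    by (rule cinner_span_right[OF _ assms(2)]) (subst cinner_commute, simp add: assms(1))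
  then show ?thesis by (subst cinner_commute) simp
qed

text \<open>Gram-Schmidt: of a new generator \<open>v\<close> only its part \<open>w\<close>
  orthogonal to the old span matters, and \<open>t\<close> is corrected by its component along
  \<open>w\<close>.\<close>

lemma orthogonal_decomposition_finite:
  assumes "finite B" "finite I"
  shows "\<exists>s\<in>complex_vector.span B. \<forall>b\<in>complex_vector.span B. cinner I (t - s) b = 0"
  using assms(1)
proof (induction B arbitrary: t rule: finite_induct)
  case empty
  have "\<forall>b\<in>complex_vector.span {}. cinner I (t - 0) b = 0"
    by (simp add: cinner_zero_right complex_vector.span_empty)
  then show ?case using complex_vector.span_zero by blast
next
  case (insert v B)
  obtain p where p: "p \<in> complex_vector.span B" "\<And>b. b \<in> complex_vector.span B \<Longrightarrow> cinner I (v - p) b = 0"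
    using insert.IH by meson
  obtain s where s: "s \<in> complex_vector.span B" "\<And>b. b \<in> complex_vector.span B \<Longrightarrow> cinner I (t - s) b = 0"
    using insert.IH by meson
  define w where "w = v - p"
  define c where "c = cinner I t w / cinner I w w"
  have sub: "complex_vector.span B \<subseteq> complex_vector.span (insert v B)"
    by (rule complex_vector.span_mono) auto
  have vin: "v \<in> complex_vector.span (insert v B)" by (simp add: complex_vector.span_base)
  have win: "w \<in> complex_vector.span (insert v B)"
    unfolding w_def using p(1) sub vin by (blast intro: complex_vector.span_diff)
  have sw: "cinner I s w = 0"
    using p(2)[OF s(1)] by (subst cinner_commute) (simp add: w_def)
  \<comment> \<open>The norm of \<open>w\<close> vanishes when \<open>w\<close> is zero on
    \<open>I\<close>, for instance if \<open>v\<close> already lies in the old span. Then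
    \<open>c\<close> is the default value of a division by zero, and the form with \<open>w\<close>
    is zero anyway.\<close>
  have tw: "cinner I (t - (s + c *\<^sub>C w)) w = 0"
  proof (cases "cinner I w w = 0")
    case True
    then have "w i = 0" if "i \<in> I" for i
      using cinner_self_eq_0[OF assms(2) _ that] by blast
    then show ?thesis by (simp add: cinner_def)
  next
    case False
    then show ?thesis
      by (simp add: cinner_diff_left cinner_add_left cinner_scaleC_left sw c_def)
  qed
  show ?case
  proof (intro bexI ballI)
    show "s + c *\<^sub>C w \<in> complex_vector.span (insert v B)"
      using s(1) sub win by (blast intro: complex_vector.span_add complex_vector.span_scale)
    fix b assume "b \<in> complex_vector.span (insert v B)"
    then obtain k where k: "b - k *\<^sub>C v \<in> complex_vector.span B"
      by (auto simp: complex_vector.span_insert)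
    define b0 where "b0 = b - k *\<^sub>C v + k *\<^sub>C p"
    have b0: "b0 \<in> complex_vector.span B"
      unfolding b0_def using k p(1) by (blast intro: complex_vector.span_add complex_vector.span_scale)
    have b: "b = b0 + k *\<^sub>C w"
      by (simp add: b0_def w_def fun_eq_iff scaleC_apply algebra_simps)
    have "cinner I (t - (s + c *\<^sub>C w)) b0 = 0"
      using s(2)[OF b0] p(2)[OF b0]
      by (simp add: cinner_diff_left cinner_add_left cinner_scaleC_left w_def)
    then show "cinner I (t - (s + c *\<^sub>C w)) b = 0"
      using tw by (simp add: b cinner_add_right cinner_scaleC_right)
  qed
qed

lemma supp_on_finite_span:
  assumes "finite I"
  shows "supp_on I \<subseteq> complex_vector.span ((\<lambda>i j. of_bool (j = i)) ` I)"
proof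
  fix f assume f: "f \<in> supp_on I"
  have e: "f = (\<Sum>i\<in>I. f i *\<^sub>C (\<lambda>j. of_bool (j = i)))"
  proof
    fix j
    have "(\<Sum>i\<in>I. f i *\<^sub>C (\<lambda>j. of_bool (j = i))) j = (\<Sum>i\<in>I. if i = j then f i else 0)"
      by (simp add: scaleC_apply) (intro sum.cong, auto)
    also have "\<dots> = f j" using f assms by (simp add: supp_on_def)
    finally show "f j = (\<Sum>i\<in>I. f i *\<^sub>C (\<lambda>j. of_bool (j = i))) j" by simp
  qed
  show "f \<in> complex_vector.span ((\<lambda>i j. of_bool (j = i)) ` I)"
    by (subst e) (intro complex_vector.span_sum complex_vector.span_scale complex_vector.span_base imageI)
qed

lemma finite_basis_exists:
  assumes "finite I" "complex_vector.subspace S" "S \<subseteq> supp_on I"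
  obtains B where "finite B" "complex_vector.independent B" "B \<subseteq> S" "complex_vector.span B = S"
proof -
  obtain B where B: "B \<subseteq> S" "complex_vector.independent B" "S \<subseteq> complex_vector.span B"
    by (rule complex_vector.maximal_independent_subset[of S])
  have "B \<subseteq> complex_vector.span ((\<lambda>i j. of_bool (j = i)) ` I)"
    by (rule order_trans[OF order_trans[OF B(1) assms(3)] supp_on_finite_span[OF assms(1)]])
  then have "finite B"
    using complex_vector.independent_span_bound[OF finite_imageI[OF assms(1)] B(2)] by simp
  moreover have "complex_vector.span B = S"
    by (rule complex_vector.span_subspace[OF B(1,3) assms(2)])
  ultimately show ?thesis using that[OF _ B(2,1)] by simp
qed

section \<open>The orthogonal projection onto a subspace\<close>

lemma orthogonal_decomposition:
  assumes "finite I" "complex_vector.subspace S" "S \<subseteq> supp_on I"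
  shows "\<exists>s\<in>S. \<forall>b\<in>S. cinner I (t - s) b = 0"
proof -
  obtain B where "finite B" "complex_vector.span B = S"
    by (rule finite_basis_exists[OF assms])
  then show ?thesis using orthogonal_decomposition_finite[of B I t] assms(1) by simp
qed

text \<open>The value 0 off the coordinate space matches the convention of \<open>Hom\<close>, so
  that equivariant projections are elements of \<open>centralizer_algebra\<close>.\<close>

definition oproj :: "'a set \<Rightarrow> ('a \<Rightarrow> complex) set \<Rightarrow> ('a \<Rightarrow> complex) \<Rightarrow> 'a \<Rightarrow> complex"
  where "oproj I S t = (if t \<in> supp_on I then SOME s. s \<in> S \<and> (\<forall>b\<in>S. cinner I (t - s) b = 0) else 0)"

context
  fixes I :: "'a set" and S :: "('a \<Rightarrow> complex) set"
  assumes I: "finite I" and S: "complex_vector.subspace S" "S \<subseteq> supp_on I"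
begin

lemma oproj_in: "oproj I S t \<in> S"
  and oproj_orthogonal: "t \<in> supp_on I \<Longrightarrow> b \<in> S \<Longrightarrow> cinner I (t - oproj I S t) b = 0"
proof -
  have *: "t \<in> supp_on I \<Longrightarrow> oproj I S t \<in> S \<and> (\<forall>b\<in>S. cinner I (t - oproj I S t) b = 0)"
    using someI_ex[OF orthogonal_decomposition[OF I S, of t, unfolded Bex_def]] by (simp add: oproj_def)
  show "t \<in> supp_on I \<Longrightarrow> b \<in> S \<Longrightarrow> cinner I (t - oproj I S t) b = 0"
    using * by blast
  show "oproj I S t \<in> S"
    using * S by (cases "t \<in> supp_on I") (auto simp: oproj_def complex_vector.subspace_0)
qed

lemma oproj_eqI:
  assumes "t \<in> supp_on I" "s \<in> S" "\<And>b. b \<in> S \<Longrightarrow> cinner I (t - s) b = 0"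
  shows "oproj I S t = s"
proof -
  have d: "oproj I S t - s \<in> S"
    using oproj_in assms(2) S(1) by (simp add: complex_vector.subspace_diff)
  have "cinner I (t - s) (oproj I S t - s) - cinner I (t - oproj I S t) (oproj I S t - s) = 0"
    using assms(3)[OF d] oproj_orthogonal[OF assms(1) d] by simp
  then have "cinner I (oproj I S t - s) (oproj I S t - s) = 0"
    by (simp add: cinner_diff_left)
  then show ?thesis
    using supp_on_eq_0[OF subsetD[OF S(2) d] I] by simp
qed

lemma linear_on_oproj: "linear_on (supp_on I) (oproj I S)"
  unfolding linear_on_def
proof (intro conjI ballI allI)
  fix x y assume xy: "x \<in> supp_on I" "y \<in> supp_on I"
  show "oproj I S (x + y) = oproj I S x + oproj I S y"
  proof (rule oproj_eqI)
    show "x + y \<in> supp_on I" using xy by (simp add: complex_vector.subspace_add subspace_supp_on)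
    show "oproj I S x + oproj I S y \<in> S" by (simp add: S oproj_in complex_vector.subspace_add)
    fix b assume "b \<in> S"
    then show "cinner I (x + y - (oproj I S x + oproj I S y)) b = 0"
      using oproj_orthogonal[OF xy(1), of b] oproj_orthogonal[OF xy(2), of b]
      by (simp add: cinner_diff_left cinner_add_left)
  qed
next
  fix c x assume x: "x \<in> supp_on I"
  show "oproj I S (c *\<^sub>C x) = c *\<^sub>C oproj I S x"
  proof (rule oproj_eqI)
    show "c *\<^sub>C x \<in> supp_on I" using x by (simp add: complex_vector.subspace_scale subspace_supp_on)
    show "c *\<^sub>C oproj I S x \<in> S" by (simp add: S oproj_in complex_vector.subspace_scale)
    fix b assume "b \<in> S"
    then show "cinner I (c *\<^sub>C x - c *\<^sub>C oproj I S x) b = 0"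
      using oproj_orthogonal[OF x, of b]
      by (simp add: cinner_diff_left cinner_scaleC_left)
  qed
qed

lemma oproj_id: "t \<in> S \<Longrightarrow> oproj I S t = t"
  using oproj_eqI[of t t] S by (auto simp: cinner_zero_left)

lemma oproj_eq_0: "t \<in> supp_on I \<Longrightarrow> (\<And>b. b \<in> S \<Longrightarrow> cinner I t b = 0) \<Longrightarrow> oproj I S t = 0"
  using oproj_eqI[of t 0] S by (simp add: complex_vector.subspace_0)

end

section \<open>Invariant arrays are spanned by pairings\<close>

text \<open>Positions form an arbitrary set of numbers, so that deleting two of them in a
  contraction requires no renumbering.\<close>

definition assigns :: "nat set \<Rightarrow> (nat \<Rightarrow> 'N) set"
  where "assigns A = (A \<rightarrow>\<^sub>E UNIV)"

text \<open>The matrix unit E_ij acting by the Leibniz rule on a tensor power of the standard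
  module, in coordinates.\<close>

definition dop :: "nat set \<Rightarrow> 'N \<Rightarrow> 'N \<Rightarrow> ((nat \<Rightarrow> 'N) \<Rightarrow> complex) \<Rightarrow> (nat \<Rightarrow> 'N) \<Rightarrow> complex"
  where "dop A i j K x = (\<Sum>p\<in>A. of_bool (x p = i) * K (x(p := j)))"

text \<open>Invariance under \<open>O(N)\<close> in the form that is checked on generators: diagonal
  reflections force every label to occur an even number of times, and the elements E_ij - E_ji of
  so(N) act as zero.\<close>

definition so_invariant :: "nat set \<Rightarrow> ((nat \<Rightarrow> 'N) \<Rightarrow> complex) \<Rightarrow> bool"
  where "so_invariant A K \<longleftrightarrow> K \<in> supp_on (assigns A) \<and>
    (\<forall>x\<in>assigns A. \<forall>i. odd (card {p \<in> A. x p = i}) \<longrightarrow> K x = 0) \<and>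
    (\<forall>x\<in>assigns A. \<forall>i j. dop A i j K x = dop A j i K x)"

definition pairing :: "nat set \<Rightarrow> (nat \<Rightarrow> nat) \<Rightarrow> bool"
  where "pairing A \<pi> \<longleftrightarrow> (\<forall>p\<in>A. \<pi> p \<in> A \<and> \<pi> p \<noteq> p \<and> \<pi> (\<pi> p) = p)"

definition pair_tensor :: "nat set \<Rightarrow> (nat \<Rightarrow> nat) \<Rightarrow> (nat \<Rightarrow> 'N) \<Rightarrow> complex"
  where "pair_tensor A \<pi> x = of_bool (x \<in> assigns A \<and> (\<forall>p\<in>A. x (\<pi> p) = x p))"

definition contraction :: "nat \<Rightarrow> nat \<Rightarrow> nat set \<Rightarrow> ((nat \<Rightarrow> 'N) \<Rightarrow> complex) \<Rightarrow> (nat \<Rightarrow> 'N::finite) \<Rightarrow> complex"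
  where "contraction p q A K y = (if y \<in> assigns (A - {p, q}) then \<Sum>a\<in>UNIV. K (y(p := a, q := a)) else 0)"

section \<open>Sums over labelings and traceless invariants\<close>

lemma finite_assigns [simp]: "finite A \<Longrightarrow> finite (assigns A :: (nat \<Rightarrow> 'N::finite) set)"
  by (simp add: assigns_def finite_PiE)

lemma assigns_upd: "x \<in> assigns A \<Longrightarrow> p \<in> A \<Longrightarrow> x(p := a) \<in> assigns A"
  by (auto simp: assigns_def PiE_def extensional_def)

lemma assigns_upd2: "y \<in> assigns (A - {p, q}) \<Longrightarrow> p \<in> A \<Longrightarrow> q \<in> A \<Longrightarrow> y(p := a, q := b) \<in> assigns A"
  by (auto simp: assigns_def PiE_def extensional_def)

lemma sum_assigns_split2:
  fixes f :: "(nat \<Rightarrow> 'N::finite) \<Rightarrow> complex"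
  assumes "p \<in> A" "q \<in> A" "p \<noteq> q"
  shows "(\<Sum>x\<in>assigns A. f x) = (\<Sum>y\<in>assigns (A - {p, q}). \<Sum>a\<in>UNIV. \<Sum>b\<in>UNIV. f (y(p := a, q := b)))"
proof -
  have "(\<Sum>x\<in>assigns A. f x) =
      (\<Sum>(y, a, b)\<in>assigns (A - {p, q}) \<times> UNIV \<times> UNIV. f (y(p := a, q := b)))"
    by (rule sum.reindex_bij_witness[where i = "\<lambda>(y, a, b). y(p := a, q := b)"
          and j = "\<lambda>x. (x(p := undefined, q := undefined), x p, x q)"])
      (use assms in \<open>auto simp: assigns_def PiE_def extensional_def fun_eq_iff\<close>)
  then show ?thesis by (simp add: sum.cartesian_product)
qed

lemma sum_card_fibres:
  fixes x :: "nat \<Rightarrow> 'N::finite"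
  assumes "finite A"
  shows "(\<Sum>i\<in>UNIV. card {p \<in> A. x p = i}) = card A"
  using sum.group[of A UNIV x "\<lambda>_. 1::nat"] assms by simp

lemma dop_diag: "finite A \<Longrightarrow> dop A i i K x = of_nat (card {p \<in> A. x p = i}) * K x"
proof -
  assume "finite A"
  have "dop A i i K x = (\<Sum>p\<in>A. of_bool (x p = i) * K x)"
    unfolding dop_def by (intro sum.cong refl) (auto simp: fun_upd_idem)
  also have "\<dots> = (\<Sum>p\<in>A. of_bool (x p = i)) * K x"
    by (simp add: sum_distrib_right)
  also have "(\<Sum>p\<in>A. of_bool (x p = i)) = (of_nat (card {p \<in> A. x p = i}) :: complex)"
    using \<open>finite A\<close> by (simp add: of_bool_def sum.If_cases Int_def)
  finally show ?thesis .
qed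

text \<open>Position \<open>p\<close> forces \<open>i = x p\<close> and position \<open>q\<close>
  forces \<open>j = x q\<close>, so the double sum over labels collapses to a double sum over
  positions.\<close>

lemma sum_dop_dop:
  fixes K :: "(nat \<Rightarrow> 'N::finite) \<Rightarrow> complex"
  shows "(\<Sum>i\<in>UNIV. \<Sum>j\<in>UNIV. dop A i j K x * cnj (dop A j i K x)) =
    (\<Sum>p\<in>A. \<Sum>q\<in>A. K (x(p := x q)) * cnj (K (x(q := x p))))"
proof -
  have "(\<Sum>i\<in>UNIV. \<Sum>j\<in>UNIV. dop A i j K x * cnj (dop A j i K x)) =
      (\<Sum>i\<in>UNIV. \<Sum>j\<in>UNIV. \<Sum>p\<in>A. \<Sum>q\<in>A.
        if x p = i then if x q = j then K (x(p := j)) * cnj (K (x(q := i))) else 0 else 0)"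
    unfolding dop_def by (simp add: sum_product) (intro sum.cong refl, auto)
  also have "\<dots> = (\<Sum>i\<in>UNIV. \<Sum>p\<in>A. \<Sum>j\<in>UNIV. \<Sum>q\<in>A.
        if x p = i then if x q = j then K (x(p := j)) * cnj (K (x(q := i))) else 0 else 0)"
    by (subst sum.swap) simp
  also have "\<dots> = (\<Sum>p\<in>A. \<Sum>i\<in>UNIV. \<Sum>q\<in>A. \<Sum>j\<in>UNIV.
        if x p = i then if x q = j then K (x(p := j)) * cnj (K (x(q := i))) else 0 else 0)"
    by (subst sum.swap) (intro sum.cong refl sum.swap)
  also have "\<dots> = (\<Sum>p\<in>A. \<Sum>q\<in>A. \<Sum>i\<in>UNIV. \<Sum>j\<in>UNIV.
        if x p = i then if x q = j then K (x(p := j)) * cnj (K (x(q := i))) else 0 else 0)"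
    by (intro sum.cong refl sum.swap)
  also have "\<dots> = (\<Sum>p\<in>A. \<Sum>q\<in>A. \<Sum>i\<in>UNIV. if x p = i then
        \<Sum>j\<in>UNIV. if x q = j then K (x(p := j)) * cnj (K (x(q := i))) else 0 else 0)"
    by (intro sum.cong refl) simp
  finally show ?thesis by simp
qed

text \<open>
  With \<open>E\<^sub>i\<^sub>j\<close> acting as \<open>dop A i j\<close>, the sum of \<open>\<langle>E\<^sub>i\<^sub>j K, E\<^sub>j\<^sub>i K\<rangle>\<close> is \<open>card A\<close> times the squared norm of \<open>K\<close> by
  tracelessness. It is the sum of all squared norms of \<open>E\<^sub>i\<^sub>j K\<close> by invariance, and the diagonal terms
  alone are at least twice as large because every label occurs an even number of times.
\<close>

lemma so_invariant_traceless_eq_0: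
  fixes K :: "(nat \<Rightarrow> 'N::finite) \<Rightarrow> complex"
  assumes A: "finite A" "A \<noteq> {}" and inv: "so_invariant A K"
    and tr: "\<And>p q y. p \<in> A \<Longrightarrow> q \<in> A \<Longrightarrow> p \<noteq> q \<Longrightarrow> y \<in> assigns (A - {p, q}) \<Longrightarrow>
      (\<Sum>a\<in>UNIV. K (y(p := a, q := a))) = 0"
  shows "K = 0"
proof -
  let ?X = "assigns A :: (nat \<Rightarrow> 'N) set"
  \<comment> \<open>For distinct positions, \<open>x(p := x q)\<close> carries the same label at
    \<open>p\<close> and \<open>q\<close>. Summing over this label is a contraction of
    \<open>K\<close> and gives 0.\<close>
  have off: "(\<Sum>x\<in>?X. K (x(p := x q)) * cnj (K (x(q := x p)))) = 0"
    if pq: "p \<in> A" "q \<in> A" "p \<noteq> q" for p q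
  proof -
    have "(\<Sum>x\<in>?X. K (x(p := x q)) * cnj (K (x(q := x p)))) =
        (\<Sum>y\<in>assigns (A - {p, q}). \<Sum>a\<in>UNIV. \<Sum>b\<in>UNIV.
          K (y(p := b, q := b)) * cnj (K (y(p := a, q := a))))"
      unfolding sum_assigns_split2[OF pq] using pq(3)
      by (intro sum.cong refl) (simp add: fun_upd_twist)
    also have "\<dots> = (\<Sum>y\<in>assigns (A - {p, q}). \<Sum>a\<in>UNIV.
        (\<Sum>b\<in>UNIV. K (y(p := b, q := b))) * cnj (K (y(p := a, q := a))))"
      by (simp add: sum_distrib_right)
    also have "\<dots> = 0" by (intro sum.neutral ballI) (simp add: tr[OF pq])
    finally show ?thesis .
  qed
  have "(\<Sum>x\<in>?X. \<Sum>i\<in>UNIV. \<Sum>j\<in>UNIV. dop A i j K x * cnj (dop A j i K x)) =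
      (\<Sum>p\<in>A. \<Sum>q\<in>A. \<Sum>x\<in>?X. K (x(p := x q)) * cnj (K (x(q := x p))))"
    unfolding sum_dop_dop by (subst sum.swap, intro sum.cong refl sum.swap)
  also have "\<dots> = (\<Sum>p\<in>A. \<Sum>q\<in>A. if q = p then \<Sum>x\<in>?X. K x * cnj (K x) else 0)"
    by (intro sum.cong refl) (auto simp: off)
  also have "\<dots> = of_real (card A * (\<Sum>x\<in>?X. (cmod (K x))\<^sup>2))"
    using A(1) cinner_self[of ?X K] unfolding cinner_def by simp
  finally have upper: "(\<Sum>x\<in>?X. \<Sum>i\<in>UNIV. \<Sum>j\<in>UNIV. dop A i j K x * cnj (dop A j i K x)) =
      of_real (card A * (\<Sum>x\<in>?X. (cmod (K x))\<^sup>2))" .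
  have sym: "dop A j i K x = dop A i j K x" if "x \<in> ?X" for i j x
    using inv that unfolding so_invariant_def by blast
  have "(\<Sum>x\<in>?X. \<Sum>i\<in>UNIV. \<Sum>j\<in>UNIV. dop A i j K x * cnj (dop A j i K x)) =
      of_real (\<Sum>x\<in>?X. \<Sum>i\<in>UNIV. \<Sum>j\<in>UNIV. (cmod (dop A i j K x))\<^sup>2)"
    unfolding of_real_sum
    by (intro sum.cong refl) (simp add: complex_norm_square sym del: of_real_power)
  then have eq: "(\<Sum>x\<in>?X. \<Sum>i\<in>UNIV. \<Sum>j\<in>UNIV. (cmod (dop A i j K x))\<^sup>2) =
      card A * (\<Sum>x\<in>?X. (cmod (K x))\<^sup>2)"
    unfolding upper of_real_eq_iff by simp
  have low: "2 * card A * (cmod (K x))\<^sup>2 \<le> (\<Sum>i\<in>UNIV. \<Sum>j\<in>UNIV. (cmod (dop A i j K x))\<^sup>2)"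
    if x: "x \<in> ?X" for x
  proof (cases "K x = 0")
    case True
    then show ?thesis by (simp add: sum_nonneg)
  next
    case False
    let ?c = "\<lambda>i. card {p \<in> A. x p = i}"
    have c: "2 * ?c i \<le> ?c i * ?c i" for i
    proof -
      have "even (?c i)" using inv x False unfolding so_invariant_def by blast
      then show ?thesis by (auto elim!: evenE)
    qed
    have "2 * real (card A) = (\<Sum>i\<in>UNIV. real (2 * ?c i))"
      unfolding sum_card_fibres[OF A(1), of x, symmetric] by (simp add: sum_distrib_left)
    also have "\<dots> \<le> (\<Sum>i\<in>UNIV. real (?c i * ?c i))"
      using c by (intro sum_mono of_nat_mono) simp
    finally have "2 * card A * (cmod (K x))\<^sup>2 \<le> (\<Sum>i\<in>UNIV. real (?c i * ?c i)) * (cmod (K x))\<^sup>2"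
      by (intro mult_right_mono) auto
    also have "\<dots> = (\<Sum>i\<in>UNIV. (cmod (dop A i i K x))\<^sup>2)"
      unfolding dop_diag[OF A(1)] by (simp add: sum_distrib_right norm_mult power_mult_distrib power2_eq_square mult_ac sum_distrib_left)
    also have "\<dots> \<le> (\<Sum>i\<in>UNIV. \<Sum>j\<in>UNIV. (cmod (dop A i j K x))\<^sup>2)"
      by (intro sum_mono member_le_sum) auto
    finally show ?thesis .
  qed
  have "2 * card A * (\<Sum>x\<in>?X. (cmod (K x))\<^sup>2) = (\<Sum>x\<in>?X. 2 * card A * (cmod (K x))\<^sup>2)"
    by (rule sum_distrib_left)
  also have "\<dots> \<le> card A * (\<Sum>x\<in>?X. (cmod (K x))\<^sup>2)"
    unfolding eq[symmetric] by (intro sum_mono low)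
  finally have "2 * card A * (\<Sum>x\<in>?X. (cmod (K x))\<^sup>2) \<le> card A * (\<Sum>x\<in>?X. (cmod (K x))\<^sup>2)" .
  moreover have "0 < card A" using A by (simp add: card_gt_0_iff)
  moreover have "0 \<le> (\<Sum>x\<in>?X. (cmod (K x))\<^sup>2)" by (simp add: sum_nonneg)
  ultimately have "(\<Sum>x\<in>?X. (cmod (K x))\<^sup>2) = 0" by simp
  then have "cinner ?X K K = 0" by (simp add: cinner_self)
  then show ?thesis
    using supp_on_eq_0[of K ?X] inv A(1) by (simp add: so_invariant_def)
qed

section \<open>Contractions, pairings and the first fundamental theorem\<close>

lemma subspace_so_invariant: "complex_vector.subspace {K. so_invariant A K}"
proof -
  have d: "dop A i j (K + L) x = dop A i j K x + dop A i j L x"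
    "dop A i j (c *\<^sub>C K) x = c * dop A i j K x" "dop A i j 0 x = 0" for i j K L c and x :: "nat \<Rightarrow> 'a"
    by (simp_all add: dop_def scaleC_apply algebra_simps sum.distrib sum_distrib_left)
  note s = complex_vector.subspace_add[OF subspace_supp_on] complex_vector.subspace_scale[OF subspace_supp_on]
  have z: "0 \<in> supp_on (assigns A)"
    by (simp add: complex_vector.subspace_0 subspace_supp_on)
  show ?thesis
    unfolding complex_vector.subspace_def
    by (simp add: so_invariant_def d s z scaleC_apply)
qed

text \<open>The two contracted positions carry equal labels and do not change parities. Acting on
  \<open>K\<close> with a matrix unit before contracting also produces the terms that hit
  \<open>p\<close> or \<open>q\<close>; their total is symmetric in \<open>i\<close> and
  \<open>j\<close>, so it cancels when the two orders are compared.\<close>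

lemma so_invariant_contraction:
  fixes K :: "(nat \<Rightarrow> 'N::finite) \<Rightarrow> complex"
  assumes A: "finite A" and pq: "p \<in> A" "q \<in> A" "p \<noteq> q" and inv: "so_invariant A K"
  shows "so_invariant (A - {p, q}) (contraction p q A K)"
  unfolding so_invariant_def
proof (intro conjI ballI allI impI)
  let ?B = "A - {p, q}"
  have split: "(\<Sum>r\<in>A. g r) = g p + (g q + (\<Sum>r\<in>?B. g r))" for g :: "nat \<Rightarrow> complex"
  proof -
    have "A = insert p (insert q ?B)" using pq by blast
    then have "sum g A = sum g (insert p (insert q ?B))" by simp
    then show ?thesis using A pq by simp
  qed
  show "contraction p q A K \<in> supp_on (assigns ?B)"
    by (simp add: supp_on_def contraction_def)
  fix y :: "nat \<Rightarrow> 'N" assume y: "y \<in> assigns ?B"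
  show "contraction p q A K y = 0" if odd: "odd (card {r \<in> ?B. y r = i})" for i
  proof -
    have "K (y(p := a, q := a)) = 0" for a
    proof -
      have "{r \<in> A. (y(p := a, q := a)) r = i} =
          {r \<in> ?B. y r = i} \<union> (if a = i then {p, q} else {})"
        using pq by auto
      then have "odd (card {r \<in> A. (y(p := a, q := a)) r = i})"
        using odd A pq by (simp add: card_Un_disjoint Int_def)
      then show ?thesis
        using inv assigns_upd2[OF y pq(1,2)] unfolding so_invariant_def by blast
    qed
    then show ?thesis by (simp add: contraction_def)
  qed
  have key: "dop ?B i j (contraction p q A K) y =
      (\<Sum>a\<in>UNIV. dop A i j K (y(p := a, q := a))) - (K (y(p := j, q := i)) + K (y(p := i, q := j)))" for i j
  proof -
    have "dop A i j K (y(p := a, q := a)) = (if a = i then K (y(p := j, q := i)) + K (y(p := i, q := j)) else 0) +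
        (\<Sum>r\<in>?B. of_bool (y r = i) * K (y(r := j, p := a, q := a)))" for a
    proof -
      have "(\<Sum>r\<in>?B. of_bool ((y(p := a, q := a)) r = i) * K (y(p := a, q := a, r := j))) =
          (\<Sum>r\<in>?B. of_bool (y r = i) * K (y(r := j, p := a, q := a)))"
        by (intro sum.cong refl) (auto simp: fun_upd_twist)
      moreover have "y(p := a, q := a, p := j) = y(p := j, q := a)" using pq(3) by auto
      ultimately show ?thesis
        unfolding dop_def split using pq(3) by auto
    qed
    then have "(\<Sum>a\<in>UNIV. dop A i j K (y(p := a, q := a))) = K (y(p := j, q := i)) + K (y(p := i, q := j)) +
        (\<Sum>r\<in>?B. of_bool (y r = i) * (\<Sum>a\<in>UNIV. K (y(r := j, p := a, q := a))))"
      by (simp add: sum.distrib sum_distrib_left sum.swap[of _ UNIV ?B] del: sum_of_bool_mult_eq)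
    moreover have "dop ?B i j (contraction p q A K) y =
        (\<Sum>r\<in>?B. of_bool (y r = i) * (\<Sum>a\<in>UNIV. K (y(r := j, p := a, q := a))))"
      unfolding dop_def by (intro sum.cong refl) (simp add: contraction_def assigns_upd[OF y])
    ultimately show ?thesis by simp
  qed
  have sym: "dop A i j K (y(p := a, q := a)) = dop A j i K (y(p := a, q := a))" for i j a
    using inv assigns_upd2[OF y pq(1,2)] unfolding so_invariant_def by blast
  show "dop ?B i j (contraction p q A K) y = dop ?B j i (contraction p q A K) y" for i j
    unfolding key sym[of i j] by simp
qed

lemma even_card_involution:
  assumes "finite B" "\<And>p. p \<in> B \<Longrightarrow> \<pi> p \<in> B \<and> \<pi> p \<noteq> p \<and> \<pi> (\<pi> p) = p"
  shows "even (card B)"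
  using assms
proof (induction B rule: finite_psubset_induct)
  case (psubset B)
  show ?case
  proof (cases "B = {}")
    case False
    then obtain p where p: "p \<in> B" by blast
    let ?C = "B - {p, \<pi> p}"
    have "even (card ?C)"
    proof (rule psubset.IH)
      show "?C \<subset> B" using p by blast
      show "\<pi> r \<in> ?C \<and> \<pi> r \<noteq> r \<and> \<pi> (\<pi> r) = r" if "r \<in> ?C" for r
      proof -
        have r: "\<pi> r \<in> B" "\<pi> r \<noteq> r" "\<pi> (\<pi> r) = r" "r \<noteq> p" "r \<noteq> \<pi> p"
          using psubset.prems[of r] that by auto
        have "\<pi> (\<pi> p) = p" using psubset.prems[OF p] by simp
        then have "\<pi> r \<noteq> p" "\<pi> r \<noteq> \<pi> p" using r(3-5) by metis+
        then show ?thesis using r by simp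
      qed
    qed
    moreover have "card {p, \<pi> p} = 2" "{p, \<pi> p} \<subseteq> B"
      using psubset.prems[OF p] p by auto
    moreover have "card B = card ?C + card {p, \<pi> p}"
      using psubset.hyps \<open>{p, \<pi> p} \<subseteq> B\<close>
      by (metis card_Diff_subset card_mono finite.emptyI finite.insertI le_add_diff_inverse2)
    ultimately show ?thesis by simp
  qed simp
qed

text \<open>New labels at one pair affect only the condition of that pair, because
  \<open>\<pi>\<close> maps the remaining positions to themselves. This makes the tensor a Kronecker
  delta in the two labels.\<close>

lemma pair_tensor_upd:
  assumes pr: "pairing A \<pi>" and p: "p \<in> A" and x: "x(p := a, \<pi> p := b) \<in> assigns A"
  shows "pair_tensor A \<pi> (x(p := a, \<pi> p := b)) = of_bool (a = b) * of_bool (\<forall>r\<in>A - {p, \<pi> p}. x (\<pi> r) = x r)"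
proof -
  let ?x = "x(p := a, \<pi> p := b)"
  have \<pi>p: "\<pi> p \<in> A" "\<pi> p \<noteq> p" "\<pi> (\<pi> p) = p" using pr p by (auto simp: pairing_def)
  have split: "(\<forall>r\<in>A. Q r) \<longleftrightarrow> Q p \<and> Q (\<pi> p) \<and> (\<forall>r\<in>A - {p, \<pi> p}. Q r)" for Q
    using p \<pi>p by blast
  have "(\<forall>r\<in>A. ?x (\<pi> r) = ?x r) \<longleftrightarrow> ?x (\<pi> p) = ?x p \<and> ?x (\<pi> (\<pi> p)) = ?x (\<pi> p) \<and>
      (\<forall>r\<in>A - {p, \<pi> p}. ?x (\<pi> r) = ?x r)"
    by (rule split)
  also have "\<dots> \<longleftrightarrow> a = b \<and> (\<forall>r\<in>A - {p, \<pi> p}. ?x (\<pi> r) = ?x r)" using \<pi>p by auto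
  also have "(\<forall>r\<in>A - {p, \<pi> p}. ?x (\<pi> r) = ?x r) \<longleftrightarrow> (\<forall>r\<in>A - {p, \<pi> p}. x (\<pi> r) = x r)"
  proof (rule ball_cong[OF refl])
    fix r assume r: "r \<in> A - {p, \<pi> p}"
    then have "\<pi> (\<pi> r) = r" using pr by (auto simp: pairing_def)
    then have "\<pi> r \<noteq> p" "\<pi> r \<noteq> \<pi> p" using r \<pi>p by auto
    then show "?x (\<pi> r) = ?x r \<longleftrightarrow> x (\<pi> r) = x r" using r by simp
  qed
  finally have e: "(\<forall>r\<in>A. ?x (\<pi> r) = ?x r) \<longleftrightarrow> a = b \<and> (\<forall>r\<in>A - {p, \<pi> p}. x (\<pi> r) = x r)" .
  show ?thesis unfolding pair_tensor_def e using x by (simp only: of_bool_conj simp_thms)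
qed

text \<open>The term of E_ij at \<open>p\<close> equals the term of E_ji at the partner of
  \<open>p\<close>: both are 1 exactly if \<open>p\<close> carries \<open>i\<close>, its partner
  carries \<open>j\<close>, and all other pairs agree. Evenness holds because partners carry equal
  labels.\<close>

lemma so_invariant_pair_tensor:
  assumes A: "finite A" and pr: "pairing A \<pi>"
  shows "so_invariant A (pair_tensor A \<pi> :: (nat \<Rightarrow> 'N::finite) \<Rightarrow> complex)"
  unfolding so_invariant_def
proof (intro conjI ballI allI impI)
  show "pair_tensor A \<pi> \<in> supp_on (assigns A)" by (simp add: supp_on_def pair_tensor_def)
  fix x :: "nat \<Rightarrow> 'N" assume x: "x \<in> assigns A"
  show "pair_tensor A \<pi> x = 0" if odd: "odd (card {p \<in> A. x p = i})" for i
  proof (rule ccontr)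
    assume "pair_tensor A \<pi> x \<noteq> 0"
    then have "\<forall>p\<in>A. x (\<pi> p) = x p" by (simp add: pair_tensor_def)
    then have "even (card {p \<in> A. x p = i})"
      using A pr by (intro even_card_involution[of _ \<pi>]) (auto simp: pairing_def)
    then show False using odd by simp
  qed
  show "dop A i j (pair_tensor A \<pi>) x = dop A j i (pair_tensor A \<pi>) x" for i j
    unfolding dop_def
  proof (rule sum.reindex_bij_witness[where i = \<pi> and j = \<pi>])
    fix p assume p: "p \<in> A"
    then have \<pi>p: "\<pi> p \<in> A" "\<pi> p \<noteq> p" "\<pi> (\<pi> p) = p" using pr by (auto simp: pairing_def)
    have upd: "pair_tensor A \<pi> (x(s := a)) = of_bool (a = x (\<pi> s)) * of_bool (\<forall>r\<in>A - {s, \<pi> s}. x (\<pi> r) = x r)"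
      if s: "s \<in> A" and "\<pi> s \<noteq> s" for s a
      using pair_tensor_upd[OF pr s, of x a "x (\<pi> s)"] assigns_upd[OF x s] that(2) by (simp add: fun_upd_idem)
    have "pair_tensor A \<pi> (x(p := j)) = of_bool (j = x (\<pi> p) \<and> (\<forall>r\<in>A - {p, \<pi> p}. x (\<pi> r) = x r))"
      by (simp only: upd[OF p \<pi>p(2)] of_bool_conj)
    moreover have "pair_tensor A \<pi> (x(\<pi> p := i)) = of_bool (i = x p \<and> (\<forall>r\<in>A - {p, \<pi> p}. x (\<pi> r) = x r))"
      using \<pi>p by (simp only: upd[OF \<pi>p(1)] of_bool_conj insert_commute not_sym[OF \<pi>p(2)] simp_thms)
    ultimately show "of_bool (x (\<pi> p) = j) * pair_tensor A \<pi> (x(\<pi> p := i)) =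
        of_bool (x p = i) * pair_tensor A \<pi> (x(p := j))"
      by auto
  qed (use pr in \<open>auto simp: pairing_def\<close>)
qed

text \<open>Subtract from \<open>K\<close> its projection to the span of the pairings. A contraction
  of the remainder is orthogonal to all pairings of the other positions, and by induction it lies in
  their span, so it is 0. The remainder is then a traceless invariant and vanishes unless there are
  no positions, where arrays are scalars.\<close>

theorem so_invariant_span_pairings:
  fixes K :: "(nat \<Rightarrow> 'N::finite) \<Rightarrow> complex"
  assumes "finite A" "so_invariant A K"
  shows "K \<in> complex_vector.span {pair_tensor A \<pi> |\<pi>. pairing A \<pi>}"
  using assms
proof (induction "card A" arbitrary: A K rule: less_induct)
  case less
  note A = less.prems(1) and inv = less.prems(2)
  let ?X = "assigns A :: (nat \<Rightarrow> 'N) set"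
  let ?P = "{pair_tensor A \<pi> :: (nat \<Rightarrow> 'N) \<Rightarrow> complex |\<pi>. pairing A \<pi>}"
  let ?S = "complex_vector.span ?P"
  have S_inv: "?S \<subseteq> {K. so_invariant A K}"
    by (rule complex_vector.span_minimal) (use so_invariant_pair_tensor[OF A] subspace_so_invariant in auto)
  have "?S \<subseteq> supp_on ?X" using S_inv by (auto simp: so_invariant_def)
  then obtain s where s: "s \<in> ?S" "\<And>b. b \<in> ?S \<Longrightarrow> cinner ?X (K - s) b = 0"
    using orthogonal_decomposition[OF finite_assigns[OF A] complex_vector.subspace_span] by meson
  define K0 where "K0 = K - s"
  have "K - s \<in> {K. so_invariant A K}"
    using inv s(1) S_inv by (intro complex_vector.subspace_diff subspace_so_invariant) auto
  then have inv0: "so_invariant A K0" by (simp add: K0_def)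
  show ?case
  proof (cases "A = {}")
    case True
    have X: "?X = {\<lambda>_. undefined}" by (simp add: True assigns_def)
    define c where "c = K (\<lambda>_. undefined)"
    have "K = c *\<^sub>C pair_tensor A id"
    proof
      fix x
      have "K x = 0" if "x \<notin> ?X" using inv that by (simp add: so_invariant_def supp_on_def)
      moreover have "x = (\<lambda>_. undefined)" if "x \<in> ?X" using that X by blast
      ultimately show "K x = (c *\<^sub>C pair_tensor A id) x"
        using True by (cases "x \<in> ?X") (simp_all add: pair_tensor_def scaleC_apply c_def)
    qed
    moreover have "pair_tensor A id \<in> ?P" using True by (auto simp: pairing_def)
    then have "c *\<^sub>C pair_tensor A id \<in> ?S"
      by (intro complex_vector.span_scale complex_vector.span_base)
    ultimately show ?thesis by simp
  next
    case False
    have "(\<Sum>a\<in>UNIV. K0 (y(p := a, q := a))) = 0"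
      if pq: "p \<in> A" "q \<in> A" "p \<noteq> q" and y: "y \<in> assigns (A - {p, q})" for p q y
    proof -
      let ?B = "A - {p, q}"
      define C where "C = contraction p q A K0"
      have "card ?B < card A" using pq A by (intro psubset_card_mono) auto
      then have C: "C \<in> complex_vector.span {pair_tensor ?B \<pi> |\<pi>. pairing ?B \<pi>}"
        unfolding C_def by (rule less.hyps) (simp_all add: A so_invariant_contraction[OF A pq inv0])
      have "cinner (assigns ?B) C (pair_tensor ?B \<pi>) = 0" if \<pi>: "pairing ?B \<pi>" for \<pi>
      proof -
        \<comment> \<open>Contraction at \<open>p\<close> and \<open>q\<close> is adjoint to
          inserting the pair of \<open>p\<close> and \<open>q\<close>, which turns a pairing of the
          smaller set into one of \<open>A\<close>.\<close>
        define \<pi>' where "\<pi>' = \<pi>(p := q, q := p)"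
        have pr: "pairing A \<pi>'" using \<pi> pq by (auto simp: pairing_def \<pi>'_def)
        have eq: "pair_tensor A \<pi>' (y(p := a, q := b)) = of_bool (a = b) * pair_tensor ?B \<pi> y"
          if y: "y \<in> assigns ?B" for y :: "nat \<Rightarrow> 'N" and a b
        proof -
          have "\<pi>' p = q" using pq(3) by (simp add: \<pi>'_def)
          then have "pair_tensor A \<pi>' (y(p := a, q := b)) = of_bool (a = b) * of_bool (\<forall>r\<in>?B. y (\<pi>' r) = y r)"
            using pair_tensor_upd[OF pr pq(1), of y a b] assigns_upd2[OF y pq(1,2)] by simp
          also have "(\<forall>r\<in>?B. y (\<pi>' r) = y r) \<longleftrightarrow> (\<forall>r\<in>?B. y (\<pi> r) = y r)"
            by (rule ball_cong[OF refl]) (simp add: \<pi>'_def)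
          finally show ?thesis using y by (simp only: pair_tensor_def simp_thms)
        qed
        have m: "pair_tensor A \<pi>' \<in> ?S" using pr by (intro complex_vector.span_base) blast
        have "0 = cinner ?X K0 (pair_tensor A \<pi>')"
          unfolding K0_def using s(2)[OF m] by (rule sym)
        also have "\<dots> = (\<Sum>y\<in>assigns ?B. \<Sum>a\<in>UNIV. \<Sum>b\<in>UNIV.
            if b = a then K0 (y(p := a, q := a)) * cnj (pair_tensor ?B \<pi> y) else 0)"
          unfolding cinner_def sum_assigns_split2[OF pq] by (intro sum.cong refl) (auto simp: eq)
        also have "\<dots> = (\<Sum>y\<in>assigns ?B. C y * cnj (pair_tensor ?B \<pi> y))"
          by (intro sum.cong refl) (simp add: C_def contraction_def sum_distrib_right)
        finally show ?thesis by (simp add: cinner_def)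
      qed
      then have "cinner (assigns ?B) C C = 0"
        by (intro cinner_span_right[OF _ C]) blast
      moreover have "C \<in> supp_on (assigns ?B)" by (simp add: C_def supp_on_def contraction_def)
      ultimately have "C = 0" using supp_on_eq_0[of C "assigns ?B"] A by simp
      then have "C y = 0" by simp
      then show ?thesis using y by (simp add: C_def contraction_def)
    qed
    then have "K0 = 0" using so_invariant_traceless_eq_0[OF A False inv0] by blast
    then show ?thesis using s(1) by (simp add: K0_def)
  qed
qed

section \<open>Operators on tensors\<close>

definition idx :: "nat \<Rightarrow> 'N list set"
  where "idx n = {is. length is = n}"

lemma finite_idx [simp]: "finite (idx n :: 'N::finite list set)"
  using finite_lists_length_eq[of "UNIV :: 'N set" n] by (simp add: idx_def)

lemma tensors_eq: "tensors n = supp_on (idx n)"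
  by (auto simp: tensors_def supp_on_def idx_def)

lemma subspace_tensors: "complex_vector.subspace (tensors n)"
  unfolding tensors_eq by (rule subspace_supp_on)

lemma tensors_eqI:
  assumes "t \<in> tensors n" "s \<in> tensors n" "\<And>is. length is = n \<Longrightarrow> t is = s is"
  shows "t = s"
proof
  fix "is" show "t is = s is"
    using assms by (cases "length is = n") (simp_all add: tensors_def)
qed

lemma pure_tensor_in [simp]: "pure_tensor js \<in> tensors (length js)"
  by (auto simp: tensors_def pure_tensor_def)

lemma tensor_expansion:
  fixes t :: "'N::finite tensor"
  assumes "t \<in> tensors n"
  shows "t = (\<Sum>js\<in>idx n. t js *\<^sub>C pure_tensor js)"
proof
  fix "is" :: "'N list"
  have "(\<Sum>js\<in>idx n. t js *\<^sub>C pure_tensor js) is = (\<Sum>js\<in>idx n. t js * pure_tensor js is)"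
    by (simp add: scaleC_apply)
  also have "\<dots> = (\<Sum>js\<in>idx n. if js = is then t js else 0)"
    by (intro sum.cong refl) (simp add: pure_tensor_def)
  also have "\<dots> = (if is \<in> idx n then t is else 0)" by simp
  also have "\<dots> = t is" using assms by (auto simp: idx_def tensors_def)
  finally show "t is = (\<Sum>js\<in>idx n. t js *\<^sub>C pure_tensor js) is" by simp
qed

lemma linear_on_0: "linear_on V f \<Longrightarrow> complex_vector.subspace V \<Longrightarrow> f 0 = 0"
  unfolding linear_on_def
  by (metis complex_vector.scale_zero_left complex_vector.subspace_0)

lemma linear_on_sum:
  assumes "linear_on V f" "complex_vector.subspace V" "\<And>a. a \<in> A \<Longrightarrow> x a \<in> V"
  shows "f (\<Sum>a\<in>A. x a) = (\<Sum>a\<in>A. f (x a))"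
  using assms(3)
proof (induction A rule: infinite_finite_induct)
  case (insert a A)
  have "(\<Sum>a\<in>A. x a) \<in> V" using insert by (intro complex_vector.subspace_sum[OF assms(2)]) auto
  then have "f (x a + (\<Sum>a\<in>A. x a)) = f (x a) + f (\<Sum>a\<in>A. x a)"
    using assms(1) insert.prems unfolding linear_on_def by blast
  then show ?case using insert by simp
qed (simp_all add: linear_on_0[OF assms(1,2)])

lemma linear_on_tensor_expansion:
  fixes t :: "'N::finite tensor"
  assumes "linear_on (tensors n) A" "t \<in> tensors n"
  shows "A t = (\<Sum>js\<in>idx n. t js *\<^sub>C A (pure_tensor js))"
proof -
  have p: "pure_tensor js \<in> tensors n" if "js \<in> idx n" for js :: "'N list"
    using that pure_tensor_in[of js] by (simp add: idx_def)
  have "A t = A (\<Sum>js\<in>idx n. t js *\<^sub>C pure_tensor js)"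
    by (rule arg_cong[OF tensor_expansion[OF assms(2)]])
  also have "\<dots> = (\<Sum>js\<in>idx n. A (t js *\<^sub>C pure_tensor js))"
    by (rule linear_on_sum[OF assms(1) subspace_tensors])
      (simp add: p complex_vector.subspace_scale[OF subspace_tensors])
  also have "\<dots> = (\<Sum>js\<in>idx n. t js *\<^sub>C A (pure_tensor js))"
    by (rule sum.cong[OF refl]) (use assms(1) p in \<open>simp add: linear_on_def\<close>)
  finally show ?thesis .
qed

text \<open>Lists with the dummy label \<open>undefined\<close> at \<open>p\<close> and
  \<open>q\<close> represent the choice of all other entries; the two remaining entries are then
  summed freely.\<close>

lemma sum_idx_split2:
  fixes f :: "'N::finite list \<Rightarrow> complex"
  assumes "p < n" "q < n" "p \<noteq> q"
  shows "(\<Sum>js\<in>idx n. f js) =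
    (\<Sum>ks\<in>{ks \<in> idx n. ks ! p = undefined \<and> ks ! q = undefined}. \<Sum>a\<in>UNIV. \<Sum>b\<in>UNIV. f (ks[p := a, q := b]))"
proof -
  have upd: "js[p := undefined, q := undefined, p := js ! p, q := js ! q] = js"
    if "p < length js" "q < length js" for js :: "'N list"
    using that by (intro nth_equalityI) (auto simp: nth_list_update)
  let ?K = "{ks \<in> idx n. ks ! p = undefined \<and> ks ! q = undefined}"
  have "(\<Sum>js\<in>idx n. f js) = (\<Sum>(ks, a, b)\<in>?K \<times> UNIV \<times> UNIV. f (ks[p := a, q := b]))"
    by (rule sum.reindex_bij_witness[where i = "\<lambda>(ks, a, b). ks[p := a, q := b]"
          and j = "\<lambda>js. (js[p := undefined, q := undefined], js ! p, js ! q)"])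
      (use assms in \<open>auto simp: idx_def upd nth_list_update list_eq_iff_nth_eq\<close>)
  then show ?thesis by (simp add: sum.cartesian_product)
qed

lemma sum_idx_append2:
  fixes f :: "'N::finite list \<Rightarrow> complex"
  shows "(\<Sum>js\<in>idx (n + 2). f js) = (\<Sum>ks\<in>idx n. \<Sum>a\<in>UNIV. \<Sum>b\<in>UNIV. f (ks @ [a, b]))"
proof -
  have "(\<Sum>js\<in>idx (n + 2). f js) = (\<Sum>(ks, a, b)\<in>idx n \<times> UNIV \<times> UNIV. f (ks @ [a, b]))"
  proof (rule sum.reindex_bij_witness[where i = "\<lambda>(ks, a, b). ks @ [a, b]"
          and j = "\<lambda>js. (take n js, js ! n, js ! Suc n)"])
    fix js :: "'N list" assume js: "js \<in> idx (n + 2)"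
    then have "drop n js = [js ! n, js ! Suc n]"
      by (intro nth_equalityI) (auto simp: idx_def less_Suc_eq numeral_2_eq_2)
    then have eq: "take n js @ [js ! n, js ! Suc n] = js"
      by (metis append_take_drop_id)
    show "(case (take n js, js ! n, js ! Suc n) of (ks, a, b) \<Rightarrow> ks @ [a, b]) = js"
      "(case (take n js, js ! n, js ! Suc n) of (ks, a, b) \<Rightarrow> f (ks @ [a, b])) = f js"
      using eq by simp_all
    show "(take n js, js ! n, js ! Suc n) \<in> idx n \<times> UNIV \<times> UNIV" using js by (simp add: idx_def)
  qed (auto simp: idx_def nth_append)
  then show ?thesis by (simp add: sum.cartesian_product)
qed

lemma tensor_act_eq: "tensor_act g t is = (\<Sum>js\<in>idx (length is). (\<Prod>p<length is. g $ (is ! p) $ (js ! p)) * t js)"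
  by (simp add: tensor_act_def idx_def)

lemma tensor_act_add: "tensor_act g (t + s) = tensor_act g t + tensor_act g s"
  and tensor_act_scaleC: "tensor_act g (c *\<^sub>C t) = c *\<^sub>C tensor_act g t"
  and tensor_act_0: "tensor_act g 0 = 0"
  by (simp_all add: fun_eq_iff tensor_act_eq scaleC_apply algebra_simps sum.distrib sum_distrib_left)

lemma tensor_act_in: "t \<in> tensors n \<Longrightarrow> tensor_act g t \<in> tensors n"
  by (simp add: tensors_def tensor_act_def)

subsection \<open>Permutations and contractions\<close>

text \<open>Permutations act on 1, ..., n while lists are indexed from 0, hence the shift. This is a
  right action on lists, so that its pullback \<open>perm_op\<close> is a left action on
  tensors.\<close>

definition relist :: "nat \<Rightarrow> (nat \<Rightarrow> nat) \<Rightarrow> 'N list \<Rightarrow> 'N list"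
  where "relist n s is = map (\<lambda>m. is ! (s m - 1)) [1..<n + 1]"

definition perm_op :: "nat \<Rightarrow> (nat \<Rightarrow> nat) \<Rightarrow> 'N tensor \<Rightarrow> 'N tensor"
  where "perm_op n s t = (\<lambda>is. of_bool (length is = n) * t (relist n s is))"

text \<open>Positions count from 0 here and in \<open>bar_op\<close>, whereas the Brauer algebra
  counts them from 1.\<close>

definition swap_op :: "nat \<Rightarrow> nat \<Rightarrow> nat \<Rightarrow> 'N tensor \<Rightarrow> 'N tensor"
  where "swap_op n p q t = (\<lambda>is. of_bool (length is = n) * t (is[p := is ! q, q := is ! p]))"

definition bar_op :: "nat \<Rightarrow> nat \<Rightarrow> nat \<Rightarrow> 'N::finite tensor \<Rightarrow> 'N tensor"
  where "bar_op n p q t =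
    (\<lambda>is. of_bool (length is = n \<and> is ! p = is ! q) * (\<Sum>a\<in>UNIV. t (is[p := a, q := a])))"

text \<open>The invariant bilinear form applied to the last two factors. On a slice that ends right
  behind two adjacent positions, \<open>bar_op\<close> at these positions factors through it, which
  lowers the order by two.\<close>

definition contract_last :: "'N::finite tensor \<Rightarrow> 'N tensor"
  where "contract_last t = (\<lambda>is. \<Sum>a\<in>UNIV. t (is @ [a, a]))"

lemma length_relist [simp]: "length (relist n s is) = n"
  by (simp add: relist_def)

lemma nth_relist: "m \<in> {1..n} \<Longrightarrow> relist n s is ! (m - 1) = is ! (s m - 1)"
proof -
  assume "m \<in> {1..n}"
  then have "m - 1 < n" "[1..<n + 1] ! (m - 1) = m"
    using nth_upt[of 1 "m - 1" "n + 1"] by auto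
  then show ?thesis by (simp add: relist_def del: upt_Suc)
qed

lemma nth_equalityI_pos: "length xs = n \<Longrightarrow> length ys = n \<Longrightarrow> (\<And>m. m \<in> {1..n} \<Longrightarrow> xs ! (m - 1) = ys ! (m - 1)) \<Longrightarrow> xs = ys"
proof (rule nth_equalityI)
  fix i assume "length xs = n" "\<And>m. m \<in> {1..n} \<Longrightarrow> xs ! (m - 1) = ys ! (m - 1)" "i < length xs"
  from this(2)[of "Suc i"] this(1,3) show "xs ! i = ys ! i" by simp
qed simp

lemma relist_relist:
  assumes "s' permutes {1..n}"
  shows "relist n s' (relist n s is) = relist n (s \<circ> s') is"
proof (rule nth_equalityI_pos[where n = n])
  fix m assume m: "m \<in> {1..n}"
  then have "s' m \<in> {1..n}" using assms by (metis permutes_in_image)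
  then show "relist n s' (relist n s is) ! (m - 1) = relist n (s \<circ> s') is ! (m - 1)"
    using m by (simp only: nth_relist o_apply)
qed simp_all

lemma relist_id: "length is = n \<Longrightarrow> relist n id is = is"
  by (rule nth_equalityI_pos[where n = n]) (simp_all only: nth_relist id_apply length_relist)

lemma relist_inv:
  assumes "s permutes {1..n}" "length is = n"
  shows "relist n s (relist n (inv s) is) = is" "relist n (inv s) (relist n s is) = is"
  using assms relist_relist[OF assms(1), of "inv s" "is"] relist_relist[OF permutes_inv[OF assms(1)], of s "is"]
  by (simp_all add: permutes_inv_o relist_id)

lemma relist_transpose:
  assumes "length is = n" "k \<in> {1..n}" "l \<in> {1..n}"
  shows "relist n (Transposition.transpose k l) is = is[k - 1 := is ! (l - 1), l - 1 := is ! (k - 1)]"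
proof (rule nth_equalityI_pos[where n = n])
  fix m assume m: "m \<in> {1..n}"
  have "relist n (Transposition.transpose k l) is ! (m - 1) = is ! (Transposition.transpose k l m - 1)"
    using m by (rule nth_relist)
  moreover have "m - 1 = k - 1 \<longleftrightarrow> m = k" "m - 1 = l - 1 \<longleftrightarrow> m = l"
    using m assms by auto
  ultimately show "relist n (Transposition.transpose k l) is ! (m - 1) =
      is[k - 1 := is ! (l - 1), l - 1 := is ! (k - 1)] ! (m - 1)"
    using m assms by (auto simp: nth_list_update transpose_def)
qed (simp_all add: assms)

lemma sum_relist:
  fixes f :: "'N::finite list \<Rightarrow> complex"
  assumes "s permutes {1..n}"
  shows "(\<Sum>js\<in>idx n. f (relist n s js)) = (\<Sum>js\<in>idx n. f js)"
  by (rule sum.reindex_bij_witness[where i = "relist n (inv s)" and j = "relist n s"])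
    (simp_all add: idx_def relist_inv[OF assms])

lemma brauer_op_perm_eq:
  fixes t :: "'N::finite tensor"
  assumes "s permutes {1..n}"
  shows "brauer_op n (brauer_perm n s) t = perm_op n s t"
proof
  fix "is" :: "'N list"
  have c: "compatible (perm_graph n s) is js \<longleftrightarrow> js = relist n s is" if "length js = n" for js :: "'N list"
  proof
    assume "compatible (perm_graph n s) is js"
    then show "js = relist n s is"
      unfolding compatible_perm_graph
      by (intro nth_equalityI_pos[where n = n] that) (simp_all only: nth_relist length_relist)
  next
    assume "js = relist n s is"
    then show "compatible (perm_graph n s) is js"
      unfolding compatible_perm_graph by (auto simp only: nth_relist)
  qed
  have "(\<Sum>js | length js = n. of_bool (compatible (perm_graph n s) is js) * t js) =
      (\<Sum>js\<in>idx n. if js = relist n s is then t js else 0)"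
    unfolding idx_def by (intro sum.cong refl) (simp add: c)
  also have "\<dots> = (if relist n s is \<in> idx n then t (relist n s is) else 0)" by simp
  also have "\<dots> = t (relist n s is)" by (simp add: idx_def)
  finally show "brauer_op n (brauer_perm n s) t is = perm_op n s t is"
    unfolding brauer_perm_def brauer_op_basis[OF perm_graph_in_brauer_graphs[OF assms]]
    by (simp add: graph_op_def perm_op_def)
qed

lemma perm_op_transpose:
  assumes "k \<in> {1..n}" "l \<in> {1..n}"
  shows "perm_op n (Transposition.transpose k l) t = swap_op n (k - 1) (l - 1) t"
proof
  fix "is" show "perm_op n (Transposition.transpose k l) t is = swap_op n (k - 1) (l - 1) t is"
    by (cases "length is = n") (simp_all only: perm_op_def swap_op_def relist_transpose[OF _ assms] of_bool_eq mult_zero_left)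
qed

lemma brauer_op_bar_eq:
  fixes t :: "'N::finite tensor"
  assumes kl: "k \<in> {1..n}" "l \<in> {1..n}" "k \<noteq> l"
  shows "brauer_op n (brauer_bar n k l) t = bar_op n (k - 1) (l - 1) t"
proof
  fix "is" :: "'N list"
  show "brauer_op n (brauer_bar n k l) t is = bar_op n (k - 1) (l - 1) t is"
  proof (cases "length is = n")
    case True
    have b: "k - 1 < n" "l - 1 < n" "k - 1 \<noteq> l - 1" using kl by auto
    have c: "compatible (bar_graph n k l) is js \<longleftrightarrow>
        is ! (k - 1) = is ! (l - 1) \<and> js ! (k - 1) = js ! (l - 1) \<and> js = is[k - 1 := js ! (k - 1), l - 1 := js ! (l - 1)]"
      if js: "length js = n" for js :: "'N list"
    proof -
      have "(\<forall>m\<in>{1..n} - {k, l}. is ! (m - 1) = js ! (m - 1)) \<longleftrightarrow>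
          js = is[k - 1 := js ! (k - 1), l - 1 := js ! (l - 1)]" (is "?L \<longleftrightarrow> ?R")
      proof
        assume L: ?L
        show ?R
        proof (rule nth_equalityI_pos[where n = n])
          fix m assume m: "m \<in> {1..n}"
          then have "m - 1 = k - 1 \<longleftrightarrow> m = k" "m - 1 = l - 1 \<longleftrightarrow> m = l" using kl by auto
          then show "js ! (m - 1) = is[k - 1 := js ! (k - 1), l - 1 := js ! (l - 1)] ! (m - 1)"
            using L m b True js by (auto simp: nth_list_update)
        qed (simp_all add: True js)
      next
        assume R: ?R
        show ?L
        proof
          fix m assume m: "m \<in> {1..n} - {k, l}"
          then have "m - 1 \<noteq> k - 1" "m - 1 \<noteq> l - 1" using kl by auto
          then show "is ! (m - 1) = js ! (m - 1)" by (subst R) simp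
        qed
      qed
      then show ?thesis unfolding compatible_bar_graph by blast
    qed
    have "(\<Sum>js | length js = n. of_bool (compatible (bar_graph n k l) is js) * t js) =
        of_bool (is ! (k - 1) = is ! (l - 1)) *
        (\<Sum>js\<in>{js \<in> idx n. js ! (k - 1) = js ! (l - 1) \<and> js = is[k - 1 := js ! (k - 1), l - 1 := js ! (l - 1)]}. t js)"
      unfolding sum_distrib_left by (rule sum.mono_neutral_cong_right) (auto simp: c idx_def finite_idx[unfolded idx_def])
    also have "(\<Sum>js\<in>{js \<in> idx n. js ! (k - 1) = js ! (l - 1) \<and> js = is[k - 1 := js ! (k - 1), l - 1 := js ! (l - 1)]}. t js) =
        (\<Sum>a\<in>UNIV. t (is[k - 1 := a, l - 1 := a]))"
      by (rule sum.reindex_bij_witness[where i = "\<lambda>a. is[k - 1 := a, l - 1 := a]" and j = "\<lambda>js. js ! (k - 1)"])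
        (use b True in \<open>auto simp: idx_def nth_list_update list_update_swap\<close>)
    finally show ?thesis
      unfolding brauer_bar_def brauer_op_basis[OF bar_graph_in_brauer_graphs[OF kl]]
      using True by (simp add: graph_op_def bar_op_def)
  next
    case False
    then show ?thesis
      unfolding brauer_bar_def brauer_op_basis[OF bar_graph_in_brauer_graphs[OF kl]]
      by (simp add: graph_op_def bar_op_def)
  qed
qed

lemma perm_op_in: "perm_op n s t \<in> tensors n"
  and swap_op_in: "swap_op n p q t \<in> tensors n"
  and bar_op_in: "bar_op n p q u \<in> tensors n"
  by (simp_all add: perm_op_def swap_op_def bar_op_def tensors_def)

lemma perm_op_perm_op: "s' permutes {1..n} \<Longrightarrow> perm_op n s (perm_op n s' t) = perm_op n (s \<circ> s') t"
  by (simp add: perm_op_def relist_relist fun_eq_iff)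

lemma perm_op_id: "t \<in> tensors n \<Longrightarrow> perm_op n id t = t"
  by (rule tensors_eqI[OF perm_op_in]) (simp_all add: perm_op_def relist_id)

subsection \<open>Equivariance\<close>

lemma orthogonal_group_sums:
  assumes "g \<in> orthogonal_group"
  shows "(\<Sum>a\<in>UNIV. g $ a $ b * g $ a $ c) = of_bool (b = c)"
    and "(\<Sum>a\<in>UNIV. g $ b $ a * g $ c $ a) = of_bool (b = c)"
proof -
  have "(transpose g ** g) $ b $ c = mat 1 $ b $ c" "(g ** transpose g) $ b $ c = mat 1 $ b $ c"
    using assms by (simp_all add: orthogonal_group_def orthogonal_matrix_def)
  then show "(\<Sum>a\<in>UNIV. g $ a $ b * g $ a $ c) = of_bool (b = c)"
    and "(\<Sum>a\<in>UNIV. g $ b $ a * g $ c $ a) = of_bool (b = c)"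
    by (simp_all add: matrix_matrix_mult_def transpose_def mat_def)
qed

lemma orthogonal_groupI:
  assumes "\<And>b c. (\<Sum>a\<in>UNIV. g $ a $ b * g $ a $ c) = of_bool (b = c)"
    and "\<And>b c. (\<Sum>a\<in>UNIV. g $ b $ a * g $ c $ a) = of_bool (b = c)"
  shows "g \<in> orthogonal_group"
  using assms by (simp add: orthogonal_group_def orthogonal_matrix_def vec_eq_iff
      matrix_matrix_mult_def transpose_def mat_def)

lemma sum_swap_innermost:
  "(\<Sum>c\<in>C. \<Sum>k\<in>K. \<Sum>a\<in>A. \<Sum>b\<in>B. f c k a b) = (\<Sum>k\<in>K. \<Sum>a\<in>A. \<Sum>b\<in>B. \<Sum>c\<in>C. f c k a b)"
proof -
  have "(\<Sum>c\<in>C. \<Sum>k\<in>K. \<Sum>a\<in>A. \<Sum>b\<in>B. f c k a b) = (\<Sum>k\<in>K. \<Sum>c\<in>C. \<Sum>a\<in>A. \<Sum>b\<in>B. f c k a b)"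
    by (rule sum.swap)
  also have "\<dots> = (\<Sum>k\<in>K. \<Sum>a\<in>A. \<Sum>c\<in>C. \<Sum>b\<in>B. f c k a b)"
    by (intro sum.cong refl sum.swap)
  also have "\<dots> = (\<Sum>k\<in>K. \<Sum>a\<in>A. \<Sum>b\<in>B. \<Sum>c\<in>C. f c k a b)"
    by (intro sum.cong refl sum.swap)
  finally show ?thesis .
qed

definition adjoint_matrix :: "complex^'N^'N \<Rightarrow> complex^'N^'N"
  where "adjoint_matrix g = (\<chi> i j. cnj (g $ j $ i))"

text \<open>Complex conjugation preserves the orthogonality relations, and transposition exchanges
  those of the rows with those of the columns.\<close>

lemma adjoint_matrix_orthogonal:
  assumes "g \<in> orthogonal_group"
  shows "adjoint_matrix g \<in> orthogonal_group"
proof (rule orthogonal_groupI)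
  fix b c :: 'a
  show "(\<Sum>a\<in>UNIV. adjoint_matrix g $ a $ b * adjoint_matrix g $ a $ c) = of_bool (b = c)"
    using arg_cong[OF orthogonal_group_sums(2)[OF assms, of b c], of cnj]
    by (simp add: adjoint_matrix_def)
  show "(\<Sum>a\<in>UNIV. adjoint_matrix g $ b $ a * adjoint_matrix g $ c $ a) = of_bool (b = c)"
    using arg_cong[OF orthogonal_group_sums(1)[OF assms, of b c], of cnj]
    by (simp add: adjoint_matrix_def)
qed

lemma cinner_tensor_act:
  "cinner (idx n) (tensor_act g t) s = cinner (idx n) t (tensor_act (adjoint_matrix g) s)"
proof -
  have "cinner (idx n) (tensor_act g t) s =
      (\<Sum>is\<in>idx n. \<Sum>js\<in>idx n. (\<Prod>p<n. g $ (is ! p) $ (js ! p)) * t js * cnj (s is))"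
    unfolding cinner_def by (intro sum.cong refl) (simp add: tensor_act_eq idx_def sum_distrib_right)
  also have "\<dots> = (\<Sum>js\<in>idx n. \<Sum>is\<in>idx n. (\<Prod>p<n. g $ (is ! p) $ (js ! p)) * t js * cnj (s is))"
    by (rule sum.swap)
  also have "\<dots> = cinner (idx n) t (tensor_act (adjoint_matrix g) s)"
    unfolding cinner_def
    by (intro sum.cong refl) (simp add: tensor_act_eq idx_def sum_distrib_left adjoint_matrix_def mult_ac)
  finally show ?thesis .
qed

lemma prod_relist:
  assumes "s permutes {1..n}"
  shows "(\<Prod>p<n. f (relist n s xs ! p) (relist n s ys ! p)) = (\<Prod>p<n. f (xs ! p) (ys ! p) :: complex)"
proof -
  have shift: "(\<Prod>p<n. h (p + 1)) = (\<Prod>m\<in>{1..n}. h m)" for h :: "nat \<Rightarrow> complex"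
    by (rule prod.reindex_bij_witness[where i = "\<lambda>m. m - 1" and j = "\<lambda>p. p + 1"]) auto
  have "(\<Prod>p<n. f (relist n s xs ! p) (relist n s ys ! p)) =
      (\<Prod>p<n. f (relist n s xs ! (p + 1 - 1)) (relist n s ys ! (p + 1 - 1)))" by simp
  also have "\<dots> = (\<Prod>m\<in>{1..n}. f (relist n s xs ! (m - 1)) (relist n s ys ! (m - 1)))"
    by (rule shift)
  also have "\<dots> = (\<Prod>m\<in>{1..n}. f (xs ! (s m - 1)) (ys ! (s m - 1)))"
    by (intro prod.cong refl) (simp only: nth_relist)
  also have "\<dots> = (\<Prod>m\<in>{1..n}. f (xs ! (m - 1)) (ys ! (m - 1)))"
    using prod.permute[OF assms, of "\<lambda>m. f (xs ! (m - 1)) (ys ! (m - 1))"] by (simp add: o_def)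
  also have "\<dots> = (\<Prod>p<n. f (xs ! (p + 1 - 1)) (ys ! (p + 1 - 1)))" by (rule shift[symmetric])
  finally show ?thesis by simp
qed

lemma tensor_act_perm_op:
  assumes "s permutes {1..n}"
  shows "tensor_act g (perm_op n s t) = perm_op n s (tensor_act g t)"
proof
  fix "is"
  show "tensor_act g (perm_op n s t) is = perm_op n s (tensor_act g t) is"
  proof (cases "length is = n")
    case True
    have "tensor_act g (perm_op n s t) is =
        (\<Sum>js\<in>idx n. (\<Prod>p<n. g $ (relist n s is ! p) $ (relist n s js ! p)) * t (relist n s js))"
      unfolding prod_relist[OF assms, of "\<lambda>a b. g $ a $ b"] tensor_act_eq True
      by (intro sum.cong refl) (simp add: perm_op_def idx_def)
    also have "\<dots> = perm_op n s (tensor_act g t) is"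
      unfolding sum_relist[OF assms, of "\<lambda>js. (\<Prod>p<n. g $ (relist n s is ! p) $ (js ! p)) * t js"]
      by (simp add: perm_op_def True tensor_act_eq)
    finally show ?thesis .
  next
    case False
    then show ?thesis by (simp add: tensor_act_eq perm_op_def idx_def)
  qed
qed

text \<open>Contracting \<open>p\<close> with \<open>q\<close> absorbs \<open>g\<close> by the
  column relations, and the inserted pair of equal labels absorbs it by the row relations. Both
  sides become the same sum \<open>S\<close>, in which \<open>g\<close> acts on the other positions
  only.\<close>

lemma tensor_act_bar_op:
  assumes g: "g \<in> orthogonal_group" and pq: "p < n" "q < n" "p \<noteq> q"
  shows "tensor_act g (bar_op n p q t) = bar_op n p q (tensor_act g t)"
proof
  fix "is" :: "'a list"
  show "tensor_act g (bar_op n p q t) is = bar_op n p q (tensor_act g t) is"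
  proof (cases "length is = n")
    case True
    define P where "P is js = (\<Prod>r\<in>{..<n} - {p, q}. g $ (is ! r) $ (js ! r))" for "is" js
    define J where "J = {ks :: 'a list \<in> idx n. ks ! p = undefined \<and> ks ! q = undefined}"
    have full: "(\<Prod>r<n. g $ (is ! r) $ (js ! r)) = g $ (is ! p) $ (js ! p) * (g $ (is ! q) $ (js ! q) * P is js)"
      for "is" js
    proof -
      have "{..<n} = insert p (insert q ({..<n} - {p, q}))" using pq by auto
      then have "(\<Prod>r<n. g $ (is ! r) $ (js ! r)) =
          (\<Prod>r\<in>insert p (insert q ({..<n} - {p, q})). g $ (is ! r) $ (js ! r))" by simp
      then show ?thesis using pq(3) by (simp add: P_def)
    qed
    have P1: "P is (ks[p := a, q := b]) = P is ks" "P (is[p := a, q := b]) ks = P is ks" for "is" ks a b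
      unfolding P_def by (intro prod.cong refl; simp)+
    have len: "length ks = n" if "ks \<in> J" for ks using that by (simp add: J_def idx_def)
    define S where "S = (\<Sum>ks\<in>J. P is ks * (\<Sum>a\<in>UNIV. t (ks[p := a, q := a])))"
    have "tensor_act g (bar_op n p q t) is =
        (\<Sum>ks\<in>J. \<Sum>a\<in>UNIV. \<Sum>b\<in>UNIV. g $ (is ! p) $ a * (g $ (is ! q) $ b * P is ks) *
          (of_bool (a = b) * (\<Sum>c\<in>UNIV. t (ks[p := c, q := c]))))"
      unfolding tensor_act_eq True sum_idx_split2[OF pq] full J_def[symmetric] P1
      using pq len by (intro sum.cong refl) (simp add: bar_op_def list_update_swap[of q p])
    also have "\<dots> = (\<Sum>ks\<in>J. \<Sum>a\<in>UNIV. \<Sum>b\<in>UNIV. if b = a then g $ (is ! p) $ a * g $ (is ! q) $ a *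
          (P is ks * (\<Sum>c\<in>UNIV. t (ks[p := c, q := c]))) else 0)"
      by (intro sum.cong refl) auto
    also have "\<dots> = (\<Sum>ks\<in>J. (\<Sum>a\<in>UNIV. g $ (is ! p) $ a * g $ (is ! q) $ a) *
          (P is ks * (\<Sum>c\<in>UNIV. t (ks[p := c, q := c]))))"
      by (simp add: sum_distrib_right)
    also have "\<dots> = of_bool (is ! p = is ! q) * S"
      unfolding orthogonal_group_sums(2)[OF g] S_def by (simp only: sum_distrib_left)
    finally have lhs: "tensor_act g (bar_op n p q t) is = of_bool (is ! p = is ! q) * S" .
    have "(\<Sum>c\<in>UNIV. tensor_act g t (is[p := c, q := c])) =
        (\<Sum>c\<in>UNIV. \<Sum>ks\<in>J. \<Sum>a\<in>UNIV. \<Sum>b\<in>UNIV. g $ c $ a * (g $ c $ b * P is ks) * t (ks[p := a, q := b]))"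
      unfolding tensor_act_eq length_list_update True sum_idx_split2[OF pq] full J_def[symmetric] P1
      using pq len True by (intro sum.cong refl) simp
    also have "\<dots> = (\<Sum>ks\<in>J. \<Sum>a\<in>UNIV. \<Sum>b\<in>UNIV. \<Sum>c\<in>UNIV. g $ c $ a * (g $ c $ b * P is ks) * t (ks[p := a, q := b]))"
      by (rule sum_swap_innermost)
    also have "\<dots> = (\<Sum>ks\<in>J. \<Sum>a\<in>UNIV. \<Sum>b\<in>UNIV. (\<Sum>c\<in>UNIV. g $ c $ a * g $ c $ b) * (P is ks * t (ks[p := a, q := b])))"
      by (intro sum.cong refl) (simp add: sum_distrib_right sum_distrib_left mult_ac)
    also have "\<dots> = (\<Sum>ks\<in>J. \<Sum>a\<in>UNIV. \<Sum>b\<in>UNIV. if b = a then P is ks * t (ks[p := a, q := a]) else 0)"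
      unfolding orthogonal_group_sums(1)[OF g] by (intro sum.cong refl) auto
    also have "\<dots> = S" by (simp add: S_def sum_distrib_left)
    finally show ?thesis using lhs True by (simp add: bar_op_def)
  next
    case False
    then show ?thesis by (simp add: tensor_act_eq bar_op_def idx_def)
  qed
qed

lemma tensor_act_contract_last:
  assumes g: "g \<in> orthogonal_group"
  shows "tensor_act g (contract_last t) = contract_last (tensor_act g t)"
proof
  fix "is" :: "'a list"
  define n where "n = length is"
  define P where "P ks = (\<Prod>r<n. g $ (is ! r) $ (ks ! r))" for ks
  have full: "(\<Prod>r<n + 2. g $ ((is @ [c, c]) ! r) $ ((ks @ [a, b]) ! r)) = P ks * g $ c $ a * g $ c $ b"
    if "ks \<in> idx n" for ks a b c
  proof -
    have "(\<Prod>r<n. g $ ((is @ [c, c]) ! r) $ ((ks @ [a, b]) ! r)) = P ks"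
      unfolding P_def using that by (intro prod.cong refl) (simp add: n_def nth_append idx_def)
    moreover have "length ks = n" using that by (simp add: idx_def)
    ultimately show ?thesis by (simp add: numeral_2_eq_2 nth_append n_def)
  qed
  have len: "length (is @ [c, c]) = n + 2" for c by (simp add: n_def)
  have "contract_last (tensor_act g t) is = (\<Sum>c\<in>UNIV. \<Sum>ks\<in>idx n. \<Sum>a\<in>UNIV. \<Sum>b\<in>UNIV.
      (\<Prod>r<n + 2. g $ ((is @ [c, c]) ! r) $ ((ks @ [a, b]) ! r)) * t (ks @ [a, b]))"
    unfolding contract_last_def tensor_act_eq len sum_idx_append2 by (rule refl)
  also have "\<dots> = (\<Sum>c\<in>UNIV. \<Sum>ks\<in>idx n. \<Sum>a\<in>UNIV. \<Sum>b\<in>UNIV. P ks * g $ c $ a * g $ c $ b * t (ks @ [a, b]))"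
    by (intro sum.cong refl) (simp only: full)
  also have "\<dots> = (\<Sum>ks\<in>idx n. \<Sum>a\<in>UNIV. \<Sum>b\<in>UNIV. \<Sum>c\<in>UNIV. P ks * g $ c $ a * g $ c $ b * t (ks @ [a, b]))"
    by (rule sum_swap_innermost)
  also have "\<dots> = (\<Sum>ks\<in>idx n. \<Sum>a\<in>UNIV. \<Sum>b\<in>UNIV. (\<Sum>c\<in>UNIV. g $ c $ a * g $ c $ b) * (P ks * t (ks @ [a, b])))"
    by (intro sum.cong refl) (simp add: sum_distrib_right sum_distrib_left mult_ac)
  also have "\<dots> = (\<Sum>ks\<in>idx n. \<Sum>a\<in>UNIV. \<Sum>b\<in>UNIV. if b = a then P ks * t (ks @ [a, a]) else 0)"
    unfolding orthogonal_group_sums(1)[OF g] by (intro sum.cong refl) auto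
  also have "\<dots> = tensor_act g (contract_last t) is"
    by (simp add: tensor_act_eq contract_last_def P_def sum_distrib_left n_def)
  finally show "tensor_act g (contract_last t) is = contract_last (tensor_act g t) is" by simp
qed

subsection \<open>The Lie algebra\<close>

definition gl_op :: "'N \<Rightarrow> 'N \<Rightarrow> 'N tensor \<Rightarrow> 'N tensor"
  where "gl_op i j t = (\<lambda>is. \<Sum>p<length is. of_bool (is ! p = i) * t (is[p := j]))"

definition so_op :: "'N \<Rightarrow> 'N \<Rightarrow> 'N tensor \<Rightarrow> 'N tensor"
  where "so_op i j t = gl_op i j t - gl_op j i t"

lemma gl_op_in: "t \<in> tensors n \<Longrightarrow> gl_op i j t \<in> tensors n"
  by (simp add: tensors_def gl_op_def)

lemma so_op_in: "t \<in> tensors n \<Longrightarrow> so_op i j t \<in> tensors n"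
  unfolding so_op_def by (intro complex_vector.subspace_diff subspace_tensors gl_op_in)

text \<open>The angle is complex because it is differentiated over the complex numbers. The signs
  make E_ij - E_ji the derivative at 0.\<close>

definition rotation :: "'N \<Rightarrow> 'N \<Rightarrow> complex \<Rightarrow> complex^'N::finite^'N"
  where "rotation i j z = (\<chi> a b. if a = i then if b = i then cos z else if b = j then sin z else 0
    else if a = j then if b = i then - sin z else if b = j then cos z else 0
    else of_bool (a = b))"

text \<open>Rotations alone would not exclude the determinant tensor, in which every label occurs
  once; reflections do.\<close>

definition reflection :: "'N \<Rightarrow> complex^'N::finite^'N"
  where "reflection i = (\<chi> a b. if a = b then if a = i then -1 else 1 else 0)"

lemma rotation_orthogonal:
  assumes "i \<noteq> j"
  shows "rotation i j z \<in> orthogonal_group"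
proof (rule orthogonal_groupI)
  fix b c :: 'a
  have U: "(\<Sum>a\<in>UNIV. f a) = f i + (f j + (\<Sum>a\<in>UNIV - {i, j}. f a))" for f :: "'a \<Rightarrow> complex"
  proof -
    have "sum f UNIV = sum f (insert i (insert j (UNIV - {i, j})))"
      by (rule arg_cong[where f = "sum f"]) auto
    then show ?thesis using assms by simp
  qed
  have sc: "sin z * sin z + cos z * cos z = 1" "cos z * cos z + sin z * sin z = 1"
    using sin_cos_squared_add[of z] by (simp_all add: power2_eq_square add.commute)
  have rest: "(\<Sum>a\<in>UNIV - {i, j}. of_bool (a = b) * of_bool (a = c)) = (of_bool (b = c \<and> b \<noteq> i \<and> b \<noteq> j) :: complex)" for b c :: 'a
  proof -
    have "(\<Sum>a\<in>UNIV - {i, j}. of_bool (a = b) * of_bool (a = c)) =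
        (\<Sum>a\<in>UNIV - {i, j}. if a = b then of_bool (b = c) else (0 :: complex))"
      by (intro sum.cong) auto
    also have "\<dots> = (if b \<in> UNIV - {i, j} then of_bool (b = c) else 0)" by (subst sum.delta) auto
    finally show ?thesis by auto
  qed
  have r1: "(\<Sum>a\<in>UNIV - {i, j}. rotation i j z $ a $ b * rotation i j z $ a $ c) =
      (\<Sum>a\<in>UNIV - {i, j}. of_bool (a = b) * of_bool (a = c))"
    by (intro sum.cong refl) (simp add: rotation_def)
  have r2: "(\<Sum>a\<in>UNIV - {i, j}. rotation i j z $ b $ a * rotation i j z $ c $ a) =
      (\<Sum>a\<in>UNIV - {i, j}. of_bool (a = b) * of_bool (a = c))"
    by (intro sum.cong refl) (auto simp: rotation_def)
  show "(\<Sum>a\<in>UNIV. rotation i j z $ a $ b * rotation i j z $ a $ c) = of_bool (b = c)"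
    unfolding U r1 rest using assms sc by (auto simp: rotation_def)
  show "(\<Sum>a\<in>UNIV. rotation i j z $ b $ a * rotation i j z $ c $ a) = of_bool (b = c)"
    unfolding U r2 rest using assms sc by (auto simp: rotation_def)
qed

lemma reflection_orthogonal: "reflection i \<in> orthogonal_group"
proof (rule orthogonal_groupI)
  fix b c :: 'a
  have "(\<Sum>a\<in>UNIV. reflection i $ a $ b * reflection i $ a $ c) = (\<Sum>a\<in>UNIV. if a = b then of_bool (b = c) else 0)"
    by (intro sum.cong refl) (auto simp: reflection_def)
  then show "(\<Sum>a\<in>UNIV. reflection i $ a $ b * reflection i $ a $ c) = of_bool (b = c)" by simp
  have "(\<Sum>a\<in>UNIV. reflection i $ b $ a * reflection i $ c $ a) = (\<Sum>a\<in>UNIV. if a = b then of_bool (b = c) else 0)"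
    by (intro sum.cong refl) (auto simp: reflection_def)
  then show "(\<Sum>a\<in>UNIV. reflection i $ b $ a * reflection i $ c $ a) = of_bool (b = c)" by simp
qed

lemma tensor_act_reflection:
  "tensor_act (reflection i) t is = (-1) ^ card {p. p < length is \<and> is ! p = i} * t is"
proof -
  have "(\<Prod>p<length is. reflection i $ (is ! p) $ (js ! p)) =
      (if js = is then (-1) ^ card {p. p < length is \<and> is ! p = i} else 0)" if js: "js \<in> idx (length is)" for js
  proof (cases "js = is")
    case True
    have "(\<Prod>p<length is. reflection i $ (is ! p) $ (is ! p)) = (\<Prod>p<length is. if is ! p = i then -1 else 1)"
      by (intro prod.cong refl) (simp add: reflection_def)
    also have "\<dots> = (-1) ^ card ({..<length is} \<inter> {p. is ! p = i})"
      by (simp add: prod.If_cases)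
    also have "{..<length is} \<inter> {p. is ! p = i} = {p. p < length is \<and> is ! p = i}" by auto
    finally show ?thesis using True by simp
  next
    case False
    then obtain p where "p < length is" "is ! p \<noteq> js ! p"
      using js by (auto simp: list_eq_iff_nth_eq idx_def)
    then have "\<exists>p\<in>{..<length is}. reflection i $ (is ! p) $ (js ! p) = 0"
      by (auto simp: reflection_def)
    then show ?thesis using False by (simp add: prod_zero)
  qed
  then have "tensor_act (reflection i) t is =
      (\<Sum>js\<in>idx (length is). if js = is then (-1) ^ card {p. p < length is \<and> is ! p = i} * t is else 0)"
    unfolding tensor_act_eq by (intro sum.cong refl) simp
  also have "\<dots> = (if is \<in> idx (length is) then (-1) ^ card {p. p < length is \<and> is ! p = i} * t is else 0)"
    by simp
  finally show ?thesis by (simp add: idx_def)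
qed

text \<open>The product rule differentiates one matrix entry at a time. At 0 all other entries are
  Kronecker deltas, so only index lists that differ from \<open>is\<close> in at most one position
  contribute.\<close>

lemma DERIV_tensor_act_rotation:
  assumes "i \<noteq> j"
  shows "((\<lambda>z. tensor_act (rotation i j z) t is) has_field_derivative so_op i j t is) (at 0)"
proof -
  define n where "n = length is"
  define d :: "'a \<Rightarrow> 'a \<Rightarrow> complex" where "d a b = of_bool (a = i \<and> b = j) - of_bool (a = j \<and> b = i)" for a b
  have r0: "rotation i j 0 $ a $ b = of_bool (a = b)" for a b
    using assms by (auto simp: rotation_def)
  have dr: "((\<lambda>z. rotation i j z $ a $ b) has_field_derivative d a b) (at 0)" for a b
    using assms unfolding rotation_def d_def
    by (cases "a = i"; cases "a = j"; cases "b = i"; cases "b = j") (auto intro!: derivative_eq_intros)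
  have dp: "((\<lambda>z. \<Prod>p<n. rotation i j z $ (is ! p) $ (js ! p)) has_field_derivative
      (\<Sum>p<n. d (is ! p) (js ! p) * (\<Prod>q\<in>{..<n} - {p}. of_bool (is ! q = js ! q)))) (at 0)" for js
    using has_field_derivative_prod[of "{..<n}" "\<lambda>p z. rotation i j z $ (is ! p) $ (js ! p)", OF dr] by (simp add: r0)
  have "((\<lambda>z. tensor_act (rotation i j z) t is) has_field_derivative
      (\<Sum>js\<in>idx n. (\<Sum>p<n. d (is ! p) (js ! p) * (\<Prod>q\<in>{..<n} - {p}. of_bool (is ! q = js ! q))) * t js)) (at 0)"
    unfolding tensor_act_eq n_def[symmetric] by (intro DERIV_sum DERIV_cmult_right dp)
  moreover have "(\<Sum>js\<in>idx n. (\<Sum>p<n. d (is ! p) (js ! p) * (\<Prod>q\<in>{..<n} - {p}. of_bool (is ! q = js ! q))) * t js) =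
      so_op i j t is"
  proof -
    have "(\<Sum>js\<in>idx n. d (is ! p) (js ! p) * (\<Prod>q\<in>{..<n} - {p}. of_bool (is ! q = js ! q)) * t js) =
        of_bool (is ! p = i) * t (is[p := j]) - of_bool (is ! p = j) * t (is[p := i])" if p: "p < n" for p
    proof -
      have "(\<Sum>js\<in>idx n. d (is ! p) (js ! p) * (\<Prod>q\<in>{..<n} - {p}. of_bool (is ! q = js ! q)) * t js) =
          (\<Sum>js\<in>(\<lambda>b. is[p := b]) ` UNIV. d (is ! p) (js ! p) * (\<Prod>q\<in>{..<n} - {p}. of_bool (is ! q = js ! q)) * t js)"
      proof (rule sum.mono_neutral_right)
        show "(\<lambda>b. is[p := b]) ` UNIV \<subseteq> idx n" by (auto simp: idx_def n_def)
        show "\<forall>js\<in>idx n - range (\<lambda>b. is[p := b]).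
            d (is ! p) (js ! p) * (\<Prod>q\<in>{..<n} - {p}. of_bool (is ! q = js ! q)) * t js = 0"
        proof
          fix js assume js: "js \<in> idx n - range (\<lambda>b. is[p := b])"
          then have "js \<noteq> is[p := js ! p]" by blast
          then obtain q where "q < n" "js ! q \<noteq> is[p := js ! p] ! q"
            using js by (auto simp: list_eq_iff_nth_eq idx_def n_def)
          then have "q \<in> {..<n} - {p}" "is ! q \<noteq> js ! q"
            using js p by (auto simp: nth_list_update idx_def n_def split: if_splits)
          then have "(\<Prod>q\<in>{..<n} - {p}. of_bool (is ! q = js ! q)) = (0 :: complex)"
            by (intro prod_zero) auto
          then show "d (is ! p) (js ! p) * (\<Prod>q\<in>{..<n} - {p}. of_bool (is ! q = js ! q)) * t js = 0"
            by simp
        qed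
      qed simp
      also have "\<dots> = (\<Sum>b\<in>UNIV. d (is ! p) b * t (is[p := b]))"
      proof (subst sum.reindex)
        show "inj (\<lambda>b. is[p := b])"
        proof (rule injI)
          fix a b assume "is[p := a] = is[p := b]"
          then have "is[p := a] ! p = is[p := b] ! p" by simp
          then show "a = b" using p by (simp add: n_def)
        qed
        have "(\<Prod>q\<in>{..<n} - {p}. of_bool (is ! q = is[p := b] ! q)) = (1 :: complex)" for b
          by (intro prod.neutral) simp
        then show "sum ((\<lambda>js. d (is ! p) (js ! p) * (\<Prod>q\<in>{..<n} - {p}. of_bool (is ! q = js ! q)) * t js) \<circ>
            (\<lambda>b. is[p := b])) UNIV = (\<Sum>b\<in>UNIV. d (is ! p) b * t (is[p := b]))"
          using p by (intro sum.cong refl) (simp add: n_def)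
      qed
      also have "\<dots> = (\<Sum>b\<in>UNIV. (if b = j then of_bool (is ! p = i) * t (is[p := j]) else 0) -
          (if b = i then of_bool (is ! p = j) * t (is[p := i]) else 0))"
        by (intro sum.cong refl) (auto simp: d_def)
      also have "\<dots> = of_bool (is ! p = i) * t (is[p := j]) - of_bool (is ! p = j) * t (is[p := i])"
        by (simp add: sum_subtractf)
      finally show ?thesis .
    qed
    then have "(\<Sum>p<n. \<Sum>js\<in>idx n. d (is ! p) (js ! p) * (\<Prod>q\<in>{..<n} - {p}. of_bool (is ! q = js ! q)) * t js) =
        so_op i j t is"
      by (simp add: so_op_def gl_op_def n_def sum_subtractf)
    then show ?thesis
      unfolding sum_distrib_right by (subst sum.swap) simp
  qed
  ultimately show ?thesis by simp
qed

text \<open>Differentiate the equivariance along the rotations at 0. A linear map is a finite matrix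
  here, so it may be differentiated term by term, and derivatives are unique.\<close>

lemma equivariant_commutes_so_op:
  fixes A :: "'N::finite tensor \<Rightarrow> 'N tensor"
  assumes lin: "linear_on (tensors n) A"
    and eqv: "\<And>g t. g \<in> orthogonal_group \<Longrightarrow> t \<in> tensors n \<Longrightarrow> A (tensor_act g t) = tensor_act g (A t)"
    and t: "t \<in> tensors n" and ij: "i \<noteq> j"
  shows "A (so_op i j t) = so_op i j (A t)"
proof
  fix "is"
  have ker: "A s is = (\<Sum>js\<in>idx n. s js * A (pure_tensor js) is)" if "s \<in> tensors n" for s
    by (subst linear_on_tensor_expansion[OF lin that]) (simp add: scaleC_apply)
  have "((\<lambda>z. \<Sum>js\<in>idx n. tensor_act (rotation i j z) t js * A (pure_tensor js) is)
      has_field_derivative (\<Sum>js\<in>idx n. so_op i j t js * A (pure_tensor js) is)) (at 0)"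
    by (intro DERIV_sum DERIV_cmult_right DERIV_tensor_act_rotation ij)
  then have "((\<lambda>z. A (tensor_act (rotation i j z) t) is) has_field_derivative A (so_op i j t) is) (at 0)"
    unfolding ker[OF tensor_act_in[OF t]] ker[OF so_op_in[OF t]] .
  moreover have "((\<lambda>z. A (tensor_act (rotation i j z) t) is) has_field_derivative so_op i j (A t) is) (at 0)"
    unfolding eqv[OF rotation_orthogonal[OF ij] t] by (rule DERIV_tensor_act_rotation[OF ij])
  ultimately show "A (so_op i j t) is = so_op i j (A t) is" by (rule DERIV_unique)
qed

subsection \<open>Invariant sesquilinear forms\<close>

definition equivariant :: "nat \<Rightarrow> nat \<Rightarrow> ('N::finite tensor \<Rightarrow> 'N tensor) \<Rightarrow> bool"
  where "equivariant m l L \<longleftrightarrow> linear_on (tensors m) L \<and> L ` tensors m \<subseteq> tensors l \<and>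
    (\<forall>g\<in>orthogonal_group. \<forall>t\<in>tensors m. L (tensor_act g t) = tensor_act g (L t))"

lemma cinner_gl_op: "cinner (idx n) (gl_op i j t) s = cinner (idx n) t (gl_op j i s)"
  for t s :: "'N::finite tensor"
proof -
  have "(\<Sum>is\<in>idx n. of_bool (is ! p = i) * t (is[p := j]) * cnj (s is)) =
      (\<Sum>is\<in>idx n. t is * cnj (of_bool (is ! p = j) * s (is[p := i])))" if p: "p < n" for p
  proof -
    have "(\<Sum>is\<in>idx n. of_bool (is ! p = i) * t (is[p := j]) * cnj (s is)) =
        (\<Sum>is\<in>{is \<in> idx n. is ! p = i}. t (is[p := j]) * cnj (s is))"
      by (rule sum.mono_neutral_cong_right) auto
    also have "\<dots> = (\<Sum>is\<in>{is \<in> idx n. is ! p = j}. t is * cnj (s (is[p := i])))"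
      by (rule sum.reindex_bij_witness[where i = "\<lambda>is. is[p := i]" and j = "\<lambda>is. is[p := j]"])
        (use p in \<open>auto simp: idx_def\<close>)
    also have "\<dots> = (\<Sum>is\<in>idx n. t is * cnj (of_bool (is ! p = j) * s (is[p := i])))"
      by (rule sum.mono_neutral_cong_left) auto
    finally show ?thesis .
  qed
  then have 1: "(\<Sum>p<n. \<Sum>is\<in>idx n. of_bool (is ! p = i) * t (is[p := j]) * cnj (s is)) =
      (\<Sum>p<n. \<Sum>is\<in>idx n. t is * cnj (of_bool (is ! p = j) * s (is[p := i])))"
    by (rule sum.cong[OF refl]) (simp only: lessThan_iff)
  have 2: "cinner (idx n) (gl_op i j t) s =
      (\<Sum>is\<in>idx n. \<Sum>p<n. of_bool (is ! p = i) * t (is[p := j]) * cnj (s is))"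
    unfolding cinner_def gl_op_def by (intro sum.cong refl) (simp only: idx_def mem_Collect_eq sum_distrib_right)
  have 3: "cinner (idx n) t (gl_op j i s) =
      (\<Sum>is\<in>idx n. \<Sum>p<n. t is * cnj (of_bool (is ! p = j) * s (is[p := i])))"
    unfolding cinner_def gl_op_def cnj_sum by (intro sum.cong refl) (simp only: idx_def mem_Collect_eq sum_distrib_left)
  show ?thesis
    unfolding 2 3 by (subst (1 2) sum.swap) (rule 1)
qed

lemma cinner_so_op: "cinner (idx n) (so_op i j t) s = - cinner (idx n) t (so_op i j s)"
  for t s :: "'N::finite tensor"
  by (simp add: so_op_def cinner_diff_left cinner_diff_right cinner_gl_op)

section \<open>The array of a sesquilinear form\<close>

lemma gl_op_pure_tensor:
  "gl_op i j (pure_tensor js) = (\<Sum>p<length js. of_bool (js ! p = j) *\<^sub>C pure_tensor (js[p := i]))"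
proof
  fix "is"
  show "gl_op i j (pure_tensor js) is = (\<Sum>p<length js. of_bool (js ! p = j) *\<^sub>C pure_tensor (js[p := i])) is"
  proof (cases "length is = length js")
    case True
    have "of_bool (is ! p = i) * pure_tensor js (is[p := j]) = of_bool (js ! p = j) * pure_tensor (js[p := i]) is"
      if "p < length js" for p
    proof -
      have "is ! p = i \<and> is[p := j] = js \<longleftrightarrow> js ! p = j \<and> is = js[p := i]"
        using that True by (metis list_update_id list_update_overwrite nth_list_update_eq)
      then show ?thesis by (auto simp: pure_tensor_def)
    qed
    then have "(\<Sum>p<length js. of_bool (is ! p = i) * pure_tensor js (is[p := j])) =
        (\<Sum>p<length js. of_bool (js ! p = j) * pure_tensor (js[p := i]) is)"
      by (intro sum.cong[OF refl]) (simp only: lessThan_iff)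
    then show ?thesis by (simp only: gl_op_def True scaleC_apply fun_sum_apply)
  next
    case False
    then have "is[p := j] \<noteq> js" "is \<noteq> js[p := i]" for p by (metis length_list_update)+
    then show ?thesis by (simp add: gl_op_def pure_tensor_def scaleC_apply)
  qed
qed

text \<open>A form in two tensors becomes an array on \<open>m + m'\<close> positions: the first
  block carries the index of one tensor, the second block that of the other. The restriction makes
  the labeling extensional, as \<open>assigns\<close> demands.\<close>

definition join :: "'N list \<Rightarrow> 'N list \<Rightarrow> nat \<Rightarrow> 'N"
  where "join js ks = (\<lambda>p\<in>{..<length js + length ks}. (js @ ks) ! p)"

lemma join_in: "js \<in> idx m \<Longrightarrow> ks \<in> idx m' \<Longrightarrow> join js ks \<in> assigns {..<m + m'}"
  by (simp add: join_def assigns_def idx_def)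

lemma join_upd1: "p < length js \<Longrightarrow> join (js[p := a]) ks = (join js ks)(p := a)"
  by (auto simp: join_def fun_eq_iff nth_append nth_list_update)

lemma join_upd2: "p < length ks \<Longrightarrow> join js (ks[p := a]) = (join js ks)(length js + p := a)"
  by (auto simp: join_def fun_eq_iff nth_append nth_list_update)

lemma join_map:
  assumes "x \<in> assigns {..<m + m'}"
  shows "join (map x [0..<m]) (map x [m..<m + m']) = x"
proof
  fix p
  have "x p = undefined" if "\<not> p < m + m'"
    using assms that by (auto simp: assigns_def PiE_def extensional_def)
  then show "join (map x [0..<m]) (map x [m..<m + m']) p = x p"
    by (simp add: join_def nth_append)
qed

text \<open>The Gram matrix of the form that sends \<open>u\<close> and \<open>u'\<close> to the
  inner product of \<open>L u\<close> and \<open>L' u'\<close>, read as a vector of the tensor power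
  of order \<open>m + m'\<close>.\<close>

definition form_array :: "nat \<Rightarrow> nat \<Rightarrow> nat \<Rightarrow> ('N::finite tensor \<Rightarrow> 'N tensor) \<Rightarrow> ('N tensor \<Rightarrow> 'N tensor) \<Rightarrow>
    (nat \<Rightarrow> 'N) \<Rightarrow> complex"
  where "form_array m m' l L L' x = (if x \<in> assigns {..<m + m'} then
    cinner (idx l) (L (pure_tensor (map x [0..<m]))) (L' (pure_tensor (map x [m..<m + m']))) else 0)"

lemma form_array_join:
  assumes "js \<in> idx m" "ks \<in> idx m'"
  shows "form_array m m' l L L' (join js ks) = cinner (idx l) (L (pure_tensor js)) (L' (pure_tensor ks))"
proof -
  have "map (join js ks) [0..<m] = js" "map (join js ks) [m..<m + m'] = ks"
    using assms by (auto simp: join_def idx_def nth_append list_eq_iff_nth_eq)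
  then show ?thesis using join_in[OF assms] by (simp add: form_array_def)
qed

lemma pure_tensor_idx: "js \<in> idx m \<Longrightarrow> pure_tensor js \<in> tensors m"
  using pure_tensor_in[of js] by (simp add: idx_def)

lemma equivariant_gl_pure:
  assumes "equivariant m l L" "js \<in> idx m"
  shows "L (gl_op i j (pure_tensor js)) = (\<Sum>p<m. of_bool (js ! p = j) *\<^sub>C L (pure_tensor (js[p := i])))"
proof -
  have lin: "linear_on (tensors m) L" using assms(1) by (simp add: equivariant_def)
  have m: "length js = m" using assms(2) by (simp add: idx_def)
  have p: "pure_tensor (js[p := i]) \<in> tensors m" for p
    by (rule pure_tensor_idx) (simp add: idx_def m)
  have "L (gl_op i j (pure_tensor js)) = (\<Sum>p<m. L (of_bool (js ! p = j) *\<^sub>C pure_tensor (js[p := i])))"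
    unfolding gl_op_pure_tensor m
    by (rule linear_on_sum[OF lin subspace_tensors]) (rule complex_vector.subspace_scale[OF subspace_tensors p])
  also have "\<dots> = (\<Sum>p<m. of_bool (js ! p = j) *\<^sub>C L (pure_tensor (js[p := i])))"
    by (rule sum.cong[OF refl]) (use lin p in \<open>simp add: linear_on_def\<close>)
  finally show ?thesis .
qed

text \<open>The Hermitian form is not invariant under the complex group, but the reflections are
  isometries and the operators \<open>so_op\<close> are skew for it, as their matrices are real.
  Equivariance of \<open>L\<close> and \<open>L'\<close> carries these two properties over to the
  array.\<close>

lemma so_invariant_form_array:
  fixes L L' :: "'N::finite tensor \<Rightarrow> 'N tensor"
  assumes L: "equivariant m l L" and L': "equivariant m' l L'"
  shows "so_invariant {..<m + m'} (form_array m m' l L L')"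
  unfolding so_invariant_def
proof (intro conjI ballI allI impI)
  let ?K = "form_array m m' l L L'"
  show "?K \<in> supp_on (assigns {..<m + m'})" by (simp add: form_array_def supp_on_def)
  fix x :: "nat \<Rightarrow> 'N" assume x: "x \<in> assigns {..<m + m'}"
  define js where "js = map x [0..<m]"
  define ks where "ks = map x [m..<m + m']"
  have jk: "js \<in> idx m" "ks \<in> idx m'" by (simp_all add: js_def ks_def idx_def)
  have xj: "x = join js ks" using join_map[OF x] by (simp add: js_def ks_def)
  have xp: "x p = js ! p" if "p < m" for p using that by (simp add: js_def)
  have xq: "x (m + p) = ks ! p" if "p < m'" for p using that by (simp add: ks_def)
  let ?w = "L (pure_tensor js)" and ?w' = "L' (pure_tensor ks)"
  show "?K x = 0" if odd: "odd (card {p \<in> {..<m + m'}. x p = i})" for i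
  proof -
    let ?R = "tensor_act (reflection i)"
    let ?c = "card {p. p < m \<and> js ! p = i}" and ?c' = "card {p. p < m' \<and> ks ! p = i}"
    have R: "?R (pure_tensor is) = (-1) ^ card {p. p < n \<and> is ! p = i} *\<^sub>C pure_tensor is"
      if "is \<in> idx n" for "is" n
    proof
      fix xs show "?R (pure_tensor is) xs = ((-1) ^ card {p. p < n \<and> is ! p = i} *\<^sub>C pure_tensor is) xs"
        using that by (simp add: tensor_act_reflection scaleC_apply pure_tensor_def idx_def)
    qed
    have RR: "cinner (idx l) (?R t) (?R s) = cinner (idx l) t s" for t s
    proof -
      have "(-1) ^ c * a * cnj ((-1) ^ c * b) = a * cnj b" for c :: nat and a b :: complex
        by (cases "even c") simp_all
      then show ?thesis unfolding cinner_def tensor_act_reflection by (intro sum.cong refl)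
    qed
    have lin: "L (c *\<^sub>C pure_tensor js) = c *\<^sub>C ?w" "L' (c *\<^sub>C pure_tensor ks) = c *\<^sub>C ?w'" for c
      using L L' pure_tensor_idx[OF jk(1)] pure_tensor_idx[OF jk(2)] by (simp_all add: equivariant_def linear_on_def)
    have eqv: "L (?R (pure_tensor js)) = ?R ?w" "L' (?R (pure_tensor ks)) = ?R ?w'"
      using L L' pure_tensor_idx[OF jk(1)] pure_tensor_idx[OF jk(2)] reflection_orthogonal[of i]
      by (simp_all add: equivariant_def)
    have "{p \<in> {..<m + m'}. x p = i} =
        {p. p < m \<and> js ! p = i} \<union> (\<lambda>p. m + p) ` {p. p < m' \<and> ks ! p = i}"
    proof (intro equalityI subsetI)
      fix p assume p: "p \<in> {p \<in> {..<m + m'}. x p = i}"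
      show "p \<in> {p. p < m \<and> js ! p = i} \<union> (\<lambda>p. m + p) ` {p. p < m' \<and> ks ! p = i}"
      proof (cases "p < m")
        case True
        then show ?thesis using p xp by simp
      next
        case False
        then have "p = m + (p - m)" "p - m < m'" using p by auto
        then show ?thesis using p xq[of "p - m"] by auto
      qed
    qed (auto simp: xp xq)
    then have "card {p \<in> {..<m + m'}. x p = i} =
        card {p. p < m \<and> js ! p = i} + card ((\<lambda>p. m + p) ` {p. p < m' \<and> ks ! p = i})"
      by (simp only:) (intro card_Un_disjoint; auto)
    then have "card {p \<in> {..<m + m'}. x p = i} = ?c + ?c'"
      by (simp add: card_image)
    then have sgn: "(-1) ^ (?c + ?c') = (-1 :: complex)" using odd by simp
    have "cinner (idx l) ?w ?w' = cinner (idx l) (?R ?w) (?R ?w')" by (simp only: RR)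
    also have "\<dots> = (-1) ^ (?c + ?c') * cinner (idx l) ?w ?w'"
      unfolding eqv[symmetric] R[OF jk(1)] R[OF jk(2)] lin cinner_scaleC_left cinner_scaleC_right
      by (simp add: power_add)
    finally have "cinner (idx l) ?w ?w' = 0" unfolding sgn by simp
    then show ?thesis unfolding xj by (simp add: form_array_join[OF jk])
  qed
  show "dop {..<m + m'} i j ?K x = dop {..<m + m'} j i ?K x" for i j
  proof (cases "i = j")
    case False
    \<comment> \<open>Acting on coordinates by a matrix unit corresponds to acting on basis vectors
      by its transpose, hence the exchanged indices on the right.\<close>
    have dop: "dop {..<m + m'} i j ?K x =
        cinner (idx l) (L (gl_op j i (pure_tensor js))) ?w' + cinner (idx l) ?w (L' (gl_op j i (pure_tensor ks)))" for i j
    proof -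
      have split: "(\<Sum>p<m + m'. f p) = (\<Sum>p<m. f p) + (\<Sum>p<m'. f (m + p))" for f :: "nat \<Rightarrow> complex"
        by (induction m') (simp_all add: add.assoc)
      have "of_bool (x p = i) * ?K (x(p := j)) = of_bool (js ! p = i) * cinner (idx l) (L (pure_tensor (js[p := j]))) ?w'"
        if p: "p < m" for p
      proof -
        have j: "js[p := j] \<in> idx m" using jk by (simp add: idx_def)
        have "x(p := j) = join (js[p := j]) ks" using p jk(1) by (simp add: xj join_upd1 idx_def)
        then show ?thesis by (simp add: form_array_join[OF j jk(2)] xp p)
      qed
      moreover have "of_bool (x (m + p) = i) * ?K (x(m + p := j)) =
          of_bool (ks ! p = i) * cinner (idx l) ?w (L' (pure_tensor (ks[p := j])))" if p: "p < m'" for p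
      proof -
        have k: "ks[p := j] \<in> idx m'" using jk by (simp add: idx_def)
        have "x(m + p := j) = join js (ks[p := j])" using p jk by (simp add: xj join_upd2 idx_def)
        then show ?thesis by (simp add: form_array_join[OF jk(1) k] xq p)
      qed
      ultimately have "dop {..<m + m'} i j ?K x =
          (\<Sum>p<m. of_bool (js ! p = i) * cinner (idx l) (L (pure_tensor (js[p := j]))) ?w') +
          (\<Sum>p<m'. of_bool (ks ! p = i) * cinner (idx l) ?w (L' (pure_tensor (ks[p := j]))))"
        unfolding dop_def split by (intro arg_cong2[where f = "(+)"] sum.cong refl) simp_all
      moreover have "cnj (of_bool P) = of_bool P" for P by (cases P) simp_all
      ultimately show ?thesis
        by (simp only: equivariant_gl_pure[OF L jk(1)] equivariant_gl_pure[OF L' jk(2)]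
          cinner_sum_left cinner_sum_right cinner_scaleC_left cinner_scaleC_right)
    qed
    have gl: "gl_op i j (pure_tensor is) \<in> tensors n" if "is \<in> idx n" for i j n and "is" :: "'N list"
      by (rule gl_op_in[OF pure_tensor_idx[OF that]])
    have diff: "M (a - b) = M a - M b" if "linear_on (tensors n) M" "a \<in> tensors n" "b \<in> tensors n"
      for n and M :: "'N tensor \<Rightarrow> 'N tensor" and a b
    proof -
      have "M (a - b + b) = M (a - b) + M b"
        using that complex_vector.subspace_diff[OF subspace_tensors that(2,3)] unfolding linear_on_def by blast
      then show ?thesis by simp
    qed
    have so: "M (so_op j i (pure_tensor is)) = M (gl_op j i (pure_tensor is)) - M (gl_op i j (pure_tensor is))"
      "M (so_op j i (pure_tensor is)) = so_op j i (M (pure_tensor is))"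
      if M: "equivariant n l M" and "is \<in> idx n" for n M "is"
    proof -
      have lin: "linear_on (tensors n) M" using M by (simp add: equivariant_def)
      show "M (so_op j i (pure_tensor is)) = M (gl_op j i (pure_tensor is)) - M (gl_op i j (pure_tensor is))"
        unfolding so_op_def by (rule diff[OF lin gl gl]) (fact that)+
      show "M (so_op j i (pure_tensor is)) = so_op j i (M (pure_tensor is))"
        by (rule equivariant_commutes_so_op[OF lin _ pure_tensor_idx[OF that(2)]])
          (use M False in \<open>auto simp: equivariant_def\<close>)
    qed
    have "dop {..<m + m'} i j ?K x - dop {..<m + m'} j i ?K x =
        cinner (idx l) (L (so_op j i (pure_tensor js))) ?w' + cinner (idx l) ?w (L' (so_op j i (pure_tensor ks)))"
      unfolding dop so(1)[OF L jk(1)] so(1)[OF L' jk(2)] cinner_diff_left cinner_diff_right by simp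
    also have "\<dots> = 0"
      unfolding so(2)[OF L jk(1)] so(2)[OF L' jk(2)] cinner_so_op by simp
    finally show ?thesis by simp
  qed simp
qed

section \<open>Evaluation on traceless tensors\<close>

definition eval_array :: "nat \<Rightarrow> nat \<Rightarrow> 'N::finite tensor \<Rightarrow> 'N tensor \<Rightarrow> ((nat \<Rightarrow> 'N) \<Rightarrow> complex) \<Rightarrow> complex"
  where "eval_array m m' u u' K = (\<Sum>js\<in>idx m. \<Sum>ks\<in>idx m'. u js * cnj (u' ks) * K (join js ks))"

lemma eval_form_array:
  fixes L L' :: "'N::finite tensor \<Rightarrow> 'N tensor"
  assumes L: "equivariant m l L" and L': "equivariant m' l L'" and u: "u \<in> tensors m" "u' \<in> tensors m'"
  shows "cinner (idx l) (L u) (L' u') = eval_array m m' u u' (form_array m m' l L L')"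
proof -
  have "L u = (\<Sum>js\<in>idx m. u js *\<^sub>C L (pure_tensor js))" "L' u' = (\<Sum>ks\<in>idx m'. u' ks *\<^sub>C L' (pure_tensor ks))"
    using L L' u by (simp_all only: equivariant_def linear_on_tensor_expansion)
  then have e: "cinner (idx l) (L u) t = (\<Sum>js\<in>idx m. u js * cinner (idx l) (L (pure_tensor js)) t)"
    "cinner (idx l) t (L' u') = (\<Sum>ks\<in>idx m'. cnj (u' ks) * cinner (idx l) t (L' (pure_tensor ks)))" for t
    by (simp_all only: cinner_sum_left cinner_sum_right cinner_scaleC_left cinner_scaleC_right)
  have "cinner (idx l) (L u) (L' u') =
      (\<Sum>js\<in>idx m. \<Sum>ks\<in>idx m'. u js * (cnj (u' ks) * cinner (idx l) (L (pure_tensor js)) (L' (pure_tensor ks))))"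
    unfolding e(1) by (subst e(2)) (simp only: sum_distrib_left)
  also have "\<dots> = eval_array m m' u u' (form_array m m' l L L')"
    unfolding eval_array_def by (intro sum.cong refl) (simp add: form_array_join)
  finally show ?thesis .
qed

lemma bar_op_eq_0D:
  fixes u :: "'N::finite tensor"
  assumes "bar_op m p q u = 0" "p < m" "q < m" "p \<noteq> q" "js \<in> idx m"
  shows "(\<Sum>a\<in>UNIV. u (js[p := a, q := a])) = 0"
proof -
  \<comment> \<open>A list with equal labels at \<open>p\<close> and \<open>q\<close>: there the
    indicator in \<open>bar_op\<close> is 1 and the sum over \<open>a\<close> is visible.\<close>
  let ?js = "js[p := undefined, q := undefined]"
  have "bar_op m p q u ?js = 0" by (simp add: assms(1))
  moreover have "?js[p := a, q := a] = js[p := a, q := a]" for a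
    using assms(2,3,5) by (intro nth_equalityI) (auto simp: nth_list_update idx_def)
  ultimately show ?thesis
    using assms by (simp add: bar_op_def idx_def)
qed

lemma traceless_bar_op:
  assumes "u \<in> traceless m" "p < m" "q < m" "p \<noteq> q"
  shows "bar_op m p q u = 0"
proof -
  have "p + 1 \<in> {1..m}" "q + 1 \<in> {1..m}" "p + 1 \<noteq> q + 1" using assms by auto
  then show ?thesis
    using assms(1) brauer_op_bar_eq[of "p + 1" m "q + 1" u] unfolding traceless_def by auto
qed

text \<open>As \<open>f\<close> depends on the entries at \<open>p\<close> and \<open>q\<close> only
  through their equality, the sum over these entries contracts \<open>u\<close>.\<close>

lemma sum_traceless:
  fixes u f :: "'N::finite list \<Rightarrow> complex"
  assumes pq: "p < m" "q < m" "p \<noteq> q"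
    and u: "\<And>js. js \<in> idx m \<Longrightarrow> (\<Sum>a\<in>UNIV. u (js[p := a, q := a])) = 0"
    and f: "\<And>js a b. js \<in> idx m \<Longrightarrow> f (js[p := a, q := b]) = of_bool (a = b) * h js"
  shows "(\<Sum>js\<in>idx m. u js * f js) = 0"
proof -
  have "(\<Sum>js\<in>idx m. u js * f js) =
      (\<Sum>ks\<in>{ks \<in> idx m. ks ! p = undefined \<and> ks ! q = undefined}. \<Sum>a\<in>UNIV. \<Sum>b\<in>UNIV.
        if b = a then u (ks[p := a, q := a]) * h ks else 0)"
    unfolding sum_idx_split2[OF pq] by (intro sum.cong refl) (auto simp: f)
  also have "\<dots> = (\<Sum>ks\<in>{ks \<in> idx m. ks ! p = undefined \<and> ks ! q = undefined}.
      (\<Sum>a\<in>UNIV. u (ks[p := a, q := a])) * h ks)"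
    by (simp add: sum_distrib_right)
  also have "\<dots> = 0" by (intro sum.neutral ballI) (simp add: u)
  finally show ?thesis .
qed

text \<open>Two blocks of positions can be paired without a pair inside a block only if they have
  equal size, hence the value 0 for \<open>m \<noteq> m'\<close>.\<close>

definition perm_form :: "nat \<Rightarrow> nat \<Rightarrow> 'N::finite tensor \<Rightarrow> 'N tensor \<Rightarrow> (nat \<Rightarrow> nat) \<Rightarrow> complex"
  where "perm_form m m' u u' \<sigma> = (if m = m' then cinner (idx m) (perm_op m \<sigma> u) u' else 0)"

text \<open>A pair inside one block contracts a traceless tensor and gives 0. Otherwise
  \<open>\<pi>\<close> matches the two blocks, so \<open>m = m'\<close>, and the matching is a
  permutation of the tensor factors.\<close>

lemma eval_pair_tensor:
  fixes u u' :: "'N::finite tensor"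
  assumes pr: "pairing {..<m + m'} \<pi>"
  shows "\<exists>c. \<forall>u\<in>traceless m. \<forall>u'\<in>traceless m'. eval_array m m' u u' (pair_tensor {..<m + m'} \<pi> :: (nat \<Rightarrow> 'N) \<Rightarrow> complex) =
    (\<Sum>\<sigma>\<in>symmetric_group m. c \<sigma> * perm_form m m' u u' \<sigma>)"
proof -
  let ?A = "{..<m + m'}" and ?\<theta> = "pair_tensor {..<m + m'} \<pi> :: (nat \<Rightarrow> 'N) \<Rightarrow> complex"
  have \<pi>: "\<pi> p < m + m'" "\<pi> p \<noteq> p" "\<pi> (\<pi> p) = p" if "p < m + m'" for p
    using bspec[OF pr[unfolded pairing_def], of p] that by simp_all
  show ?thesis
  proof (cases "\<exists>p<m. \<pi> p < m")
    case True
    then obtain p where p: "p < m" "\<pi> p < m" by blast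
    have "eval_array m m' u u' ?\<theta> = 0" if u: "u \<in> traceless m" for u u'
    proof -
      have "(\<Sum>js\<in>idx m. u js * ?\<theta> (join js ks)) = 0" if ks: "ks \<in> idx m'" for ks
      proof (rule sum_traceless)
        show pq: "p < m" "\<pi> p < m" "p \<noteq> \<pi> p" using p \<pi>(2)[of p] by auto
        show "(\<Sum>a\<in>UNIV. u (js[p := a, \<pi> p := a])) = 0" if "js \<in> idx m" for js
          by (rule bar_op_eq_0D[OF traceless_bar_op[OF u pq] pq that])
        show "?\<theta> (join (js[p := a, \<pi> p := b]) ks) =
            of_bool (a = b) * of_bool (\<forall>r\<in>?A - {p, \<pi> p}. join js ks (\<pi> r) = join js ks r)" if js: "js \<in> idx m" for js a b
        proof -
          have "join (js[p := a, \<pi> p := b]) ks = (join js ks)(p := a, \<pi> p := b)"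
            using p js by (simp add: join_upd1 idx_def)
          then show ?thesis
            using pair_tensor_upd[OF pr, of p "join js ks" a b] assigns_upd[OF assigns_upd[OF join_in[OF js ks]], of p "\<pi> p" a b] p \<pi>(1)[of p]
            by (simp only: lessThan_iff trans_less_add1)
        qed
      qed
      then have "(\<Sum>ks\<in>idx m'. cnj (u' ks) * (\<Sum>js\<in>idx m. u js * ?\<theta> (join js ks))) = 0"
        by (intro sum.neutral ballI) (simp only: mult_zero_right)
      moreover have "eval_array m m' u u' ?\<theta> = (\<Sum>ks\<in>idx m'. \<Sum>js\<in>idx m. cnj (u' ks) * (u js * ?\<theta> (join js ks)))"
        unfolding eval_array_def by (subst sum.swap) (intro sum.cong refl, simp only: mult_ac)
      ultimately show ?thesis by (simp only: sum_distrib_left)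
    qed
    then show ?thesis by (intro exI[of _ "\<lambda>_. 0"]) simp
  next
    case False
    then have up: "m \<le> \<pi> p" if "p < m" for p using that by (meson not_le)
    show ?thesis
    proof (cases "\<exists>p<m'. m \<le> \<pi> (m + p)")
      case True
      then obtain p where p: "p < m'" "m \<le> \<pi> (m + p)" by blast
      define q where "q = \<pi> (m + p) - m"
      have q: "\<pi> (m + p) = m + q" "q < m'" "q \<noteq> p" using p \<pi>[of "m + p"] by (auto simp: q_def)
      have "eval_array m m' u u' ?\<theta> = 0" if u': "u' \<in> traceless m'" for u u'
      proof -
        have "(\<Sum>ks\<in>idx m'. cnj (u' ks) * ?\<theta> (join js ks)) = 0" if js: "js \<in> idx m" for js
        proof (rule sum_traceless)
          show pq: "p < m'" "q < m'" "p \<noteq> q" using p q by auto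
          show "(\<Sum>a\<in>UNIV. cnj (u' (ks[p := a, q := a]))) = 0" if "ks \<in> idx m'" for ks
            using bar_op_eq_0D[OF traceless_bar_op[OF u' pq] pq that] unfolding cnj_sum[symmetric] by simp
          show "?\<theta> (join js (ks[p := a, q := b])) =
              of_bool (a = b) * of_bool (\<forall>r\<in>?A - {m + p, m + q}. join js ks (\<pi> r) = join js ks r)"
            if ks: "ks \<in> idx m'" for ks a b
          proof -
            have "join js (ks[p := a, q := b]) = (join js ks)(m + p := a, m + q := b)"
              using p q ks js by (simp add: join_upd2 idx_def)
            then show ?thesis
              using pair_tensor_upd[OF pr, of "m + p" "join js ks" a b] assigns_upd[OF assigns_upd[OF join_in[OF js ks]], of "m + p" "m + q" a b] p(1) q(2)
              by (simp only: q(1) lessThan_iff add_less_cancel_left)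
          qed
        qed
        then have "(\<Sum>js\<in>idx m. u js * (\<Sum>ks\<in>idx m'. cnj (u' ks) * ?\<theta> (join js ks))) = 0"
          by (intro sum.neutral ballI) (simp only: mult_zero_right)
        then show ?thesis unfolding eval_array_def by (simp only: sum_distrib_left mult.assoc)
      qed
      then show ?thesis by (intro exI[of _ "\<lambda>_. 0"]) simp
    next
      case no: False
      then have down: "\<pi> (m + p) < m" if "p < m'" for p using that by (meson not_le)
      have mm: "m = m'"
      proof -
        have "bij_betw (\<lambda>p. \<pi> p - m) {..<m} {..<m'}"
        proof (rule bij_betw_byWitness[where f' = "\<lambda>p. \<pi> (m + p)"])
          show "\<forall>p\<in>{..<m}. \<pi> (m + (\<pi> p - m)) = p" using up \<pi> by auto
          show "\<forall>p\<in>{..<m'}. \<pi> (\<pi> (m + p)) - m = p" using \<pi> by auto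
          show "(\<lambda>p. \<pi> p - m) ` {..<m} \<subseteq> {..<m'}"
          proof
            fix y assume "y \<in> (\<lambda>p. \<pi> p - m) ` {..<m}"
            then obtain p where "p < m" "y = \<pi> p - m" by blast
            then show "y \<in> {..<m'}" using up[of p] \<pi>(1)[of p] by auto
          qed
          show "(\<lambda>p. \<pi> (m + p)) ` {..<m'} \<subseteq> {..<m}" using down by auto
        qed
        then have "card {..<m} = card {..<m'}" by (rule bij_betw_same_card)
        then show ?thesis by simp
      qed
      \<comment> \<open>\<open>\<pi>\<close> sends position \<open>k - 1\<close> of the first block
        into the second one; removing the offset \<open>m\<close> and adding 1 leads back to the
        points 1, ..., m.\<close>
      define \<sigma> where "\<sigma> k = (if k \<in> {1..m} then \<pi> (k - 1) - m + 1 else k)" for k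
      have "\<sigma> permutes {1..m}"
      proof (rule bij_imp_permutes)
        show "bij_betw \<sigma> {1..m} {1..m}"
        proof (rule bij_betw_byWitness[where f' = "\<lambda>k. \<pi> (m + (k - 1)) + 1"])
          show "\<forall>k\<in>{1..m}. \<pi> (m + (\<sigma> k - 1)) + 1 = k"
          proof
            fix k assume k: "k \<in> {1..m}"
            then have "m + (\<pi> (k - 1) - m) = \<pi> (k - 1)" using up[of "k - 1"] by auto
            then show "\<pi> (m + (\<sigma> k - 1)) + 1 = k" using k \<pi>(3)[of "k - 1"] by (auto simp: \<sigma>_def)
          qed
          show "\<forall>k\<in>{1..m}. \<sigma> (\<pi> (m + (k - 1)) + 1) = k"
          proof
            fix k assume k: "k \<in> {1..m}"
            then have "\<pi> (m + (k - 1)) < m" using down[of "k - 1"] mm by auto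
            then show "\<sigma> (\<pi> (m + (k - 1)) + 1) = k" using k \<pi>(3)[of "m + (k - 1)"] mm by (auto simp: \<sigma>_def)
          qed
          show "\<sigma> ` {1..m} \<subseteq> {1..m}"
          proof
            fix y assume "y \<in> \<sigma> ` {1..m}"
            then obtain k where k: "k \<in> {1..m}" "y = \<sigma> k" by blast
            then have "k - 1 < m" by auto
            then have "\<pi> (k - 1) < m + m" using \<pi>(1)[of "k - 1"] mm by simp
            then have "\<pi> (k - 1) - m + 1 \<in> {1..m}" using k(1) by auto
            then show "y \<in> {1..m}" using k by (simp add: \<sigma>_def)
          qed
          show "(\<lambda>k. \<pi> (m + (k - 1)) + 1) ` {1..m} \<subseteq> {1..m}"
          proof
            fix y assume "y \<in> (\<lambda>k. \<pi> (m + (k - 1)) + 1) ` {1..m}"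
            then obtain k where k: "k \<in> {1..m}" "y = \<pi> (m + (k - 1)) + 1" by blast
            then have "k - 1 < m'" using mm by auto
            then show "y \<in> {1..m}" using down[of "k - 1"] k(2) by auto
          qed
        qed
      qed (auto simp: \<sigma>_def)
      then have \<sigma>: "\<sigma> \<in> symmetric_group m" by (simp add: symmetric_group_def)
      have \<theta>: "?\<theta> (join js ks) = of_bool (js = relist m \<sigma> ks)" if jk: "js \<in> idx m" "ks \<in> idx m'" for js ks
      proof -
        have x: "join js ks p = js ! p" "join js ks (m + p) = ks ! p" if "p < m" for p
          using that jk mm by (simp_all add: join_def idx_def nth_append)
        have \<pi>x: "join js ks (\<pi> p) = relist m \<sigma> ks ! p" if p: "p < m" for p
        proof -
          have "relist m \<sigma> ks ! p = ks ! (\<sigma> (p + 1) - 1)" using nth_relist[of "p + 1" m \<sigma> ks] p by simp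
          also have "\<dots> = ks ! (\<pi> p - m)" using p by (simp add: \<sigma>_def)
          also have "\<dots> = join js ks (m + (\<pi> p - m))" using x(2)[of "\<pi> p - m"] \<pi>(1)[of p] p mm up[OF p] by simp
          finally show ?thesis using up[OF p] by simp
        qed
        have "(\<forall>p\<in>?A. join js ks (\<pi> p) = join js ks p) \<longleftrightarrow> (\<forall>p<m. join js ks (\<pi> p) = join js ks p)"
        proof (intro iffI ballI allI impI)
          fix p assume h: "\<forall>p<m. join js ks (\<pi> p) = join js ks p" and p: "p \<in> ?A"
          show "join js ks (\<pi> p) = join js ks p"
          proof (cases "p < m")
            case False
            then have "\<pi> p < m" using down[of "p - m"] p by auto
            then have "join js ks (\<pi> (\<pi> p)) = join js ks (\<pi> p)" using h by blast
            then show ?thesis using \<pi>(3)[of p] p by simp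
          qed (use h in blast)
        qed simp
        also have "\<dots> \<longleftrightarrow> (\<forall>p<m. relist m \<sigma> ks ! p = js ! p)"
        proof -
          have "join js ks (\<pi> p) = join js ks p \<longleftrightarrow> relist m \<sigma> ks ! p = js ! p" if "p < m" for p
            by (simp only: \<pi>x[OF that] x(1)[OF that])
          then show ?thesis by blast
        qed
        also have "\<dots> \<longleftrightarrow> js = relist m \<sigma> ks"
          using jk(1) by (auto simp add: list_eq_iff_nth_eq idx_def)
        finally show ?thesis using join_in[OF jk] by (simp add: pair_tensor_def)
      qed
      have "eval_array m m' u u' ?\<theta> = perm_form m m' u u' \<sigma>" for u u'
      proof -
        have "eval_array m m' u u' ?\<theta> =
            (\<Sum>ks\<in>idx m'. \<Sum>js\<in>idx m. if js = relist m \<sigma> ks then u js * cnj (u' ks) else 0)"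
          unfolding eval_array_def by (subst sum.swap) (intro sum.cong refl, simp add: \<theta>)
        also have "\<dots> = (\<Sum>ks\<in>idx m'. if relist m \<sigma> ks \<in> idx m then u (relist m \<sigma> ks) * cnj (u' ks) else 0)"
          by simp
        also have "\<dots> = perm_form m m' u u' \<sigma>"
          unfolding perm_form_def cinner_def perm_op_def using mm
          by (simp add: idx_def)
        finally show ?thesis .
      qed
      moreover have "(\<Sum>\<tau>\<in>symmetric_group m. of_bool (\<tau> = \<sigma>) * perm_form m m' u u' \<tau>) = perm_form m m' u u' \<sigma>" for u u' :: "'N tensor"
      proof -
        have "(\<Sum>\<tau>\<in>symmetric_group m. of_bool (\<tau> = \<sigma>) * perm_form m m' u u' \<tau>) =
            (\<Sum>\<tau>\<in>symmetric_group m. if \<tau> = \<sigma> then perm_form m m' u u' \<sigma> else 0)"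
          by (intro sum.cong refl) simp
        also have "\<dots> = perm_form m m' u u' \<sigma>"
          using \<sigma> by (subst sum.delta) (simp_all add: symmetric_group_def finite_permutations)
        finally show ?thesis .
      qed
      ultimately show ?thesis by (intro exI[of _ "\<lambda>\<tau>. of_bool (\<tau> = \<sigma>)"]) simp
    qed
  qed
qed

text \<open>The array of the form is invariant and hence a combination of pairings, each of which is
  zero or a permutation on traceless tensors. That \<open>c\<close> is the same for all
  \<open>u\<close> and \<open>u'\<close> allows \<open>u\<close> to be symmetrized later.\<close>

proposition equivariant_form:
  fixes L L' :: "'N::finite tensor \<Rightarrow> 'N tensor"
  assumes L: "equivariant m l L" and L': "equivariant m' l L'"
  obtains c where "\<And>u u'. u \<in> traceless m \<Longrightarrow> u' \<in> traceless m' \<Longrightarrow>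
    cinner (idx l) (L u) (L' u') = (\<Sum>\<sigma>\<in>symmetric_group m. c \<sigma> * perm_form m m' u u' \<sigma>)"
proof -
  let ?G = "{K :: (nat \<Rightarrow> 'N) \<Rightarrow> complex. \<exists>c. \<forall>u\<in>traceless m. \<forall>u'\<in>traceless m'. eval_array m m' u u' K =
    (\<Sum>\<sigma>\<in>symmetric_group m. c \<sigma> * perm_form m m' u u' \<sigma>)}"
  have sub: "complex_vector.subspace ?G"
    unfolding complex_vector.subspace_def
  proof (intro conjI ballI allI)
    show "0 \<in> ?G" by (intro CollectI exI[of _ "\<lambda>_. 0"]) (simp add: eval_array_def)
    fix K K' assume "K \<in> ?G" "K' \<in> ?G"
    then obtain c c' where c: "\<forall>u\<in>traceless m. \<forall>u'\<in>traceless m'. eval_array m m' u u' K =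
        (\<Sum>\<sigma>\<in>symmetric_group m. c \<sigma> * perm_form m m' u u' \<sigma>)"
      "\<forall>u\<in>traceless m. \<forall>u'\<in>traceless m'. eval_array m m' u u' K' =
        (\<Sum>\<sigma>\<in>symmetric_group m. c' \<sigma> * perm_form m m' u u' \<sigma>)" by blast
    have "eval_array m m' u u' (K + K') = eval_array m m' u u' K + eval_array m m' u u' K'" for u u'
      by (simp add: eval_array_def algebra_simps sum.distrib)
    then show "K + K' \<in> ?G"
      using c by (intro CollectI exI[of _ "\<lambda>\<sigma>. c \<sigma> + c' \<sigma>"]) (simp add: algebra_simps sum.distrib)
  next
    fix a K assume "K \<in> ?G"
    then obtain c where c: "\<forall>u\<in>traceless m. \<forall>u'\<in>traceless m'. eval_array m m' u u' K =
        (\<Sum>\<sigma>\<in>symmetric_group m. c \<sigma> * perm_form m m' u u' \<sigma>)" by blast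
    have "eval_array m m' u u' (a *\<^sub>C K) = a * eval_array m m' u u' K" for u u'
      by (simp add: eval_array_def scaleC_apply sum_distrib_left mult_ac)
    then show "a *\<^sub>C K \<in> ?G"
      using c by (intro CollectI exI[of _ "\<lambda>\<sigma>. a * c \<sigma>"]) (simp add: sum_distrib_left mult_ac)
  qed
  have "complex_vector.span {pair_tensor {..<m + m'} \<pi> |\<pi>. pairing {..<m + m'} \<pi>} \<subseteq> ?G"
    by (rule complex_vector.span_minimal[OF _ sub]) (use eval_pair_tensor in blast)
  then have "form_array m m' l L L' \<in> ?G"
    using so_invariant_span_pairings[OF finite_lessThan so_invariant_form_array[OF L L']] by (rule subsetD)
  then obtain c where c: "\<forall>u\<in>traceless m. \<forall>u'\<in>traceless m'. eval_array m m' u u' (form_array m m' l L L') =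
      (\<Sum>\<sigma>\<in>symmetric_group m. c \<sigma> * perm_form m m' u u' \<sigma>)" by blast
  show ?thesis
  proof (rule that)
    fix u u' :: "'N tensor" assume u: "u \<in> traceless m" "u' \<in> traceless m'"
    then have "u \<in> tensors m" "u' \<in> tensors m'" by (simp_all add: traceless_def)
    then show "cinner (idx l) (L u) (L' u') = (\<Sum>\<sigma>\<in>symmetric_group m. c \<sigma> * perm_form m m' u u' \<sigma>)"
      using eval_form_array[OF L L'] c u by simp
  qed
qed

section \<open>Disjointness of the modules \<open>U(\<lambda>, N)\<close>\<close>

subsection \<open>Dominance\<close>

definition dominates :: "diagram \<Rightarrow> diagram \<Rightarrow> bool"
  where "dominates D E \<longleftrightarrow> (\<forall>k. card {b \<in> E. fst b < k} \<le> card {b \<in> D. fst b < k})"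

lemma young_diagramD: "young_diagram D \<Longrightarrow> (i, j) \<in> D \<Longrightarrow> i' \<le> i \<Longrightarrow> j' \<le> j \<Longrightarrow> (i', j') \<in> D"
  unfolding young_diagram_def by blast

text \<open>Rows are initial segments: without the box \<open>(k, j)\<close> row \<open>k\<close> of
  \<open>E\<close> has at most \<open>j\<close> boxes, whereas that of \<open>D\<close> has at least
  \<open>j + 1\<close>.\<close>

lemma young_diagram_row_subset:
  assumes "young_diagram D" "young_diagram E" "card {b \<in> D. fst b = k} = card {b \<in> E. fst b = k}" "(k, j) \<in> D"
  shows "(k, j) \<in> E"
proof (rule ccontr)
  assume notin: "(k, j) \<notin> E"
  have "{b \<in> E. fst b = k} \<subseteq> (\<lambda>i. (k, i)) ` {..<j}"
  proof
    fix b assume b: "b \<in> {b \<in> E. fst b = k}"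
    have "\<not> j \<le> snd b"
      using b notin assms(2) unfolding young_diagram_def by (cases b) auto
    then show "b \<in> (\<lambda>i. (k, i)) ` {..<j}" using b by (cases b) auto
  qed
  then have "card {b \<in> E. fst b = k} \<le> card ((\<lambda>i. (k, i)) ` {..<j})" by (intro card_mono) auto
  also have "\<dots> \<le> j" using card_image_le[of "{..<j}" "\<lambda>i. (k, i)"] by simp
  finally have le: "card {b \<in> E. fst b = k} \<le> j" .
  have "(\<lambda>i. (k, i)) ` {..j} \<subseteq> {b \<in> D. fst b = k}"
    using assms(1,4) unfolding young_diagram_def by auto
  moreover have "finite {b \<in> D. fst b = k}" using assms(1) by (simp add: young_diagram_def)
  ultimately have "card ((\<lambda>i. (k, i)) ` {..j}) \<le> card {b \<in> D. fst b = k}" by (intro card_mono)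
  moreover have "card ((\<lambda>i. (k, i)) ` {..j}) = Suc j" by (subst card_image) (auto intro: inj_onI)
  ultimately show False using le assms(3) by simp
qed

lemma dominates_antisym:
  assumes y: "young_diagram D" "young_diagram E" and d: "dominates D E" "dominates E D"
  shows "D = E"
proof -
  have eq: "card {b \<in> D. fst b < k} = card {b \<in> E. fst b < k}" for k
    using d unfolding dominates_def by (simp add: le_antisym)
  have row: "card {b \<in> F. fst b < Suc k} = card {b \<in> F. fst b < k} + card {b \<in> F. fst b = k}"
    if "young_diagram F" for F :: diagram and k
  proof -
    have "{b \<in> F. fst b < Suc k} = {b \<in> F. fst b < k} \<union> {b \<in> F. fst b = k}" by auto
    then show ?thesis using that by (simp add: young_diagram_def) (subst card_Un_disjoint, auto)
  qed
  have "card {b \<in> D. fst b = k} = card {b \<in> E. fst b = k}" for k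
    using row[OF y(1), of k] row[OF y(2), of k] eq[of k] eq[of "Suc k"] by simp
  then show ?thesis
    using young_diagram_row_subset[OF y] young_diagram_row_subset[OF y(2,1)] by auto
qed

text \<open>Count the entries in the first \<open>k\<close> rows of \<open>s\<close> by their
  columns in \<open>t\<close>. Those in one column lie in different rows of \<open>s\<close>, so
  their number is at most \<open>k\<close> and at most the length of the column; the smaller of the
  two is the number of boxes of this column in the first \<open>k\<close> rows.\<close>

lemma dominatesI:
  fixes t s :: "nat \<Rightarrow> nat \<times> nat"
  assumes D: "young_diagram D" and E: "young_diagram E"
    and t: "bij_betw t {1..m} D" and s: "bij_betw s {1..m} E"
    and inj: "\<And>a b. a \<in> {1..m} \<Longrightarrow> b \<in> {1..m} \<Longrightarrow> a \<noteq> b \<Longrightarrow> snd (t a) = snd (t b) \<Longrightarrow> fst (s a) \<noteq> fst (s b)"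
  shows "dominates D E"
  unfolding dominates_def
proof
  fix k
  have finD: "finite D" using D by (simp add: young_diagram_def)
  define X where "X c = {a \<in> {1..m}. snd (t a) = c \<and> fst (s a) < k}" for c
  have "card {b \<in> E. fst b < k} = card {a \<in> {1..m}. fst (s a) < k}"
  proof -
    have "bij_betw s {a \<in> {1..m}. fst (s a) < k} {b \<in> E. fst b < k}"
    proof (rule bij_betw_imageI)
      show "inj_on s {a \<in> {1..m}. fst (s a) < k}"
        by (rule inj_on_subset[OF bij_betw_imp_inj_on[OF s]]) blast
      show "s ` {a \<in> {1..m}. fst (s a) < k} = {b \<in> E. fst b < k}"
        unfolding bij_betw_imp_surj_on[OF s, symmetric] by blast
    qed
    then show ?thesis by (rule bij_betw_same_card[symmetric])
  qed
  also have "{a \<in> {1..m}. fst (s a) < k} = (\<Union>c\<in>snd ` D. X c)"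
    using bij_betwE[OF t] by (auto simp: X_def)
  also have "card \<dots> = (\<Sum>c\<in>snd ` D. card (X c))"
  proof (intro card_UN_disjoint ballI finite_imageI finD impI)
    show "finite (X c)" for c by (rule finite_subset[of _ "{1..m}"]) (auto simp: X_def)
  qed (auto simp: X_def)
  also have "\<dots> \<le> (\<Sum>c\<in>snd ` D. card {b \<in> D. snd b = c \<and> fst b < k})"
  proof (rule sum_mono)
    fix c
    let ?C = "{b \<in> D. snd b = c \<and> fst b < k}"
    show "card (X c) \<le> card ?C"
    proof (cases "\<forall>i<k. (i, c) \<in> D")
      case True
      have "inj_on (\<lambda>a. fst (s a)) (X c)"
        using inj unfolding inj_on_def X_def by blast
      then have "card (X c) = card ((\<lambda>a. fst (s a)) ` X c)" by (simp add: card_image)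
      also have "\<dots> \<le> card {..<k}" by (intro card_mono) (auto simp: X_def)
      also have "\<dots> = card ((\<lambda>i. (i, c)) ` {..<k})" by (subst card_image) (auto intro: inj_onI)
      also have "\<dots> \<le> card ?C" using True finD by (intro card_mono) auto
      finally show ?thesis .
    next
      case False
      then obtain i where i: "i < k" "(i, c) \<notin> D" by blast
      have "fst b < k" if "b \<in> D" "snd b = c" for b
      proof (rule ccontr)
        assume "\<not> fst b < k"
        moreover have "(fst b, c) \<in> D" unfolding that(2)[symmetric] using that(1) by simp
        ultimately have "(i, c) \<in> D" using young_diagramD[OF D, of "fst b" c i c] i(1) by simp
        then show False using i(2) by simp
      qed
      then have "t ` X c \<subseteq> ?C" using bij_betwE[OF t] unfolding X_def by blast
      moreover have "inj_on t (X c)"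
        by (rule inj_on_subset[OF bij_betw_imp_inj_on[OF t]]) (auto simp: X_def)
      ultimately show ?thesis using finD by (intro card_inj_on_le[of t]) auto
    qed
  qed
  also have "\<dots> = card (\<Union>c\<in>snd ` D. {b \<in> D. snd b = c \<and> fst b < k})"
    using finD by (intro card_UN_disjoint[symmetric]) auto
  also have "(\<Union>c\<in>snd ` D. {b \<in> D. snd b = c \<and> fst b < k}) = {b \<in> D. fst b < k}" by auto
  finally show "card {b \<in> E. fst b < k} \<le> card {b \<in> D. fst b < k}" .
qed

subsection \<open>Specht modules\<close>

lemma symmetric_group_inv: "s \<in> symmetric_group m \<Longrightarrow> inv s \<in> symmetric_group m"
  and symmetric_group_comp: "s \<in> symmetric_group m \<Longrightarrow> s' \<in> symmetric_group m \<Longrightarrow> s \<circ> s' \<in> symmetric_group m"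
  and finite_symmetric_group [simp]: "finite (symmetric_group m)"
  by (simp_all add: symmetric_group_def permutes_inv permutes_compose finite_permutations)

lemma symmetric_group_permutation: "s \<in> symmetric_group m \<Longrightarrow> permutation s"
  by (auto simp: symmetric_group_def permutation_permutes)

lemma symmetric_group_inverses:
  assumes "s \<in> symmetric_group m"
  shows "s \<circ> inv s = id" "inv s \<circ> s = id" "inv (inv s) = s" "s (inv s x) = x" "inv s (s x) = x" "bij s"
  using assms permutes_inv_o[of s "{1..m}"] permutes_inverses[of s "{1..m}"]
    permutes_inv_inv[of s "{1..m}"] permutes_bij[of s "{1..m}"]
  by (simp_all add: symmetric_group_def)

lemma symmetric_group_in: "s \<in> symmetric_group m \<Longrightarrow> s x \<in> {1..m} \<longleftrightarrow> x \<in> {1..m}"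
  by (simp only: symmetric_group_def mem_Collect_eq permutes_in_image)

lemma sum_symmetric_group_left:
  assumes "s \<in> symmetric_group m"
  shows "(\<Sum>q\<in>symmetric_group m. f (s \<circ> q)) = (\<Sum>q\<in>symmetric_group m. f q)"
  by (rule sum.reindex_bij_witness[where i = "\<lambda>q. inv s \<circ> q" and j = "\<lambda>q. s \<circ> q"])
    (simp_all add: symmetric_group_comp symmetric_group_inv assms symmetric_group_inverses[OF assms] flip: o_assoc,
      simp_all add: o_assoc symmetric_group_inverses[OF assms])

lemma sum_symmetric_group_right:
  assumes "s \<in> symmetric_group m"
  shows "(\<Sum>q\<in>symmetric_group m. f (q \<circ> s)) = (\<Sum>q\<in>symmetric_group m. f q)"
  by (rule sum.reindex_bij_witness[where i = "\<lambda>q. q \<circ> inv s" and j = "\<lambda>q. q \<circ> s"])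
    (simp_all add: symmetric_group_comp symmetric_group_inv assms o_assoc[symmetric] symmetric_group_inverses[OF assms])

section \<open>Tableaux, tabloids and polytabloids\<close>

definition tableaux :: "diagram \<Rightarrow> (nat \<Rightarrow> nat \<times> nat) set"
  where "tableaux D = {t. bij_betw t {1..card D} D}"

definition tabloids :: "diagram \<Rightarrow> (nat \<Rightarrow> nat) set"
  where "tabloids D = tabloid (card D) ` tableaux D"

lemma finite_tabloids: "finite D \<Longrightarrow> finite (tabloids D)"
proof -
  assume "finite D"
  then have "finite {r. \<forall>x. (x \<in> {1..card D} \<longrightarrow> r x \<in> fst ` D) \<and> (x \<notin> {1..card D} \<longrightarrow> r x = (0::nat))}"
    by (intro finite_set_of_finite_funs) auto
  moreover have "fst (t x) \<in> fst ` D" if "t \<in> tableaux D" "x \<in> {1..card D}" for t x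
    using that bij_betwE unfolding tableaux_def by blast
  ultimately show ?thesis
    by (elim finite_subset[rotated]) (auto simp: tabloids_def tabloid_def)
qed

lemma tableaux_perm:
  assumes "t \<in> tableaux D" "s \<in> symmetric_group (card D)"
  shows "t \<circ> s \<in> tableaux D"
  using assms permutes_imp_bij[of s "{1..card D}"] bij_betw_trans
  by (auto simp: tableaux_def symmetric_group_def)

lemma tabloid_comp:
  assumes "s \<in> symmetric_group m"
  shows "tabloid m t \<circ> s = tabloid m (t \<circ> s)"
proof
  fix x
  note symmetric_group_in[OF assms, of x]
  then show "(tabloid m t \<circ> s) x = tabloid m (t \<circ> s) x" by (simp add: tabloid_def)
qed

lemma column_group_subset: "column_group m t \<subseteq> symmetric_group m"
  by (auto simp: column_group_def)

lemma polytabloid_supp: "t \<in> tableaux D \<Longrightarrow> polytabloid (card D) t \<in> supp_on (tabloids D)"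
proof -
  assume t: "t \<in> tableaux D"
  have "polytabloid (card D) t r = 0" if "r \<notin> tabloids D" for r
  proof -
    have "r \<noteq> tabloid (card D) (t \<circ> inv q)" if "q \<in> column_group (card D) t" for q
      using \<open>r \<notin> tabloids D\<close> tableaux_perm[OF t symmetric_group_inv] column_group_subset that
      unfolding tabloids_def by fast
    then show ?thesis unfolding polytabloid_def by (intro sum.neutral) auto
  qed
  then show ?thesis by (simp add: supp_on_def)
qed

lemma specht_eq: "specht D = complex_vector.span (polytabloid (card D) ` tableaux D)"
  by (simp add: specht_def tableaux_def)

lemma specht_subset: "specht D \<subseteq> supp_on (tabloids D)"
  unfolding specht_eq by (rule complex_vector.span_minimal) (auto simp: polytabloid_supp subspace_supp_on)

lemma specht_act_add: "specht_act s (F + G) = specht_act s F + specht_act s G"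
  and specht_act_scaleC: "specht_act s (c *\<^sub>C F) = c *\<^sub>C specht_act s F"
  and specht_act_0: "specht_act s 0 = 0"
  by (simp_all add: specht_act_def fun_eq_iff scaleC_apply)

lemma specht_act_eq_tabloid:
  assumes s: "s \<in> symmetric_group m"
  shows "r \<circ> s = tabloid m t \<longleftrightarrow> r = tabloid m (t \<circ> inv s)"
proof
  assume "r \<circ> s = tabloid m t"
  then have "r \<circ> s \<circ> inv s = tabloid m t \<circ> inv s" by simp
  then show "r = tabloid m (t \<circ> inv s)"
    using tabloid_comp[OF symmetric_group_inv[OF s]] symmetric_group_inverses(1)[OF s] by (simp add: o_assoc[symmetric])
next
  assume "r = tabloid m (t \<circ> inv s)"
  then show "r \<circ> s = tabloid m t"
    using tabloid_comp[OF s, of "t \<circ> inv s"] symmetric_group_inverses(2)[OF s] by (simp add: o_assoc[symmetric])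
qed

text \<open>Conjugation by \<open>s\<close> carries the column group of \<open>t\<close> onto that
  of \<open>t \<circ> inv s\<close> and preserves signs.\<close>

lemma specht_act_polytabloid:
  assumes s: "s \<in> symmetric_group m"
  shows "specht_act s (polytabloid m t) = polytabloid m (t \<circ> inv s)"
proof
  fix r
  note S = symmetric_group_inverses[OF s]
  have "specht_act s (polytabloid m t) r =
      (\<Sum>q\<in>column_group m t. of_int (sign q) * of_bool (r = tabloid m (t \<circ> inv q \<circ> inv s)))"
    by (simp add: specht_act_def polytabloid_def specht_act_eq_tabloid[OF s])
  also have "\<dots> = (\<Sum>q\<in>column_group m (t \<circ> inv s). of_int (sign q) * of_bool (r = tabloid m (t \<circ> inv s \<circ> inv q)))"
  proof (rule sum.reindex_bij_witness[where i = "\<lambda>q. inv s \<circ> q \<circ> s" and j = "\<lambda>q. s \<circ> q \<circ> inv s"])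
    fix q assume q: "q \<in> column_group m t"
    then have qs: "q \<in> symmetric_group m" by (simp add: column_group_def)
    show "inv s \<circ> (s \<circ> q \<circ> inv s) \<circ> s = q" by (simp add: fun_eq_iff S)
    note in_iff = symmetric_group_in[OF symmetric_group_inv[OF s]]
    show "s \<circ> q \<circ> inv s \<in> column_group m (t \<circ> inv s)"
      unfolding column_group_def
    proof (intro CollectI conjI ballI)
      show "s \<circ> q \<circ> inv s \<in> symmetric_group m"
        by (intro symmetric_group_comp s qs symmetric_group_inv)
      fix p assume "p \<in> {1..m}"
      then have "snd (t (q (inv s p))) = snd (t (inv s p))" using q in_iff unfolding column_group_def by blast
      then show "snd ((t \<circ> inv s) ((s \<circ> q \<circ> inv s) p)) = snd ((t \<circ> inv s) p)" by (simp add: S)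
    qed
    have "sign (s \<circ> q \<circ> inv s) = sign q"
      using symmetric_group_permutation[OF s] symmetric_group_permutation[OF qs] permutation_inverse[of s]
      by (simp add: sign_compose permutation_compose sign_inverse sign_def[of s])
    moreover have "inv (s \<circ> q \<circ> inv s) = s \<circ> inv q \<circ> inv s"
      by (rule inv_unique_comp) (simp_all add: fun_eq_iff S symmetric_group_inverses[OF qs])
    moreover have "t \<circ> inv s \<circ> (s \<circ> inv q \<circ> inv s) = t \<circ> inv q \<circ> inv s" by (simp add: fun_eq_iff S)
    ultimately show "of_int (sign (s \<circ> q \<circ> inv s)) * of_bool (r = tabloid m (t \<circ> inv s \<circ> inv (s \<circ> q \<circ> inv s))) =
        (of_int (sign q) * of_bool (r = tabloid m (t \<circ> inv q \<circ> inv s)) :: complex)" by simp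
  next
    fix q assume q: "q \<in> column_group m (t \<circ> inv s)"
    then have qs: "q \<in> symmetric_group m" by (simp add: column_group_def)
    show "s \<circ> (inv s \<circ> q \<circ> s) \<circ> inv s = q" by (simp add: fun_eq_iff S)
    note in_iff = symmetric_group_in[OF s]
    show "inv s \<circ> q \<circ> s \<in> column_group m t"
      unfolding column_group_def
    proof (intro CollectI conjI ballI)
      show "inv s \<circ> q \<circ> s \<in> symmetric_group m"
        by (intro symmetric_group_comp s qs symmetric_group_inv)
      fix p assume "p \<in> {1..m}"
      then have "snd ((t \<circ> inv s) (q (s p))) = snd ((t \<circ> inv s) (s p))"
        using q in_iff unfolding column_group_def by blast
      then show "snd (t ((inv s \<circ> q \<circ> s) p)) = snd (t p)" by (simp add: S)
    qed
  qed
  finally show "specht_act s (polytabloid m t) r = polytabloid m (t \<circ> inv s) r"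
    by (simp add: polytabloid_def)
qed

lemma specht_act_in:
  assumes "w \<in> specht D" "s \<in> symmetric_group (card D)"
  shows "specht_act s w \<in> specht D"
proof -
  have "specht D \<subseteq> {w. specht_act s w \<in> specht D}"
    unfolding specht_eq
  proof (rule complex_vector.span_minimal)
    have "polytabloid (card D) (t \<circ> inv s) \<in> complex_vector.span (polytabloid (card D) ` tableaux D)"
      if "t \<in> tableaux D" for t
      by (intro complex_vector.span_base imageI tableaux_perm[OF that] symmetric_group_inv assms(2))
    then show "polytabloid (card D) ` tableaux D \<subseteq>
        {w. specht_act s w \<in> complex_vector.span (polytabloid (card D) ` tableaux D)}"
      by (auto simp: specht_act_polytabloid[OF assms(2)])
    show "complex_vector.subspace {w. specht_act s w \<in> complex_vector.span (polytabloid (card D) ` tableaux D)}"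
      by (simp add: complex_vector.subspace_def specht_act_add specht_act_scaleC specht_act_0
          complex_vector.span_zero complex_vector.span_add complex_vector.span_scale)
  qed
  then show ?thesis using assms(1) by blast
qed

text \<open>The transposition belongs to the column group, so left multiplication by it permutes
  this group and reverses the signs.\<close>

lemma specht_act_column_transposition:
  assumes ab: "a \<in> {1..m}" "b \<in> {1..m}" "a \<noteq> b" and col: "snd (t a) = snd (t b)"
  shows "specht_act (Transposition.transpose a b) (polytabloid m t) = (-1) *\<^sub>C polytabloid m t"
proof
  fix r
  let ?\<tau> = "Transposition.transpose a b"
  have \<tau>: "?\<tau> \<in> symmetric_group m" using ab by (simp add: symmetric_group_def permutes_swap_id)
  have \<tau>2: "?\<tau> \<circ> (?\<tau> \<circ> q) = q" "inv ?\<tau> = ?\<tau>" for q :: "nat \<Rightarrow> nat"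
    by (simp_all add: fun_eq_iff)
  have mem: "?\<tau> \<circ> q \<in> column_group m t" if "q \<in> column_group m t" for q
  proof -
    have "snd (t (?\<tau> x)) = snd (t x)" for x
      using col by (simp add: Transposition.transpose_def)
    then show ?thesis using that \<tau> by (simp add: column_group_def symmetric_group_comp)
  qed
  have "specht_act ?\<tau> (polytabloid m t) r =
      (\<Sum>q\<in>column_group m t. of_int (sign q) * of_bool (r = tabloid m (t \<circ> inv q \<circ> ?\<tau>)))"
    by (simp add: specht_act_def polytabloid_def specht_act_eq_tabloid[OF \<tau>] \<tau>2)
  also have "\<dots> = (\<Sum>q\<in>column_group m t. - of_int (sign q) * of_bool (r = tabloid m (t \<circ> inv q)))"
  proof (rule sum.reindex_bij_witness[where i = "\<lambda>q. ?\<tau> \<circ> q" and j = "\<lambda>q. ?\<tau> \<circ> q"])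
    fix q assume q: "q \<in> column_group m t"
    then have qs: "q \<in> symmetric_group m" by (simp add: column_group_def)
    have "sign (?\<tau> \<circ> q) = - sign q"
      using symmetric_group_permutation[OF qs] ab(3)
      by (simp add: sign_compose permutation_swap_id sign_swap_id)
    moreover have "inv (?\<tau> \<circ> q) = inv q \<circ> ?\<tau>"
      using symmetric_group_inverses(6)[OF qs] by (simp add: o_inv_distrib \<tau>2)
    ultimately show "- of_int (sign (?\<tau> \<circ> q)) * of_bool (r = tabloid m (t \<circ> inv (?\<tau> \<circ> q))) =
        (of_int (sign q) * of_bool (r = tabloid m (t \<circ> inv q \<circ> ?\<tau>)) :: complex)"
      by (simp add: o_assoc)
  qed (simp_all add: \<tau>2 mem)
  also have "\<dots> = ((-1) *\<^sub>C polytabloid m t) r"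
    by (simp add: polytabloid_def scaleC_apply sum_negf)
  finally show "specht_act ?\<tau> (polytabloid m t) r = ((-1) *\<^sub>C polytabloid m t) r" .
qed

subsection \<open>Traceless tensors\<close>

lemma traceless_iff:
  "u \<in> traceless m \<longleftrightarrow> u \<in> tensors m \<and> (\<forall>p<m. \<forall>q<m. p \<noteq> q \<longrightarrow> bar_op m p q u = 0)"
proof
  assume "u \<in> traceless m"
  then show "u \<in> tensors m \<and> (\<forall>p<m. \<forall>q<m. p \<noteq> q \<longrightarrow> bar_op m p q u = 0)"
    using traceless_bar_op by (auto simp: traceless_def)
next
  assume h: "u \<in> tensors m \<and> (\<forall>p<m. \<forall>q<m. p \<noteq> q \<longrightarrow> bar_op m p q u = 0)"
  have "brauer_op m (brauer_bar m k l) u = 0" if kl: "k \<in> {1..m}" "l \<in> {1..m}" "k \<noteq> l" for k l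
  proof -
    have "k - 1 < m" "l - 1 < m" "k - 1 \<noteq> l - 1" using kl by auto
    then show ?thesis using h brauer_op_bar_eq[OF kl, of u] by simp
  qed
  then show "u \<in> traceless m" using h by (simp add: traceless_def)
qed

lemma bar_op_add: "bar_op n p q (t + s) = bar_op n p q t + bar_op n p q s"
  and bar_op_scaleC: "bar_op n p q (c *\<^sub>C t) = c *\<^sub>C bar_op n p q t"
  and bar_op_0: "bar_op n p q 0 = (0 :: 'N::finite tensor)"
  for t s :: "'N::finite tensor"
  by (simp_all add: bar_op_def fun_eq_iff scaleC_apply algebra_simps sum.distrib sum_distrib_left)

lemma perm_op_add: "perm_op n \<sigma> (t + s) = perm_op n \<sigma> t + perm_op n \<sigma> s"
  and perm_op_scaleC: "perm_op n \<sigma> (c *\<^sub>C t) = c *\<^sub>C perm_op n \<sigma> t"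
  and perm_op_0: "perm_op n \<sigma> 0 = 0"
  by (simp_all add: perm_op_def fun_eq_iff scaleC_apply algebra_simps)

lemma perm_op_sum: "perm_op n \<sigma> (\<Sum>a\<in>A. t a) = (\<Sum>a\<in>A. perm_op n \<sigma> (t a))"
  by (simp add: perm_op_def fun_eq_iff sum_distrib_left del: sum_of_bool_mult_eq)

lemma subspace_traceless: "complex_vector.subspace (traceless m :: 'N::finite tensor set)"
proof -
  have "0 \<in> tensors m" "t \<in> tensors m \<Longrightarrow> s \<in> tensors m \<Longrightarrow> t + s \<in> tensors m" "t \<in> tensors m \<Longrightarrow> c *\<^sub>C t \<in> tensors m"
    for t s :: "'N tensor" and c
    by (simp_all add: complex_vector.subspace_0 complex_vector.subspace_add complex_vector.subspace_scale subspace_tensors)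
  then show ?thesis
    by (auto simp: complex_vector.subspace_def traceless_iff bar_op_add bar_op_scaleC bar_op_0)
qed

lemma traceless_subset: "traceless m \<subseteq> tensors m"
  by (auto simp: traceless_def)

lemma tensor_act_traceless:
  assumes "g \<in> orthogonal_group" "u \<in> traceless m"
  shows "tensor_act g u \<in> traceless m"
  unfolding traceless_iff
proof (intro conjI allI impI)
  show "tensor_act g u \<in> tensors m" using assms(2) by (simp add: traceless_iff tensor_act_in)
  fix p q assume pq: "p < m" "q < m" "p \<noteq> q"
  show "bar_op m p q (tensor_act g u) = 0"
    unfolding tensor_act_bar_op[OF assms(1) pq, symmetric] traceless_bar_op[OF assms(2) pq] by (rule tensor_act_0)
qed

text \<open>Contracting the permuted tensor at two positions contracts \<open>u\<close> at the
  positions that \<open>inv \<sigma>\<close> assigns to them.\<close>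

lemma perm_op_traceless:
  assumes \<sigma>: "\<sigma> \<in> symmetric_group m" and u: "u \<in> traceless m"
  shows "perm_op m \<sigma> u \<in> traceless m"
  unfolding traceless_iff
proof (intro conjI allI impI)
  have \<sigma>p: "\<sigma> permutes {1..m}" using \<sigma> by (simp add: symmetric_group_def)
  show "perm_op m \<sigma> u \<in> tensors m" by (rule perm_op_in)
  fix p q assume pq: "p < m" "q < m" "p \<noteq> q"
  define p' where "p' = inv \<sigma> (p + 1) - 1"
  define q' where "q' = inv \<sigma> (q + 1) - 1"
  have in1: "inv \<sigma> (p + 1) \<in> {1..m}" "inv \<sigma> (q + 1) \<in> {1..m}"
    using permutes_in_image[OF permutes_inv[OF \<sigma>p]] pq by simp_all
  have "inv \<sigma> (p + 1) \<noteq> inv \<sigma> (q + 1)"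
    using permutes_inj[OF permutes_inv[OF \<sigma>p]] pq(3) by (simp add: inj_eq)
  then have pq': "p' < m" "q' < m" "p' \<noteq> q'" using in1 by (auto simp: p'_def q'_def)
  have eq: "relist m \<sigma> (is[p := a, q := a]) = (relist m \<sigma> is)[p' := a, q' := a]" if "length is = m" for "is" a
  proof (rule nth_equalityI_pos[where n = m])
    fix k assume k: "k \<in> {1..m}"
    then have \<sigma>k: "\<sigma> k \<in> {1..m}" using permutes_in_image[OF \<sigma>p] by blast
    have "\<sigma> k - 1 = p \<longleftrightarrow> \<sigma> k = p + 1" "\<sigma> k - 1 = q \<longleftrightarrow> \<sigma> k = q + 1" using \<sigma>k by auto
    moreover have "\<sigma> k = x \<longleftrightarrow> k = inv \<sigma> x" for x
      using permutes_inverses[OF \<sigma>p] by metis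
    moreover have "k - 1 = p' \<longleftrightarrow> k = inv \<sigma> (p + 1)" "k - 1 = q' \<longleftrightarrow> k = inv \<sigma> (q + 1)"
      using k in1 by (auto simp: p'_def q'_def)
    ultimately have e: "\<sigma> k - 1 = p \<longleftrightarrow> k - 1 = p'" "\<sigma> k - 1 = q \<longleftrightarrow> k - 1 = q'" by simp_all
    have l: "\<sigma> k - 1 < m" "k - 1 < m" using k \<sigma>k by auto
    have "relist m \<sigma> (is[p := a, q := a]) ! (k - 1) = is[p := a, q := a] ! (\<sigma> k - 1)" by (rule nth_relist[OF k])
    also have "\<dots> = (if \<sigma> k - 1 = p \<or> \<sigma> k - 1 = q then a else is ! (\<sigma> k - 1))"
      using l that pq by (auto simp: nth_list_update)
    also have "\<dots> = (if k - 1 = p' \<or> k - 1 = q' then a else relist m \<sigma> is ! (k - 1))"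
      by (simp only: e nth_relist[OF k])
    also have "\<dots> = (relist m \<sigma> is)[p' := a, q' := a] ! (k - 1)"
      using l pq' by (auto simp: nth_list_update)
    finally show "relist m \<sigma> (is[p := a, q := a]) ! (k - 1) = (relist m \<sigma> is)[p' := a, q' := a] ! (k - 1)" .
  qed simp_all
  show "bar_op m p q (perm_op m \<sigma> u) = 0"
  proof
    fix "is"
    have "(\<Sum>a\<in>UNIV. u ((relist m \<sigma> is)[p' := a, q' := a])) = 0"
      by (rule bar_op_eq_0D[OF traceless_bar_op[OF u pq'] pq']) (simp add: idx_def)
    then show "bar_op m p q (perm_op m \<sigma> u) is = 0 is"
      by (cases "length is = m") (simp_all add: bar_op_def perm_op_def eq)
  qed
qed

lemma cinner_perm_op:
  fixes t s :: "'N::finite tensor"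
  assumes "\<sigma> \<in> symmetric_group m"
  shows "cinner (idx m) (perm_op m \<sigma> t) s = cinner (idx m) t (perm_op m (inv \<sigma>) s)"
proof -
  have \<sigma>: "\<sigma> permutes {1..m}" using assms by (simp add: symmetric_group_def)
  have "cinner (idx m) (perm_op m \<sigma> t) s =
      (\<Sum>is\<in>idx m. t (relist m \<sigma> is) * cnj (s (relist m (inv \<sigma>) (relist m \<sigma> is))))"
    unfolding cinner_def by (intro sum.cong refl) (simp add: perm_op_def idx_def relist_inv[OF \<sigma>])
  also have "\<dots> = (\<Sum>is\<in>idx m. t is * cnj (s (relist m (inv \<sigma>) is)))"
    by (rule sum_relist[OF \<sigma>, of "\<lambda>is. t is * cnj (s (relist m (inv \<sigma>) is))"])
  also have "\<dots> = cinner (idx m) t (perm_op m (inv \<sigma>) s)"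
    unfolding cinner_def by (intro sum.cong refl) (simp add: perm_op_def idx_def)
  finally show ?thesis .
qed

text \<open>Moved to the other side of the form, \<open>g\<close> becomes its adjoint, which
  preserves \<open>S\<close>; so \<open>g\<close> keeps the residual orthogonal to
  \<open>S\<close>.\<close>

lemma equivariant_oproj:
  fixes S :: "'N::finite tensor set"
  assumes S: "complex_vector.subspace S" "S \<subseteq> tensors n"
    and stable: "\<And>g t. g \<in> orthogonal_group \<Longrightarrow> t \<in> S \<Longrightarrow> tensor_act g t \<in> S"
  shows "equivariant n n (oproj (idx n) S)"
proof -
  note P = finite_idx S(1) S(2)[unfolded tensors_eq]
  have "oproj (idx n) S (tensor_act g t) = tensor_act g (oproj (idx n) S t)"
    if g: "g \<in> orthogonal_group" and t: "t \<in> tensors n" for g t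
  proof (rule oproj_eqI[OF P])
    show "tensor_act g t \<in> supp_on (idx n)" using tensor_act_in[OF t] by (simp add: tensors_eq)
    show "tensor_act g (oproj (idx n) S t) \<in> S" by (intro stable g oproj_in P)
    fix b assume "b \<in> S"
    then have "tensor_act (adjoint_matrix g) b \<in> S" by (intro stable adjoint_matrix_orthogonal g)
    then have "cinner (idx n) (t - oproj (idx n) S t) (tensor_act (adjoint_matrix g) b) = 0"
      using t by (intro oproj_orthogonal[OF P]) (simp_all add: tensors_eq)
    then show "cinner (idx n) (tensor_act g t - tensor_act g (oproj (idx n) S t)) b = 0"
      by (simp add: cinner_diff_left cinner_tensor_act)
  qed
  then show ?thesis
    using linear_on_oproj[OF P] oproj_in[OF P] S(2) by (auto simp: equivariant_def tensors_eq)
qed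

subsection \<open>Weyl modules\<close>

lemma weyl_module_eq:
  "weyl_module D = {h. linear_on (specht D) h \<and> h ` specht D \<subseteq> traceless (card D) \<and>
    (\<forall>s\<in>symmetric_group (card D). \<forall>w\<in>specht D. h (specht_act s w) = perm_op (card D) s (h w)) \<and>
    (\<forall>w. w \<notin> specht D \<longrightarrow> h w = 0)}"
  unfolding weyl_module_def Hom_def symmetric_group_def by (simp add: brauer_op_perm_eq cong: conj_cong)

lemma weyl_moduleI:
  assumes "\<And>w w'. w \<in> specht D \<Longrightarrow> w' \<in> specht D \<Longrightarrow> h (w + w') = h w + h w'"
    and "\<And>c w. w \<in> specht D \<Longrightarrow> h (c *\<^sub>C w) = c *\<^sub>C h w"
    and "\<And>w. w \<in> specht D \<Longrightarrow> h w \<in> traceless (card D)"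
    and "\<And>s w. s \<in> symmetric_group (card D) \<Longrightarrow> w \<in> specht D \<Longrightarrow> h (specht_act s w) = perm_op (card D) s (h w)"
    and "\<And>w. w \<notin> specht D \<Longrightarrow> h w = 0"
  shows "h \<in> weyl_module D"
  using assms unfolding weyl_module_eq linear_on_def by blast

lemma weyl_moduleD:
  assumes "h \<in> weyl_module D"
  shows "linear_on (specht D) h"
    and "\<And>w. w \<in> specht D \<Longrightarrow> h w \<in> traceless (card D)"
    and "\<And>s w. s \<in> symmetric_group (card D) \<Longrightarrow> w \<in> specht D \<Longrightarrow> h (specht_act s w) = perm_op (card D) s (h w)"
    and "\<And>w. w \<notin> specht D \<Longrightarrow> h w = 0"
  using assms unfolding weyl_module_eq by blast+

lemma subspace_specht: "complex_vector.subspace (specht D)"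
  unfolding specht_eq by (rule complex_vector.subspace_span)

lemma linear_onD:
  assumes "linear_on V f"
  shows "x \<in> V \<Longrightarrow> y \<in> V \<Longrightarrow> f (x + y) = f x + f y" and "x \<in> V \<Longrightarrow> f (c *\<^sub>C x) = c *\<^sub>C f x"
  using assms by (simp_all add: linear_on_def)

lemma subspace_weyl_module: "complex_vector.subspace (weyl_module D :: 'N::finite weyl set)"
  unfolding complex_vector.subspace_def
proof (intro conjI ballI allI)
  note T = complex_vector.subspace_0[OF subspace_traceless] complex_vector.subspace_add[OF subspace_traceless]
    complex_vector.subspace_scale[OF subspace_traceless]
  show "0 \<in> (weyl_module D :: 'N weyl set)"
    by (rule weyl_moduleI) (simp_all add: zero_fun_apply T(1) perm_op_0 del: zero_fun_def)
  fix h h' :: "'N weyl" assume h: "h \<in> weyl_module D" "h' \<in> weyl_module D"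
  note H = weyl_moduleD[OF h(1)] and H' = weyl_moduleD[OF h(2)]
  show "h + h' \<in> weyl_module D"
    by (rule weyl_moduleI)
      (simp_all add: plus_fun_apply[of h h'] linear_onD[OF H(1)] linear_onD[OF H'(1)] H H' T perm_op_add
        complex_vector.scale_right_distrib add_ac)
next
  fix c and h :: "'N weyl" assume h: "h \<in> weyl_module D"
  note H = weyl_moduleD[OF h]
  have s: "(c *\<^sub>C h) w = c *\<^sub>C h w" for w by (simp add: scaleC_fun_def)
  show "c *\<^sub>C h \<in> weyl_module D"
    by (rule weyl_moduleI)
      (simp_all add: s linear_onD[OF H(1)] H complex_vector.subspace_scale[OF subspace_traceless] perm_op_scaleC
        complex_vector.scale_right_distrib complex_vector.scale_left_commute)
qed

lemma weyl_act_in: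
  assumes "g \<in> orthogonal_group" "h \<in> weyl_module D"
  shows "weyl_act g h \<in> weyl_module D"
proof -
  note H = weyl_moduleD[OF assms(2)]
  have perm: "tensor_act g (perm_op (card D) s t) = perm_op (card D) s (tensor_act g t)"
    if "s \<in> symmetric_group (card D)" for s t
    using that tensor_act_perm_op by (simp add: symmetric_group_def)
  show ?thesis
    by (rule weyl_moduleI)
      (simp_all add: weyl_act_def linear_onD[OF H(1)] H tensor_act_add tensor_act_scaleC tensor_act_0
        tensor_act_traceless[OF assms(1)] perm)
qed

text \<open>The average over the symmetric group of the map \<open>w \<mapsto> w(r) u\<close>.\<close>

definition weyl_elem :: "diagram \<Rightarrow> (nat \<Rightarrow> nat) \<Rightarrow> 'N::finite tensor \<Rightarrow> 'N weyl"
  where "weyl_elem D r u = (\<lambda>w. if w \<in> specht D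
    then \<Sum>s\<in>symmetric_group (card D). w (r \<circ> inv s) *\<^sub>C perm_op (card D) s u else 0)"

lemma weyl_elem_in:
  assumes u: "u \<in> traceless (card D)"
  shows "weyl_elem D r u \<in> weyl_module D"
proof (rule weyl_moduleI)
  let ?m = "card D" let ?S = "symmetric_group (card D)"
  fix w assume w: "w \<in> specht D"
  show "weyl_elem D r u w \<in> traceless ?m"
    using w u unfolding weyl_elem_def
    by (auto intro!: complex_vector.subspace_sum[OF subspace_traceless]
        complex_vector.subspace_scale[OF subspace_traceless] perm_op_traceless)
  show "weyl_elem D r u (w + w') = weyl_elem D r u w + weyl_elem D r u w'" if "w' \<in> specht D" for w'
    using w that complex_vector.subspace_add[OF subspace_specht w that]
    by (simp add: weyl_elem_def complex_vector.scale_left_distrib sum.distrib)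
  show "weyl_elem D r u (c *\<^sub>C w) = c *\<^sub>C weyl_elem D r u w" for c
    using w complex_vector.subspace_scale[OF subspace_specht w]
    by (simp add: weyl_elem_def scaleC_apply complex_vector.scale_sum_right)
  show "weyl_elem D r u (specht_act s w) = perm_op ?m s (weyl_elem D r u w)" if s: "s \<in> ?S" for s
  proof -
    have "weyl_elem D r u (specht_act s w) = (\<Sum>q\<in>?S. w (r \<circ> inv q \<circ> s) *\<^sub>C perm_op ?m q u)"
      using specht_act_in[OF w s] by (simp add: weyl_elem_def specht_act_def)
    also have "\<dots> = (\<Sum>q\<in>?S. w (r \<circ> inv (s \<circ> q) \<circ> s) *\<^sub>C perm_op ?m (s \<circ> q) u)"
      by (rule sum_symmetric_group_left[OF s, of "\<lambda>q. w (r \<circ> inv q \<circ> s) *\<^sub>C perm_op ?m q u", symmetric])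
    also have "\<dots> = (\<Sum>q\<in>?S. w (r \<circ> inv q) *\<^sub>C perm_op ?m s (perm_op ?m q u))"
    proof (rule sum.cong[OF refl])
      fix q assume q: "q \<in> ?S"
      have "inv (s \<circ> q) = inv q \<circ> inv s"
        using symmetric_group_inverses(6)[OF s] symmetric_group_inverses(6)[OF q] by (rule o_inv_distrib)
      then have "r \<circ> inv (s \<circ> q) \<circ> s = r \<circ> inv q"
        by (simp add: fun_eq_iff symmetric_group_inverses[OF s])
      moreover have "perm_op ?m (s \<circ> q) u = perm_op ?m s (perm_op ?m q u)"
        using perm_op_perm_op[of q ?m s u] q by (simp add: symmetric_group_def)
      ultimately show "w (r \<circ> inv (s \<circ> q) \<circ> s) *\<^sub>C perm_op ?m (s \<circ> q) u = w (r \<circ> inv q) *\<^sub>C perm_op ?m s (perm_op ?m q u)"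
        by simp
    qed
    also have "\<dots> = perm_op ?m s (weyl_elem D r u w)"
      using w by (simp add: weyl_elem_def perm_op_sum perm_op_scaleC)
    finally show ?thesis .
  qed
qed (simp add: weyl_elem_def)

lemma weyl_elem_add: "weyl_elem D r (u + u') = weyl_elem D r u + weyl_elem D r u'"
  and weyl_elem_scaleC: "weyl_elem D r (c *\<^sub>C u) = c *\<^sub>C weyl_elem D r u"
proof -
  show "weyl_elem D r (u + u') = weyl_elem D r u + weyl_elem D r u'"
  proof
    fix w show "weyl_elem D r (u + u') w = (weyl_elem D r u + weyl_elem D r u') w"
      by (simp add: weyl_elem_def plus_fun_apply[of "weyl_elem D r u"] perm_op_add
          complex_vector.scale_right_distrib sum.distrib)
  qed
  show "weyl_elem D r (c *\<^sub>C u) = c *\<^sub>C weyl_elem D r u"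
  proof
    fix w
    have "(c *\<^sub>C weyl_elem D r u) w = c *\<^sub>C weyl_elem D r u w" by (simp add: scaleC_fun_def)
    then show "weyl_elem D r (c *\<^sub>C u) w = (c *\<^sub>C weyl_elem D r u) w"
      by (simp add: weyl_elem_def perm_op_scaleC complex_vector.scale_sum_right mult.commute)
  qed
qed

lemma weyl_elem_sum: "weyl_elem D r (\<Sum>a\<in>A. u a) = (\<Sum>a\<in>A. weyl_elem D r (u a))"
proof
  fix w
  have "(\<Sum>a\<in>A. weyl_elem D r (u a)) w = (\<Sum>a\<in>A. weyl_elem D r (u a) w)"
    by (rule fun_sum_apply)
  also have "\<dots> = weyl_elem D r (\<Sum>a\<in>A. u a) w"
    unfolding weyl_elem_def perm_op_sum complex_vector.scale_sum_right
    by (cases "w \<in> specht D") (simp_all only: if_True if_False sum.neutral_const sum.swap[of _ A])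
  finally show "weyl_elem D r (\<Sum>a\<in>A. u a) w = (\<Sum>a\<in>A. weyl_elem D r (u a)) w" by (rule sym)
qed

lemma tensor_act_sum: "tensor_act g (\<Sum>a\<in>A. t a) = (\<Sum>a\<in>A. tensor_act g (t a))"
  by (rule ext) (simp add: tensor_act_eq sum_distrib_left, rule sum.swap)

lemma weyl_elem_tensor_act:
  "weyl_elem D r (tensor_act g u) = weyl_act g (weyl_elem D r u)"
proof
  fix w
  have "perm_op (card D) s (tensor_act g u) = tensor_act g (perm_op (card D) s u)" if "s \<in> symmetric_group (card D)" for s
    using that unfolding symmetric_group_def by (simp only: mem_Collect_eq tensor_act_perm_op)
  then show "weyl_elem D r (tensor_act g u) w = weyl_act g (weyl_elem D r u) w"
    by (simp add: weyl_elem_def weyl_act_def tensor_act_0 tensor_act_sum tensor_act_scaleC)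
qed

text \<open>The substitution of \<open>s \<circ> \<rho>\<close> for \<open>s\<close> leaves the
  coefficients unchanged when \<open>\<rho>\<close> fixes \<open>r\<close>. Thus only the row
  symmetrization of \<open>u\<close> matters, one half of a Young symmetrizer.\<close>

lemma weyl_elem_perm_op:
  assumes \<rho>: "\<rho> \<in> symmetric_group (card D)" and r: "r \<circ> \<rho> = r"
  shows "weyl_elem D r (perm_op (card D) \<rho> u) = weyl_elem D r u"
proof
  fix w
  let ?m = "card D" let ?S = "symmetric_group (card D)"
  have "(\<Sum>s\<in>?S. w (r \<circ> inv s) *\<^sub>C perm_op ?m s u) = (\<Sum>s\<in>?S. w (r \<circ> inv (s \<circ> \<rho>)) *\<^sub>C perm_op ?m (s \<circ> \<rho>) u)"
    by (rule sum_symmetric_group_right[OF \<rho>, of "\<lambda>s. w (r \<circ> inv s) *\<^sub>C perm_op ?m s u", symmetric])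
  also have "\<dots> = (\<Sum>s\<in>?S. w (r \<circ> inv s) *\<^sub>C perm_op ?m s (perm_op ?m \<rho> u))"
  proof (rule sum.cong[OF refl])
    fix s assume s: "s \<in> ?S"
    have "inv (s \<circ> \<rho>) = inv \<rho> \<circ> inv s"
      using symmetric_group_inverses(6)[OF s] symmetric_group_inverses(6)[OF \<rho>] by (rule o_inv_distrib)
    moreover have "r \<circ> inv \<rho> = r"
    proof -
      have "r \<circ> inv \<rho> = (r \<circ> \<rho>) \<circ> inv \<rho>" by (simp only: r)
      then show ?thesis by (simp add: fun_eq_iff symmetric_group_inverses[OF \<rho>])
    qed
    ultimately have "r \<circ> inv (s \<circ> \<rho>) = r \<circ> inv s" by (simp add: o_assoc)
    moreover have "perm_op ?m (s \<circ> \<rho>) u = perm_op ?m s (perm_op ?m \<rho> u)"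
      using perm_op_perm_op[of \<rho> ?m s u] \<rho> by (simp add: symmetric_group_def)
    ultimately show "w (r \<circ> inv (s \<circ> \<rho>)) *\<^sub>C perm_op ?m (s \<circ> \<rho>) u = w (r \<circ> inv s) *\<^sub>C perm_op ?m s (perm_op ?m \<rho> u)"
      by simp
  qed
  finally show "weyl_elem D r (perm_op ?m \<rho> u) w = weyl_elem D r u w"
    by (simp add: weyl_elem_def)
qed

text \<open>This converts a homomorphism on the Weyl module into an equivariant map of whole tensor
  powers, to which \<open>equivariant_form\<close> applies. The projection comes first because
  \<open>weyl_elem\<close> yields elements of the module for traceless tensors.\<close>

lemma equivariant_weyl:
  fixes f :: "'N::finite weyl \<Rightarrow> 'N tensor"
  assumes f: "f \<in> Hom orthogonal_group weyl_act (weyl_module D) tensor_act (tensors l)"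
  shows "equivariant (card D) l (\<lambda>t. f (weyl_elem D r (oproj (idx (card D)) (traceless (card D)) t)))"
proof -
  let ?m = "card D"
  let ?P = "oproj (idx ?m) (traceless ?m :: 'N tensor set)"
  have P: "equivariant ?m ?m ?P"
    by (rule equivariant_oproj[OF subspace_traceless traceless_subset tensor_act_traceless])
  have in_t: "?P t \<in> traceless ?m" for t
    by (rule oproj_in[OF finite_idx subspace_traceless traceless_subset[unfolded tensors_eq]])
  note W = weyl_elem_in[OF in_t]
  have lin: "linear_on (weyl_module D) f" and into: "f ` weyl_module D \<subseteq> tensors l"
    and eqv: "\<And>g h. g \<in> orthogonal_group \<Longrightarrow> h \<in> weyl_module D \<Longrightarrow> f (weyl_act g h) = tensor_act g (f h)"
    using f by (auto simp: Hom_def)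
  have Plin: "linear_on (tensors ?m) ?P" using P by (simp add: equivariant_def)
  show ?thesis
    unfolding equivariant_def
  proof (intro conjI ballI)
    show "linear_on (tensors ?m) (\<lambda>t. f (weyl_elem D r (?P t)))"
      by (simp add: linear_on_def linear_onD[OF Plin] weyl_elem_add weyl_elem_scaleC linear_onD[OF lin] W)
    show "(\<lambda>t. f (weyl_elem D r (?P t))) ` tensors ?m \<subseteq> tensors l" using into W by blast
    fix g :: "complex^'N^'N" and t :: "'N tensor" assume g: "g \<in> orthogonal_group" and t: "t \<in> tensors ?m"
    then have "?P (tensor_act g t) = tensor_act g (?P t)" using P by (simp add: equivariant_def)
    then show "f (weyl_elem D r (?P (tensor_act g t))) = tensor_act g (f (weyl_elem D r (?P t)))"
      by (simp add: weyl_elem_tensor_act eqv[OF g W])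
  qed
qed

text \<open>
  A basis \<open>B\<close> of the Specht module consisting of polytabloids expands every vector as
  \<open>w = \<Sum>b. \<psi>\<^sub>b w b\<close> with \<open>\<psi>\<^sub>b\<close> a combination of evaluations at tabloids; averaging \<open>h w = s (h (s\<^sup>-\<^sup>1 w))\<close> over
  all permutations \<open>s\<close> then exhibits \<open>h\<close> as a combination of the elements \<open>weyl_elem D r (h b)\<close>.
\<close>

lemma Hom_weyl_span:
  fixes f :: "'N::finite weyl \<Rightarrow> 'N tensor"
  assumes D: "finite D" and lin: "linear_on (weyl_module D) f" and h: "h \<in> weyl_module D"
  shows "f h \<in> complex_vector.span
    {f (weyl_elem D r (h (polytabloid (card D) t))) |r t. r \<in> tabloids D \<and> t \<in> tableaux D}"
proof -
  let ?m = "card D" let ?S = "symmetric_group (card D)"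
  let ?P = "polytabloid ?m ` tableaux D"
  note H = weyl_moduleD[OF h]
  obtain B where B: "B \<subseteq> ?P" "complex_vector.independent B" "?P \<subseteq> complex_vector.span B"
    by (rule complex_vector.maximal_independent_subset[of ?P])
  have spanB: "complex_vector.span B = specht D"
    unfolding specht_eq using B(1,3)
    by (intro equalityI complex_vector.span_mono complex_vector.span_minimal complex_vector.subspace_span)
  have Bsub: "B \<subseteq> specht D" using spanB complex_vector.span_superset[of B] by simp
  have "B \<subseteq> complex_vector.span ((\<lambda>i j. of_bool (j = i)) ` tabloids D)"
    by (rule order_trans[OF order_trans[OF Bsub specht_subset] supp_on_finite_span[OF finite_tabloids[OF D]]])
  then have finB: "finite B"
    using complex_vector.independent_span_bound[OF finite_imageI[OF finite_tabloids[OF D]] B(2)] by simp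
  \<comment> \<open>The coordinate functionals of \<open>B\<close> are also evaluated at the
    indicator functions of tabloids, which may lie outside the Specht module; hence the extension to
    a basis of the whole function space.\<close>
  define E where "E = complex_vector.extend_basis B"
  have E: "complex_vector.independent E" "complex_vector.span E = UNIV" "B \<subseteq> E"
    unfolding E_def using complex_vector.independent_extend_basis[OF B(2)]
      complex_vector.span_extend_basis[OF B(2)] complex_vector.extend_basis_superset[OF B(2)] by simp_all
  define \<psi> where "\<psi> b w = complex_vector.representation E w b" for b w
  define \<delta> :: "(nat \<Rightarrow> nat) \<Rightarrow> (nat \<Rightarrow> nat) \<Rightarrow> complex" where "\<delta> r = (\<lambda>r'. of_bool (r' = r))" for r
  have expand: "(\<Sum>b\<in>B. \<psi> b w *\<^sub>C b) = w" if w: "w \<in> specht D" for w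
  proof -
    have "w \<in> complex_vector.span B" using w spanB by simp
    then have "complex_vector.representation B w = complex_vector.representation E w"
      by (rule complex_vector.representation_extend[OF E(1) _ E(3), symmetric])
    then show ?thesis
      unfolding \<psi>_def using complex_vector.sum_representation_eq[OF B(2) \<open>w \<in> complex_vector.span B\<close> finB order_refl]
      by simp
  qed
  have \<psi>_eval: "\<psi> b w = (\<Sum>r\<in>tabloids D. w r * \<psi> b (\<delta> r))" if w: "w \<in> specht D" for b w
  proof -
    have e: "w = (\<Sum>r\<in>tabloids D. w r *\<^sub>C \<delta> r)"
    proof
      fix r'
      have "(\<Sum>r\<in>tabloids D. w r *\<^sub>C \<delta> r) r' = (\<Sum>r\<in>tabloids D. w r * \<delta> r r')" by (simp add: scaleC_apply)
      also have "\<dots> = (\<Sum>r\<in>tabloids D. if r = r' then w r else 0)"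
        by (intro sum.cong refl) (simp add: \<delta>_def)
      also have "\<dots> = (if r' \<in> tabloids D then w r' else 0)" using finite_tabloids[OF D] by simp
      also have "\<dots> = w r'" using subsetD[OF specht_subset w] by (simp add: supp_on_def)
      finally show "w r' = (\<Sum>r\<in>tabloids D. w r *\<^sub>C \<delta> r) r'" by simp
    qed
    have "\<psi> b (\<Sum>r\<in>tabloids D. w r *\<^sub>C \<delta> r) = (\<Sum>r\<in>tabloids D. w r * \<psi> b (\<delta> r))"
      unfolding \<psi>_def using E(1,2)
      by (subst complex_vector.representation_sum) (simp_all add: complex_vector.representation_scale)
    then show ?thesis using e by simp
  qed
  define X where "X = (\<Sum>b\<in>B. \<Sum>r\<in>tabloids D. \<psi> b (\<delta> r) *\<^sub>C weyl_elem D r (h b))"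
  have Bt: "h b \<in> traceless ?m" if "b \<in> B" for b using H(2) Bsub that by blast
  have Xin: "X \<in> weyl_module D"
    unfolding X_def
    by (intro complex_vector.subspace_sum[OF subspace_weyl_module] complex_vector.subspace_scale[OF subspace_weyl_module]
        weyl_elem_in Bt)
  have "X = of_nat (card ?S) *\<^sub>C h"
  proof
    fix w
    have rhs: "(of_nat (card ?S) *\<^sub>C h) w = of_nat (card ?S) *\<^sub>C h w" by (simp add: scaleC_fun_def)
    show "X w = (of_nat (card ?S) *\<^sub>C h) w"
    proof (cases "w \<in> specht D")
      case w: True
      have sw: "specht_act (inv s) w \<in> specht D" if "s \<in> ?S" for s
        by (rule specht_act_in[OF w symmetric_group_inv[OF that]])
      have "X w = (\<Sum>b\<in>B. \<Sum>r\<in>tabloids D. \<psi> b (\<delta> r) *\<^sub>C (\<Sum>s\<in>?S. w (r \<circ> inv s) *\<^sub>C perm_op ?m s (h b)))"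
      proof -
        have "(c *\<^sub>C weyl_elem D r u) w = c *\<^sub>C weyl_elem D r u w" for c r and u :: "'N tensor"
          by (simp add: scaleC_fun_def)
        then have "X w = (\<Sum>b\<in>B. \<Sum>r\<in>tabloids D. \<psi> b (\<delta> r) *\<^sub>C weyl_elem D r (h b) w)"
          unfolding X_def by (simp only: fun_sum_apply)
        then show ?thesis using w by (simp only: weyl_elem_def if_True)
      qed
      also have "\<dots> = (\<Sum>b\<in>B. \<Sum>r\<in>tabloids D. \<Sum>s\<in>?S. (w (r \<circ> inv s) * \<psi> b (\<delta> r)) *\<^sub>C perm_op ?m s (h b))"
        by (simp add: complex_vector.scale_sum_right mult.commute)
      also have "\<dots> = (\<Sum>b\<in>B. \<Sum>s\<in>?S. \<Sum>r\<in>tabloids D. (w (r \<circ> inv s) * \<psi> b (\<delta> r)) *\<^sub>C perm_op ?m s (h b))"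
        by (intro sum.cong refl sum.swap)
      also have "\<dots> = (\<Sum>s\<in>?S. \<Sum>b\<in>B. \<Sum>r\<in>tabloids D. (w (r \<circ> inv s) * \<psi> b (\<delta> r)) *\<^sub>C perm_op ?m s (h b))"
        by (rule sum.swap)
      also have "\<dots> = (\<Sum>s\<in>?S. h w)"
      proof (rule sum.cong[OF refl])
        fix s assume s: "s \<in> ?S"
        have "(\<Sum>r\<in>tabloids D. (w (r \<circ> inv s) * \<psi> b (\<delta> r)) *\<^sub>C perm_op ?m s (h b)) =
            perm_op ?m s (h (\<psi> b (specht_act (inv s) w) *\<^sub>C b))" if b: "b \<in> B" for b
        proof -
          have "b \<in> specht D" using b Bsub by blast
          then have "h (\<psi> b (specht_act (inv s) w) *\<^sub>C b) = \<psi> b (specht_act (inv s) w) *\<^sub>C h b"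
            by (rule linear_onD[OF H(1)])
          then show ?thesis
            unfolding \<psi>_eval[OF sw[OF s]]
            by (simp add: specht_act_def perm_op_scaleC flip: complex_vector.scale_sum_left)
        qed
        then have "(\<Sum>b\<in>B. \<Sum>r\<in>tabloids D. (w (r \<circ> inv s) * \<psi> b (\<delta> r)) *\<^sub>C perm_op ?m s (h b)) =
            perm_op ?m s (\<Sum>b\<in>B. h (\<psi> b (specht_act (inv s) w) *\<^sub>C b))"
          by (simp add: perm_op_sum)
        also have "(\<Sum>b\<in>B. h (\<psi> b (specht_act (inv s) w) *\<^sub>C b)) = h (\<Sum>b\<in>B. \<psi> b (specht_act (inv s) w) *\<^sub>C b)"
          using Bsub by (intro linear_on_sum[OF H(1) subspace_specht, symmetric]
              complex_vector.subspace_scale[OF subspace_specht]) blast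
        also have "\<dots> = h (specht_act (inv s) w)" by (simp only: expand[OF sw[OF s]])
        also have "perm_op ?m s \<dots> = h (specht_act s (specht_act (inv s) w))"
          by (rule H(3)[OF s sw[OF s], symmetric])
        also have "specht_act s (specht_act (inv s) w) = w"
          by (simp add: specht_act_def fun_eq_iff o_assoc[symmetric] symmetric_group_inverses[OF s])
        finally show "(\<Sum>b\<in>B. \<Sum>r\<in>tabloids D. (w (r \<circ> inv s) * \<psi> b (\<delta> r)) *\<^sub>C perm_op ?m s (h b)) = h w" .
      qed
      also have "\<dots> = of_nat (card ?S) *\<^sub>C h w"
        by (simp add: fun_eq_iff scaleC_apply)
      finally show ?thesis unfolding rhs .
    next
      case False
      then show ?thesis unfolding rhs using H(4) weyl_moduleD(4)[OF Xin] by simp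
    qed
  qed
  moreover have "card ?S \<noteq> 0"
  proof -
    have "id \<in> ?S" by (simp add: symmetric_group_def permutes_id)
    then show ?thesis by (auto simp: card_eq_0_iff)
  qed
  ultimately have hX: "h = (1 / of_nat (card ?S)) *\<^sub>C X" by simp
  have "f h = (1 / of_nat (card ?S)) *\<^sub>C f X"
    by (subst hX) (rule linear_onD[OF lin Xin])
  also have "f X = (\<Sum>b\<in>B. \<Sum>r\<in>tabloids D. \<psi> b (\<delta> r) *\<^sub>C f (weyl_elem D r (h b)))"
  proof -
    note sub = complex_vector.subspace_sum[OF subspace_weyl_module] complex_vector.subspace_scale[OF subspace_weyl_module]
      weyl_elem_in[OF Bt]
    have "f X = (\<Sum>b\<in>B. f (\<Sum>r\<in>tabloids D. \<psi> b (\<delta> r) *\<^sub>C weyl_elem D r (h b)))"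
      unfolding X_def by (intro linear_on_sum[OF lin subspace_weyl_module] sub)
    also have "\<dots> = (\<Sum>b\<in>B. \<Sum>r\<in>tabloids D. f (\<psi> b (\<delta> r) *\<^sub>C weyl_elem D r (h b)))"
      by (intro sum.cong refl linear_on_sum[OF lin subspace_weyl_module] sub)
    also have "\<dots> = (\<Sum>b\<in>B. \<Sum>r\<in>tabloids D. \<psi> b (\<delta> r) *\<^sub>C f (weyl_elem D r (h b)))"
      by (intro sum.cong refl linear_onD[OF lin] sub)
    finally show ?thesis .
  qed
  finally have fh: "f h = (1 / of_nat (card ?S)) *\<^sub>C (\<Sum>b\<in>B. \<Sum>r\<in>tabloids D. \<psi> b (\<delta> r) *\<^sub>C f (weyl_elem D r (h b)))" .
  have "f (weyl_elem D r (h b)) \<in> {f (weyl_elem D r (h (polytabloid ?m t))) |r t. r \<in> tabloids D \<and> t \<in> tableaux D}"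
    if "b \<in> B" "r \<in> tabloids D" for b r
    using that B(1) by blast
  then show ?thesis
    unfolding fh by (intro complex_vector.span_scale complex_vector.span_sum complex_vector.span_base)
qed

text \<open>On generators the form is a combination of permutation forms between a row-symmetric and
  a column-antisymmetric tensor. Unless \<open>D'\<close> dominates \<open>D\<close>, for every
  permutation two entries share a column on the second side and a row on the first. Their
  transposition fixes one argument and negates the other, so each permutation form is 0.\<close>

lemma weyl_orthogonal_aux:
  fixes f f' :: "'N::finite weyl \<Rightarrow> 'N tensor"
  assumes D: "young_diagram D" and D': "young_diagram D'"
    and nd: "card D = card D' \<Longrightarrow> \<not> dominates D' D"
    and f: "f \<in> Hom orthogonal_group weyl_act (weyl_module D) tensor_act (tensors l)"
    and f': "f' \<in> Hom orthogonal_group weyl_act (weyl_module D') tensor_act (tensors l)"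
    and h: "h \<in> weyl_module D" and h': "h' \<in> weyl_module D'"
  shows "cinner (idx l) (f h) (f' h') = 0"
proof -
  let ?m = "card D" and ?m' = "card D'"
  have fin: "finite D" "finite D'" using D D' by (simp_all add: young_diagram_def)
  have lin: "linear_on (weyl_module D) f" "linear_on (weyl_module D') f'"
    using f f' by (simp_all add: Hom_def)
  have key: "cinner (idx l) (f (weyl_elem D r u)) (f' (weyl_elem D' r' (h' (polytabloid ?m' t')))) = 0"
    if r: "r \<in> tabloids D" and r': "r' \<in> tabloids D'" and t': "t' \<in> tableaux D'" and u: "u \<in> traceless ?m" for r r' t' u
  proof -
    let ?L = "\<lambda>t. f (weyl_elem D r (oproj (idx ?m) (traceless ?m) t))"
    let ?L' = "\<lambda>t. f' (weyl_elem D' r' (oproj (idx ?m') (traceless ?m') t))"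
    let ?u' = "h' (polytabloid ?m' t')"
    obtain c where c: "\<And>u u'. u \<in> traceless ?m \<Longrightarrow> u' \<in> traceless ?m' \<Longrightarrow>
        cinner (idx l) (?L u) (?L' u') = (\<Sum>\<sigma>\<in>symmetric_group ?m. c \<sigma> * perm_form ?m ?m' u u' \<sigma>)"
      using equivariant_form[OF equivariant_weyl[OF f] equivariant_weyl[OF f']] by blast
    have proj: "oproj (idx k) (traceless k) v = v" if "v \<in> traceless k" for k and v :: "'N tensor"
      by (rule oproj_id[OF finite_idx subspace_traceless traceless_subset[unfolded tensors_eq] that])
    have pt: "polytabloid ?m' t' \<in> specht D'"
      unfolding specht_eq using t' by (intro complex_vector.span_base imageI)
    have u': "?u' \<in> traceless ?m'" by (rule weyl_moduleD(2)[OF h' pt])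
    show ?thesis
    proof (cases "?m = ?m'")
      case False
      then show ?thesis using c[OF u u'] u u' by (simp add: perm_form_def proj)
    next
      case mm: True
      \<comment> \<open>The row group of the tabloid \<open>r\<close>. Summing over it replaces
        \<open>u\<close> by the invariant tensor \<open>v\<close>, and this multiplies the value of
        the first map only by the order of the group.\<close>
      define R where "R = {\<rho> \<in> symmetric_group ?m. r \<circ> \<rho> = r}"
      have finR: "finite R" by (simp add: R_def)
      have Rid: "id \<in> R" by (simp add: R_def symmetric_group_def permutes_id)
      define v where "v = (\<Sum>\<rho>\<in>R. perm_op ?m \<rho> u)"
      have v: "v \<in> traceless ?m"
        unfolding v_def using u by (intro complex_vector.subspace_sum[OF subspace_traceless] perm_op_traceless) (auto simp: R_def)
      have inv_v: "perm_op ?m \<rho> v = v" if \<rho>: "\<rho> \<in> R" for \<rho>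
      proof -
        have \<rho>s: "\<rho> \<in> symmetric_group ?m" "r \<circ> \<rho> = r" using \<rho> by (simp_all add: R_def)
        note I = symmetric_group_inverses[OF \<rho>s(1)]
        have ri: "r \<circ> inv \<rho> = r"
        proof -
          have "r \<circ> inv \<rho> = (r \<circ> \<rho>) \<circ> inv \<rho>" by (simp only: \<rho>s(2))
          then show ?thesis by (simp add: fun_eq_iff I)
        qed
        have "perm_op ?m \<rho> v = (\<Sum>q\<in>R. perm_op ?m (\<rho> \<circ> q) u)"
          unfolding v_def perm_op_sum
          by (rule sum.cong[OF refl], rule perm_op_perm_op) (simp add: R_def symmetric_group_def)
        also have "\<dots> = v"
          unfolding v_def
          by (rule sum.reindex_bij_witness[where i = "\<lambda>q. inv \<rho> \<circ> q" and j = "\<lambda>q. \<rho> \<circ> q"])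
            (simp_all add: R_def symmetric_group_comp symmetric_group_inv \<rho>s(1) o_assoc I \<rho>s(2) ri)
        finally show ?thesis .
      qed
      have Lv: "?L v = of_nat (card R) *\<^sub>C ?L u"
      proof -
        have "weyl_elem D r v = (\<Sum>\<rho>\<in>R. weyl_elem D r (perm_op ?m \<rho> u))"
          unfolding v_def by (rule weyl_elem_sum)
        also have "\<dots> = (\<Sum>\<rho>\<in>R. weyl_elem D r u)"
          by (intro sum.cong refl weyl_elem_perm_op) (simp_all add: R_def)
        finally have "f (weyl_elem D r v) = f (\<Sum>\<rho>\<in>R. weyl_elem D r u)" by (rule arg_cong)
        also have "\<dots> = (\<Sum>\<rho>\<in>R. f (weyl_elem D r u))"
          by (rule linear_on_sum[OF lin(1) subspace_weyl_module]) (rule weyl_elem_in[OF u])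
        finally have "f (weyl_elem D r v) = (\<Sum>\<rho>\<in>R. f (weyl_elem D r u))" .
        then show ?thesis by (simp add: proj u v fun_eq_iff scaleC_apply)
      qed
      have zero: "perm_form ?m ?m' v ?u' \<sigma> = 0" if \<sigma>: "\<sigma> \<in> symmetric_group ?m" for \<sigma>
      proof -
        note S = symmetric_group_inverses[OF \<sigma>]
        obtain t where t: "t \<in> tableaux D" "r = tabloid ?m t" using r by (auto simp: tabloids_def)
        have t2: "bij_betw (t \<circ> inv \<sigma>) {1..?m} D"
          using tableaux_perm[OF t(1) symmetric_group_inv[OF \<sigma>]] by (simp add: tableaux_def)
        have t'b: "bij_betw t' {1..?m} D'" using t' mm by (simp add: tableaux_def)
        obtain a b where ab: "a \<in> {1..?m}" "b \<in> {1..?m}" "a \<noteq> b" "snd (t' a) = snd (t' b)"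
          "fst ((t \<circ> inv \<sigma>) a) = fst ((t \<circ> inv \<sigma>) b)"
          using dominatesI[OF D' D t'b t2] nd[OF mm] by blast
        let ?\<tau> = "Transposition.transpose a b"
        have \<tau>: "?\<tau> \<in> symmetric_group ?m" "inv ?\<tau> = ?\<tau>"
          using ab by (simp_all add: symmetric_group_def permutes_swap_id)
        \<comment> \<open>This exchanges \<open>inv \<sigma> a\<close> and
          \<open>inv \<sigma> b\<close>, which lie in one row of \<open>t\<close>; therefore it
          belongs to \<open>R\<close>, and \<open>?\<tau>\<close> fixes
          \<open>perm_op ?m \<sigma> v\<close>.\<close>
        define \<rho> where "\<rho> = inv \<sigma> \<circ> ?\<tau> \<circ> \<sigma>"
        have "r (inv \<sigma> a) = r (inv \<sigma> b)"
          using ab symmetric_group_in[OF symmetric_group_inv[OF \<sigma>]] unfolding t(2) tabloid_def by simp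
        then have "r (inv \<sigma> (?\<tau> x)) = r (inv \<sigma> x)" for x
          by (simp add: Transposition.transpose_def)
        then have "r \<circ> \<rho> = r" by (simp add: \<rho>_def fun_eq_iff S)
        moreover have "\<rho> \<in> symmetric_group ?m"
          unfolding \<rho>_def by (intro symmetric_group_comp symmetric_group_inv \<sigma> \<tau>)
        ultimately have \<rho>: "\<rho> \<in> R" by (simp add: R_def)
        have "\<sigma> \<circ> \<rho> = ?\<tau> \<circ> \<sigma>" by (simp add: \<rho>_def fun_eq_iff S)
        moreover have "perm_op ?m \<sigma> (perm_op ?m \<rho> v) = perm_op ?m (\<sigma> \<circ> \<rho>) v"
          using perm_op_perm_op[of \<rho> ?m \<sigma> v] \<rho> by (simp add: R_def symmetric_group_def)
        moreover have "perm_op ?m ?\<tau> (perm_op ?m \<sigma> v) = perm_op ?m (?\<tau> \<circ> \<sigma>) v"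
          using perm_op_perm_op[of \<sigma> ?m ?\<tau> v] \<sigma> by (simp add: symmetric_group_def)
        ultimately have sv: "perm_op ?m ?\<tau> (perm_op ?m \<sigma> v) = perm_op ?m \<sigma> v"
          using inv_v[OF \<rho>] by simp
        have "perm_op ?m ?\<tau> ?u' = h' (specht_act ?\<tau> (polytabloid ?m' t'))"
          using weyl_moduleD(3)[OF h' _ pt, of ?\<tau>] \<tau>(1) mm by simp
        also have "specht_act ?\<tau> (polytabloid ?m' t') = (-1) *\<^sub>C polytabloid ?m' t'"
          using ab mm by (intro specht_act_column_transposition) simp_all
        also have "h' \<dots> = (-1) *\<^sub>C ?u'" by (rule linear_onD[OF weyl_moduleD(1)[OF h'] pt])
        finally have tu: "perm_op ?m ?\<tau> ?u' = (-1) *\<^sub>C ?u'" .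
        have "cinner (idx ?m) (perm_op ?m \<sigma> v) ?u' = cinner (idx ?m) (perm_op ?m ?\<tau> (perm_op ?m \<sigma> v)) ?u'"
          by (simp only: sv)
        also have "\<dots> = cinner (idx ?m) (perm_op ?m \<sigma> v) ((-1) *\<^sub>C ?u')"
          unfolding cinner_perm_op[OF \<tau>(1)] \<tau>(2) tu by (rule refl)
        also have "\<dots> = - cinner (idx ?m) (perm_op ?m \<sigma> v) ?u'" by (simp only: cinner_scaleC_right) simp
        finally have "cinner (idx ?m) (perm_op ?m \<sigma> v) ?u' = 0" by simp
        then show ?thesis by (simp only: perm_form_def if_cancel)
      qed
      have "of_nat (card R) * cinner (idx l) (?L u) (?L' ?u') = cinner (idx l) (?L v) (?L' ?u')"
        unfolding Lv cinner_scaleC_left by (rule refl)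
      also have "\<dots> = 0" unfolding c[OF v u'] by (intro sum.neutral ballI) (simp add: zero)
      finally have "cinner (idx l) (?L u) (?L' ?u') = 0"
        using finR Rid by (auto simp: card_eq_0_iff)
      then show ?thesis by (simp add: proj u u')
    qed
  qed
  have pt: "polytabloid ?m t \<in> specht D" if "t \<in> tableaux D" for t
    unfolding specht_eq using that by (intro complex_vector.span_base imageI)
  show ?thesis
  proof (rule cinner_span_left[OF _ Hom_weyl_span[OF fin(1) lin(1) h]])
    fix x assume "x \<in> {f (weyl_elem D r (h (polytabloid ?m t))) |r t. r \<in> tabloids D \<and> t \<in> tableaux D}"
    then obtain r t where x: "x = f (weyl_elem D r (h (polytabloid ?m t)))" "r \<in> tabloids D" "t \<in> tableaux D" by blast
    show "cinner (idx l) x (f' h') = 0"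
    proof (rule cinner_span_right[OF _ Hom_weyl_span[OF fin(2) lin(2) h']])
      fix y assume "y \<in> {f' (weyl_elem D' r (h' (polytabloid ?m' t))) |r t. r \<in> tabloids D' \<and> t \<in> tableaux D'}"
      then obtain r' t' where y: "y = f' (weyl_elem D' r' (h' (polytabloid ?m' t')))" "r' \<in> tabloids D'" "t' \<in> tableaux D'"
        by blast
      show "cinner (idx l) x y = 0"
        unfolding x(1) y(1) by (rule key[OF x(2) y(2,3) weyl_moduleD(2)[OF h pt[OF x(3)]]])
    qed
  qed
qed

text \<open>Different diagrams cannot dominate each other in both directions, so the one-sided
  argument applies in one of the two orders.\<close>

proposition weyl_orthogonal:
  fixes f f' :: "'N::finite weyl \<Rightarrow> 'N tensor"
  assumes D: "young_diagram D" and D': "young_diagram D'" and ne: "D \<noteq> D'"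
    and f: "f \<in> Hom orthogonal_group weyl_act (weyl_module D) tensor_act (tensors l)"
    and f': "f' \<in> Hom orthogonal_group weyl_act (weyl_module D') tensor_act (tensors l)"
    and h: "h \<in> weyl_module D" and h': "h' \<in> weyl_module D'"
  shows "cinner (idx l) (f h) (f' h') = 0"
proof (cases "dominates D' D")
  case False
  then show ?thesis by (intro weyl_orthogonal_aux[OF D D' _ f f' h h'])
next
  case True
  then have "\<not> dominates D D'" using dominates_antisym[OF D D'] ne by blast
  then have "cinner (idx l) (f' h') (f h) = 0" by (intro weyl_orthogonal_aux[OF D' D _ f' f h' h])
  then show ?thesis by (subst cinner_commute) simp
qed

section \<open>Isotypic projections\<close>

text \<open>The isotypic component of U(E, N) in the tensor power of order \<open>l\<close>.\<close>

definition weyl_space :: "nat \<Rightarrow> diagram \<Rightarrow> 'N::finite tensor set"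
  where "weyl_space l E = complex_vector.span
    (\<Union>f\<in>Hom orthogonal_group weyl_act (weyl_module E) tensor_act (tensors l). f ` weyl_module E)"

text \<open>An operator that detects the type \<open>E\<close>. As an element of the centralizer
  algebra it is respected by every isomorphism of modules over that algebra.\<close>

definition iso_proj :: "nat \<Rightarrow> diagram \<Rightarrow> 'N::finite tensor \<Rightarrow> 'N tensor"
  where "iso_proj l E = oproj (idx l) (weyl_space l E)"

lemma subspace_weyl_space: "complex_vector.subspace (weyl_space l E)"
  unfolding weyl_space_def by (rule complex_vector.subspace_span)

lemma HomD:
  assumes "f \<in> Hom G \<rho> V \<sigma> W"
  shows "linear_on V f" and "x \<in> V \<Longrightarrow> f x \<in> W"
    and "g \<in> G \<Longrightarrow> x \<in> V \<Longrightarrow> f (\<rho> g x) = \<sigma> g (f x)" and "x \<notin> V \<Longrightarrow> f x = 0"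
proof -
  have *: "linear_on V f" "f ` V \<subseteq> W" "\<forall>g\<in>G. \<forall>x\<in>V. f (\<rho> g x) = \<sigma> g (f x)" "\<forall>x. x \<notin> V \<longrightarrow> f x = 0"
    using assms by (simp_all add: Hom_def)
  show "linear_on V f" by (fact *(1))
  show "x \<in> V \<Longrightarrow> f x \<in> W" by (rule subsetD[OF *(2) imageI])
  show "g \<in> G \<Longrightarrow> x \<in> V \<Longrightarrow> f (\<rho> g x) = \<sigma> g (f x)" by (rule bspec[OF bspec[OF *(3)]])
  show "x \<notin> V \<Longrightarrow> f x = 0" using *(4) by simp
qed

lemma weyl_spaceI:
  assumes "f \<in> Hom orthogonal_group weyl_act (weyl_module E) tensor_act (tensors l)" "h \<in> weyl_module E"
  shows "f h \<in> weyl_space l E"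
  unfolding weyl_space_def by (rule complex_vector.span_base[OF UN_I[OF assms(1) imageI[OF assms(2)]]])

lemma weyl_space_minimal:
  fixes S :: "'N::finite tensor set"
  assumes "\<And>f. f \<in> Hom orthogonal_group weyl_act (weyl_module E) tensor_act (tensors l) \<Longrightarrow> f ` weyl_module E \<subseteq> S"
    and "complex_vector.subspace S"
  shows "weyl_space l E \<subseteq> S"
  unfolding weyl_space_def
  by (rule complex_vector.span_minimal[OF _ assms(2)], rule UN_least, rule assms(1))

lemma weyl_space_subset: "weyl_space l E \<subseteq> tensors l"
proof (rule weyl_space_minimal[OF _ subspace_tensors])
  fix f :: "'a weyl \<Rightarrow> 'a tensor"
  assume f: "f \<in> Hom orthogonal_group weyl_act (weyl_module E) tensor_act (tensors l)"
  show "f ` weyl_module E \<subseteq> tensors l" by (rule image_subsetI) (rule HomD(2)[OF f])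
qed

lemma equivariantD:
  assumes "equivariant m l L"
  shows "linear_on (tensors m) L" and "t \<in> tensors m \<Longrightarrow> L t \<in> tensors l"
    and "g \<in> orthogonal_group \<Longrightarrow> t \<in> tensors m \<Longrightarrow> L (tensor_act g t) = tensor_act g (L t)"
    and "L 0 = 0"
proof -
  have *: "linear_on (tensors m) L" "L ` tensors m \<subseteq> tensors l"
    "\<forall>g\<in>orthogonal_group. \<forall>t\<in>tensors m. L (tensor_act g t) = tensor_act g (L t)"
    using assms by (simp_all add: equivariant_def)
  show "linear_on (tensors m) L" by (fact *(1))
  show "t \<in> tensors m \<Longrightarrow> L t \<in> tensors l" using *(2) by blast
  show "g \<in> orthogonal_group \<Longrightarrow> t \<in> tensors m \<Longrightarrow> L (tensor_act g t) = tensor_act g (L t)" using *(3) by blast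
  show "L 0 = 0" by (rule linear_on_0[OF *(1) subspace_tensors])
qed

lemma Hom_compose:
  assumes Q: "equivariant m l Q" and f: "f \<in> Hom G \<rho> V tensor_act (tensors m)" and G: "G \<subseteq> orthogonal_group"
  shows "Q \<circ> f \<in> Hom G \<rho> V tensor_act (tensors l)"
proof -
  note q = equivariantD[OF Q]
  note f = HomD[OF f]
  have "linear_on V (Q \<circ> f)"
    unfolding linear_on_def o_apply by (simp add: linear_onD[OF f(1)] linear_onD[OF q(1)] f(2))
  moreover have "Q (f (\<rho> g x)) = tensor_act g (Q (f x))" if "g \<in> G" "x \<in> V" for g x
  proof -
    have "g \<in> orthogonal_group" using that(1) G by blast
    then show ?thesis by (simp only: f(3)[OF that] q(3) f(2)[OF that(2)])
  qed
  ultimately show ?thesis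
    unfolding Hom_def by (intro CollectI conjI ballI allI impI image_subsetI) (simp_all add: f(2,4) q(2,4))
qed

text \<open>Composition with \<open>Q\<close> turns homomorphisms from the Weyl module into
  homomorphisms again. Since \<open>m\<close> and \<open>l\<close> may differ, types are preserved
  by contractions too.\<close>

lemma equivariant_weyl_space:
  fixes Q :: "'N::finite tensor \<Rightarrow> 'N tensor"
  assumes Q: "equivariant m l Q" and t: "t \<in> weyl_space m E"
  shows "Q t \<in> weyl_space l E"
proof -
  note q = equivariantD[OF Q]
  let ?S = "{t \<in> tensors m. Q t \<in> weyl_space l E}"
  note T = subspace_tensors[of m] and W = subspace_weyl_space[of l E]
  have sub: "complex_vector.subspace ?S"
    unfolding complex_vector.subspace_def
  proof (intro conjI ballI allI)
    show "0 \<in> ?S"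
      by (simp only: mem_Collect_eq q(4) complex_vector.subspace_0[OF T] complex_vector.subspace_0[OF W] simp_thms)
    fix x assume "x \<in> ?S"
    then have x: "x \<in> tensors m" "Q x \<in> weyl_space l E" by blast+
    show "x + y \<in> ?S" if "y \<in> ?S" for y
    proof -
      have y: "y \<in> tensors m" "Q y \<in> weyl_space l E" using that by blast+
      have "x + y \<in> tensors m" by (rule complex_vector.subspace_add[OF T x(1) y(1)])
      moreover have "Q (x + y) = Q x + Q y" by (rule linear_onD(1)[OF q(1) x(1) y(1)])
      moreover have "Q x + Q y \<in> weyl_space l E" by (rule complex_vector.subspace_add[OF W x(2) y(2)])
      ultimately show ?thesis by (simp only: mem_Collect_eq simp_thms)
    qed
    show "c *\<^sub>C x \<in> ?S" for c
    proof -
      have "c *\<^sub>C x \<in> tensors m" by (rule complex_vector.subspace_scale[OF T x(1)])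
      moreover have "Q (c *\<^sub>C x) = c *\<^sub>C Q x" by (rule linear_onD(2)[OF q(1) x(1)])
      moreover have "c *\<^sub>C Q x \<in> weyl_space l E" by (rule complex_vector.subspace_scale[OF W x(2)])
      ultimately show ?thesis by (simp only: mem_Collect_eq simp_thms)
    qed
  qed
  have "weyl_space m E \<subseteq> ?S"
  proof (rule weyl_space_minimal[OF _ sub])
    fix f :: "'N weyl \<Rightarrow> 'N tensor"
    assume f: "f \<in> Hom orthogonal_group weyl_act (weyl_module E) tensor_act (tensors m)"
    show "f ` weyl_module E \<subseteq> ?S"
    proof (rule image_subsetI)
      fix h :: "'N weyl" assume h: "h \<in> weyl_module E"
      have "f h \<in> tensors m" by (rule HomD(2)[OF f h])
      moreover have "Q (f h) \<in> weyl_space l E"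
        using weyl_spaceI[OF Hom_compose[OF Q f order_refl] h] by (simp only: o_apply)
      ultimately show "f h \<in> ?S" by (simp only: mem_Collect_eq simp_thms)
    qed
  qed
  from subsetD[OF this t] show ?thesis by (simp only: mem_Collect_eq)
qed

lemma tensor_act_weyl_space:
  fixes t :: "'N::finite tensor"
  assumes g: "g \<in> orthogonal_group" and t: "t \<in> weyl_space l E"
  shows "tensor_act g t \<in> weyl_space l E"
proof -
  let ?S = "{t. tensor_act g t \<in> weyl_space l E}"
  note W = subspace_weyl_space[of l E]
  have sub: "complex_vector.subspace ?S"
    unfolding complex_vector.subspace_def
  proof (intro conjI ballI allI)
    show "0 \<in> ?S" by (simp only: mem_Collect_eq tensor_act_0 complex_vector.subspace_0[OF W])
    fix x assume x: "x \<in> ?S"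
    show "x + y \<in> ?S" if "y \<in> ?S" for y
      using x that complex_vector.subspace_add[OF W, of "tensor_act g x" "tensor_act g y"]
      by (simp only: mem_Collect_eq tensor_act_add)
    show "c *\<^sub>C x \<in> ?S" for c
      using x complex_vector.subspace_scale[OF W, of "tensor_act g x" c]
      by (simp only: mem_Collect_eq tensor_act_scaleC)
  qed
  have "weyl_space l E \<subseteq> ?S"
  proof (rule weyl_space_minimal[OF _ sub])
    fix f :: "'N weyl \<Rightarrow> 'N tensor"
    assume f: "f \<in> Hom orthogonal_group weyl_act (weyl_module E) tensor_act (tensors l)"
    show "f ` weyl_module E \<subseteq> ?S"
    proof (rule image_subsetI)
      fix h :: "'N weyl" assume h: "h \<in> weyl_module E"
      have "tensor_act g (f h) = f (weyl_act g h)" by (rule HomD(3)[OF f g h, symmetric])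
      then show "f h \<in> ?S" using weyl_spaceI[OF f weyl_act_in[OF g h]] by (simp only: mem_Collect_eq)
    qed
  qed
  from subsetD[OF this t] show ?thesis by (simp only: mem_Collect_eq)
qed

lemmas iso_proj_facts = finite_idx subspace_weyl_space weyl_space_subset[unfolded tensors_eq]

lemma iso_proj_in: "iso_proj l E t \<in> weyl_space l E"
  unfolding iso_proj_def by (rule oproj_in[OF iso_proj_facts])

lemma iso_proj_id: "t \<in> weyl_space l E \<Longrightarrow> iso_proj l E t = t"
  unfolding iso_proj_def by (rule oproj_id[OF iso_proj_facts])

lemma equivariant_iso_proj: "equivariant l l (iso_proj l E)"
  unfolding iso_proj_def
  by (rule equivariant_oproj[OF subspace_weyl_space weyl_space_subset tensor_act_weyl_space])

lemma iso_proj_centralizer: "iso_proj l E \<in> centralizer_algebra l"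
proof -
  have "iso_proj l E t = 0" if "t \<notin> tensors l" for t
    using that by (simp add: iso_proj_def oproj_def tensors_eq)
  then show ?thesis
    using equivariant_iso_proj[of l E] unfolding centralizer_algebra_def Hom_def equivariant_def
    by (intro CollectI conjI allI impI) (elim conjE, assumption)+
qed

lemma iso_proj_other:
  assumes "young_diagram E" "young_diagram E'" "E \<noteq> E'" "t \<in> weyl_space l E"
  shows "iso_proj l E' t = 0"
  unfolding iso_proj_def
proof (rule oproj_eq_0[OF iso_proj_facts])
  show "t \<in> supp_on (idx l)" using assms(4) weyl_space_subset tensors_eq by blast
  fix b :: "'a tensor" assume b: "b \<in> weyl_space l E'"
  have sub1: "complex_vector.subspace {y. cinner (idx l) x y = 0}" for x :: "'a tensor"
    by (simp add: complex_vector.subspace_def cinner_zero_right cinner_add_right cinner_scaleC_right)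
  have sub2: "complex_vector.subspace {x. cinner (idx l) x y = 0}" for y :: "'a tensor"
    by (simp add: complex_vector.subspace_def cinner_zero_left cinner_add_left cinner_scaleC_left)
  have 1: "weyl_space l E' \<subseteq> {y. cinner (idx l) (f h) y = 0}"
    if f: "f \<in> Hom orthogonal_group weyl_act (weyl_module E) tensor_act (tensors l)" and h: "h \<in> weyl_module E"
    for f :: "'a weyl \<Rightarrow> 'a tensor" and h
  proof (rule weyl_space_minimal[OF _ sub1])
    fix f' :: "'a weyl \<Rightarrow> 'a tensor"
    assume f': "f' \<in> Hom orthogonal_group weyl_act (weyl_module E') tensor_act (tensors l)"
    show "f' ` weyl_module E' \<subseteq> {y. cinner (idx l) (f h) y = 0}"
    proof (rule image_subsetI, rule CollectI)
      fix h' :: "'a weyl" assume h': "h' \<in> weyl_module E'"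
      show "cinner (idx l) (f h) (f' h') = 0" by (rule weyl_orthogonal[OF assms(1-3) f f' h h'])
    qed
  qed
  have "weyl_space l E \<subseteq> {x. cinner (idx l) x b = 0}"
  proof (rule weyl_space_minimal[OF _ sub2])
    fix f :: "'a weyl \<Rightarrow> 'a tensor"
    assume f: "f \<in> Hom orthogonal_group weyl_act (weyl_module E) tensor_act (tensors l)"
    show "f ` weyl_module E \<subseteq> {x. cinner (idx l) x b = 0}"
    proof (rule image_subsetI, rule CollectI)
      fix h :: "'a weyl" assume h: "h \<in> weyl_module E"
      from subsetD[OF 1[OF f h] b] show "cinner (idx l) (f h) b = 0" by (rule CollectD)
    qed
  qed
  from subsetD[OF this assms(4)] show "cinner (idx l) t b = 0" by (rule CollectD)
qed

text \<open>By equivariance \<open>Q\<close> preserves the isotypic component, and by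
  self-adjointness also its orthogonal complement.\<close>

lemma iso_proj_commute:
  fixes Q :: "'N::finite tensor \<Rightarrow> 'N tensor"
  assumes Q: "equivariant l l Q" and sa: "\<And>t s. cinner (idx l) (Q t) s = cinner (idx l) t (Q s)" and t: "t \<in> tensors l"
  shows "iso_proj l E (Q t) = Q (iso_proj l E t)"
  unfolding iso_proj_def[of l E]
proof (rule oproj_eqI[OF iso_proj_facts])
  note q = equivariantD[OF Q]
  let ?P = "oproj (idx l) (weyl_space l E)"
  have Pin: "?P t \<in> weyl_space l E" by (rule oproj_in[OF iso_proj_facts])
  show "Q t \<in> supp_on (idx l)" using q(2)[OF t] by (simp add: tensors_eq)
  show "Q (?P t) \<in> weyl_space l E" by (rule equivariant_weyl_space[OF Q Pin])
  fix b :: "'N tensor" assume "b \<in> weyl_space l E"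
  then have "cinner (idx l) (t - ?P t) (Q b) = 0"
    using t by (intro oproj_orthogonal[OF iso_proj_facts] equivariant_weyl_space[OF Q]) (simp_all add: tensors_eq)
  then show "cinner (idx l) (Q t - Q (?P t)) b = 0"
    by (simp add: cinner_diff_left sa)
qed

section \<open>Swaps and contractions as equivariant, self-adjoint operators\<close>

lemma equivariant_swap_op:
  assumes "p < n" "q < n"
  shows "equivariant n n (swap_op n p q)"
proof -
  have pq: "p + 1 \<in> {1..n}" "q + 1 \<in> {1..n}" using assms by auto
  have e: "swap_op n p q = perm_op n (Transposition.transpose (p + 1) (q + 1))"
    by (rule ext) (simp only: perm_op_transpose[OF pq] add_diff_cancel_right')
  have "Transposition.transpose (p + 1) (q + 1) permutes {1..n}" by (rule permutes_swap_id[OF pq])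
  then show ?thesis
    unfolding e equivariant_def linear_on_def by (auto simp: perm_op_in perm_op_add perm_op_scaleC tensor_act_perm_op)
qed

lemma equivariant_bar_op: "p < n \<Longrightarrow> q < n \<Longrightarrow> p \<noteq> q \<Longrightarrow> equivariant n n (bar_op n p q)"
  unfolding equivariant_def linear_on_def by (auto simp: bar_op_in bar_op_add bar_op_scaleC tensor_act_bar_op)

lemma contract_last_in: "t \<in> tensors (n + 2) \<Longrightarrow> contract_last t \<in> tensors n"
  by (simp add: tensors_def contract_last_def)

lemma equivariant_contract_last: "equivariant (n + 2) n contract_last"
proof -
  have "linear_on (tensors (n + 2)) contract_last"
    by (simp add: linear_on_def contract_last_def fun_eq_iff scaleC_apply sum.distrib sum_distrib_left)
  then show ?thesis by (auto simp: equivariant_def contract_last_in tensor_act_contract_last)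
qed

lemma cinner_swap_op:
  fixes t s :: "'N::finite tensor"
  assumes "p < n" "q < n"
  shows "cinner (idx n) (swap_op n p q t) s = cinner (idx n) t (swap_op n p q s)"
proof -
  have pq: "p + 1 \<in> {1..n}" "q + 1 \<in> {1..n}" using assms by auto
  have e: "swap_op n p q t = perm_op n (Transposition.transpose (p + 1) (q + 1)) t" for t :: "'N tensor"
    by (simp only: perm_op_transpose[OF pq] add_diff_cancel_right')
  have "Transposition.transpose (p + 1) (q + 1) \<in> symmetric_group n"
    by (simp only: symmetric_group_def mem_Collect_eq permutes_swap_id[OF pq])
  from cinner_perm_op[OF this] show ?thesis unfolding e by simp
qed

lemma cinner_bar_op:
  fixes t s :: "'N::finite tensor"
  assumes pq: "p < n" "q < n" "p \<noteq> q"
  shows "cinner (idx n) (bar_op n p q t) s = cinner (idx n) t (bar_op n p q s)"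
proof -
  let ?J = "{ks \<in> idx n. ks ! p = undefined \<and> ks ! q = undefined} :: 'N list set"
  have upd: "ks[p := a, q := b, p := c, q := d] = ks[p := c, q := d]" "ks[p := a, q := b] ! p = a" "ks[p := a, q := b] ! q = b"
    "length (ks[p := a, q := b]) = n" if "ks \<in> ?J" for ks :: "'N list" and a b c d
    using that pq by (auto simp: idx_def list_eq_iff_nth_eq nth_list_update)
  have len: "ks \<in> idx n \<Longrightarrow> length ks = n" for ks :: "'N list" by (simp add: idx_def)
  have "cinner (idx n) (bar_op n p q t) s = (\<Sum>ks\<in>?J. \<Sum>a\<in>UNIV. \<Sum>b\<in>UNIV.
      if b = a then (\<Sum>c\<in>UNIV. t (ks[p := c, q := c])) * cnj (s (ks[p := a, q := a])) else 0)"
    unfolding cinner_def sum_idx_split2[OF pq] by (intro sum.cong refl) (simp add: bar_op_def upd len)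
  also have "\<dots> = (\<Sum>ks\<in>?J. (\<Sum>c\<in>UNIV. t (ks[p := c, q := c])) * cnj (\<Sum>a\<in>UNIV. s (ks[p := a, q := a])))"
    by (simp add: sum_distrib_left)
  also have "\<dots> = (\<Sum>ks\<in>?J. \<Sum>a\<in>UNIV. \<Sum>b\<in>UNIV.
      if b = a then t (ks[p := a, q := a]) * cnj (\<Sum>c\<in>UNIV. s (ks[p := c, q := c])) else 0)"
    by (simp add: sum_distrib_right)
  also have "\<dots> = cinner (idx n) t (bar_op n p q s)"
    unfolding cinner_def sum_idx_split2[OF pq] by (intro sum.cong refl) (simp add: bar_op_def upd len)
  finally show ?thesis .
qed

subsection \<open>Operators on the first tensor factors\<close>

text \<open>The labels of the last factors are frozen to \<open>r\<close>. An extended operator acts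
  on every slice as the operator itself, so identities between extended operators are checked slice
  by slice in order \<open>l\<close>.\<close>

definition slice :: "nat \<Rightarrow> 'N list \<Rightarrow> 'N tensor \<Rightarrow> 'N tensor"
  where "slice l r t = (\<lambda>js. of_bool (length js = l) * t (js @ r))"

lemma extend_op_slice: "extend_op l A t is = A (slice l (drop l is) t) (take l is)"
  by (simp add: extend_op_def slice_def)

lemma slice_in [simp]: "slice l r t \<in> tensors l"
  by (simp add: slice_def tensors_def)

lemma slice_add: "slice l r (t + s) = slice l r t + slice l r s"
  and slice_scaleC: "slice l r (c *\<^sub>C t) = c *\<^sub>C slice l r t"
  and slice_0: "slice l r 0 = 0"
  by (simp_all add: slice_def fun_eq_iff scaleC_apply algebra_simps)

lemma slice_eq_0:
  assumes "t \<in> tensors n" "length r + l \<noteq> n"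
  shows "slice l r t = 0"
  using assms by (auto simp: slice_def tensors_def fun_eq_iff)

lemma slice_eqI:
  assumes "l \<le> n" "t \<in> tensors n" "s \<in> tensors n" "\<And>r. length r = n - l \<Longrightarrow> slice l r t = slice l r s"
  shows "t = s"
proof (rule tensors_eqI[OF assms(2,3)])
  fix "is" :: "'a list" assume len: "length is = n"
  have "slice l (drop l is) t (take l is) = slice l (drop l is) s (take l is)"
    using assms(4)[of "drop l is"] len by simp
  then show "t is = s is" using len assms(1) by (simp add: slice_def)
qed

context
  fixes l :: nat and A :: "'N::finite tensor \<Rightarrow> 'N tensor"
  assumes A: "equivariant l l A"
begin

lemma slice_extend_op: "slice l r (extend_op l A t) = A (slice l r t)"
proof
  fix js
  have "A (slice l r t) js = 0" if "length js \<noteq> l"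
    using equivariantD(2)[OF A slice_in] that by (simp add: tensors_def)
  then show "slice l r (extend_op l A t) js = A (slice l r t) js"
    by (cases "length js = l") (simp_all add: slice_def[of l r "extend_op l A t"] extend_op_slice)
qed

lemma extend_op_in:
  assumes t: "t \<in> tensors n"
  shows "extend_op l A t \<in> tensors n"
  unfolding tensors_def
proof (intro CollectI allI impI)
  fix "is" :: "'N list" assume len: "length is \<noteq> n"
  show "extend_op l A t is = 0"
  proof (cases "l \<le> length is")
    case True
    then have "slice l (drop l is) t = 0" using len by (intro slice_eq_0[OF t]) simp
    then show ?thesis by (simp add: extend_op_slice equivariantD(4)[OF A])
  next
    case False
    have "A (slice l (drop l is) t) \<in> tensors l" by (rule equivariantD(2)[OF A slice_in])
    then show ?thesis using False by (simp add: extend_op_slice tensors_def)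
  qed
qed

lemma extend_op_add: "extend_op l A (t + s) = extend_op l A t + extend_op l A s"
  and extend_op_scaleC: "extend_op l A (c *\<^sub>C t) = c *\<^sub>C extend_op l A t"
  and extend_op_0: "extend_op l A 0 = 0"
proof -
  note lin = linear_onD[OF equivariantD(1)[OF A]]
  show "extend_op l A (t + s) = extend_op l A t + extend_op l A s"
    by (rule ext) (simp add: extend_op_slice slice_add lin)
  show "extend_op l A (c *\<^sub>C t) = c *\<^sub>C extend_op l A t"
    by (rule ext) (simp add: extend_op_slice slice_scaleC lin scaleC_apply)
  show "extend_op l A 0 = 0"
    by (rule ext) (simp add: extend_op_slice slice_0 equivariantD(4)[OF A])
qed

lemma extend_op_diff: "extend_op l A (t - s) = extend_op l A t - extend_op l A s"
  using extend_op_add[of "t - s" s] by simp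

lemma extend_op_sum: "extend_op l A (\<Sum>a\<in>X. t a) = (\<Sum>a\<in>X. extend_op l A (t a))"
proof -
  have "linear_on UNIV (extend_op l A)" by (simp add: linear_on_def extend_op_add extend_op_scaleC)
  from linear_on_sum[OF this complex_vector.subspace_UNIV] show ?thesis by simp
qed

lemma linear_sum:
  assumes "\<And>a. a \<in> X \<Longrightarrow> t a \<in> tensors l"
  shows "A (\<Sum>a\<in>X. t a) = (\<Sum>a\<in>X. A (t a))"
  using linear_on_sum[OF equivariantD(1)[OF A] subspace_tensors] assms by blast

text \<open>A swap behind the first \<open>l\<close> factors acts on slices only through their
  labels: it permutes the entries of \<open>r\<close>. For \<open>bar_op\<close> below, the slice is
  likewise a sum of slices with other labels.\<close>

lemma extend_op_swap_tail:
  assumes t: "t \<in> tensors n" and pq: "l \<le> p" "l \<le> q" "p < n" "q < n"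
  shows "extend_op l A (swap_op n p q t) = swap_op n p q (extend_op l A t)"
proof (rule slice_eqI[of l n])
  show "l \<le> n" using pq by simp
  show "extend_op l A (swap_op n p q t) \<in> tensors n" "swap_op n p q (extend_op l A t) \<in> tensors n"
    by (simp_all add: extend_op_in swap_op_in)
  fix r :: "'N list" assume r: "length r = n - l"
  have e: "slice l r (swap_op n p q t) = slice l (r[p - l := r ! (q - l), q - l := r ! (p - l)]) t" for t
    using pq r by (auto simp: slice_def swap_op_def fun_eq_iff nth_append list_update_append)
  show "slice l r (extend_op l A (swap_op n p q t)) = slice l r (swap_op n p q (extend_op l A t))"
    by (simp only: slice_extend_op e)
qed

lemma extend_op_bar_tail:
  assumes t: "t \<in> tensors n" and pq: "l \<le> p" "l \<le> q" "p < n" "q < n"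
  shows "extend_op l A (bar_op n p q t) = bar_op n p q (extend_op l A t)"
proof (rule slice_eqI[of l n])
  show "l \<le> n" using pq by simp
  show "extend_op l A (bar_op n p q t) \<in> tensors n" "bar_op n p q (extend_op l A t) \<in> tensors n"
    by (simp_all add: extend_op_in bar_op_in)
  fix r :: "'N list" assume r: "length r = n - l"
  have e: "slice l r (bar_op n p q t) =
      of_bool (r ! (p - l) = r ! (q - l)) *\<^sub>C (\<Sum>a\<in>UNIV. slice l (r[p - l := a, q - l := a]) t)" for t
    using pq r by (auto simp: slice_def bar_op_def fun_eq_iff scaleC_apply nth_append list_update_append)
  show "slice l r (extend_op l A (bar_op n p q t)) = slice l r (bar_op n p q (extend_op l A t))"
    by (simp add: slice_extend_op e linear_onD(2)[OF equivariantD(1)[OF A]] linear_sum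
        complex_vector.subspace_sum[OF subspace_tensors])
qed

text \<open>
  The part of \<open>x\<^sub>p\<^sub>+\<^sub>1\<close> that mixes the first \<open>l\<close> factors with factor \<open>p\<close> acts on the former through elements
  of \<open>so(N)\<close>, hence commutes with the centralizer algebra of these \<open>l\<close> factors.
\<close>

lemma slice_swap_bar_mixed:
  fixes t :: "'N tensor"
  assumes p: "l \<le> p" "p < n" and r: "length r = n - l"
  shows "slice l r (\<Sum>q<l. swap_op n p q t - bar_op n p q t) =
    (\<Sum>j\<in>UNIV. so_op j (r ! (p - l)) (slice l (r[p - l := j]) t))"
proof
  fix js :: "'N list"
  let ?a = "r ! (p - l)"
  show "slice l r (\<Sum>q<l. swap_op n p q t - bar_op n p q t) js =
      (\<Sum>j\<in>UNIV. so_op j ?a (slice l (r[p - l := j]) t)) js"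
  proof (cases "length js = l")
    case True
    \<comment> \<open>Head position \<open>q\<close> gets the label \<open>b\<close> and position
      \<open>p\<close> the label \<open>j\<close>. With \<open>a = r ! (p - l)\<close>, the swap
      yields the term with labels \<open>a\<close> and \<open>js ! q\<close>, and the bar element
      the diagonal terms; together they form E_ja - E_aj summed over \<open>j\<close>.\<close>
    let ?T = "\<lambda>q b j. t (js[q := b] @ r[p - l := j])"
    have sw: "swap_op n p q t (js @ r) = ?T q ?a (js ! q)" if "q < l" for q
      using that p r True by (simp add: swap_op_def nth_append list_update_append)
    have ba: "bar_op n p q t (js @ r) = of_bool (js ! q = ?a) * (\<Sum>j\<in>UNIV. ?T q j j)" if "q < l" for q
      using that p r True by (auto simp add: bar_op_def nth_append list_update_append)
    have "slice l r (\<Sum>q<l. swap_op n p q t - bar_op n p q t) js =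
        (\<Sum>q<l. swap_op n p q t (js @ r) - bar_op n p q t (js @ r))"
      using True by (simp add: slice_def)
    also have "\<dots> = (\<Sum>q<l. ?T q ?a (js ! q) - of_bool (js ! q = ?a) * (\<Sum>j\<in>UNIV. ?T q j j))"
      by (rule sum.cong[OF refl]) (simp only: lessThan_iff sw ba)
    also have "\<dots> = (\<Sum>q<l. \<Sum>j\<in>UNIV. of_bool (js ! q = j) * ?T q ?a j - of_bool (js ! q = ?a) * ?T q j j)"
    proof (rule sum.cong[OF refl])
      fix q
      have "(\<Sum>j\<in>UNIV. of_bool (js ! q = j) * ?T q ?a j) = (\<Sum>j\<in>UNIV. if j = js ! q then ?T q ?a (js ! q) else 0)"
        by (rule sum.cong[OF refl]) auto
      then show "?T q ?a (js ! q) - of_bool (js ! q = ?a) * (\<Sum>j\<in>UNIV. ?T q j j) =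
          (\<Sum>j\<in>UNIV. of_bool (js ! q = j) * ?T q ?a j - of_bool (js ! q = ?a) * ?T q j j)"
        by (simp only: sum_subtractf sum_distrib_left) simp
    qed
    also have "\<dots> = (\<Sum>j\<in>UNIV. \<Sum>q<l. of_bool (js ! q = j) * ?T q ?a j - of_bool (js ! q = ?a) * ?T q j j)"
      by (rule sum.swap)
    also have "\<dots> = (\<Sum>j\<in>UNIV. so_op j ?a (slice l (r[p - l := j]) t)) js"
      by (simp only: fun_sum_apply so_op_def fun_diff_def gl_op_def slice_def True length_list_update
          sum_subtractf of_bool_eq simp_thms mult_1)
    finally show ?thesis .
  next
    case False
    have "(\<Sum>j\<in>UNIV. so_op j ?a (slice l (r[p - l := j]) t)) \<in> tensors l"
      by (intro complex_vector.subspace_sum[OF subspace_tensors] so_op_in slice_in)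
    then show ?thesis using False by (simp only: slice_def tensors_def mem_Collect_eq of_bool_eq mult_zero_left) simp
  qed
qed

lemma extend_op_mixed:
  assumes t: "t \<in> tensors n" and p: "l \<le> p" "p < n"
  shows "extend_op l A (\<Sum>q<l. swap_op n p q t - bar_op n p q t) =
    (\<Sum>q<l. swap_op n p q (extend_op l A t) - bar_op n p q (extend_op l A t))"
proof (rule slice_eqI[of l n])
  have in_n: "(\<Sum>q<l. swap_op n p q s - bar_op n p q s) \<in> tensors n" for s :: "'N tensor"
    by (intro complex_vector.subspace_sum[OF subspace_tensors] complex_vector.subspace_diff[OF subspace_tensors]
        swap_op_in bar_op_in)
  show "l \<le> n" using p by simp
  show "extend_op l A (\<Sum>q<l. swap_op n p q t - bar_op n p q t) \<in> tensors n"
    "(\<Sum>q<l. swap_op n p q (extend_op l A t) - bar_op n p q (extend_op l A t)) \<in> tensors n"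
    by (intro extend_op_in in_n)+
  fix r :: "'N list" assume r: "length r = n - l"
  have so: "A (so_op i j u) = so_op i j (A u)" if "u \<in> tensors l" for i j u
  proof (cases "i = j")
    case True
    then show ?thesis by (simp add: so_op_def equivariantD(4)[OF A])
  next
    case False
    then show ?thesis
      by (intro equivariant_commutes_so_op[OF equivariantD(1)[OF A] _ that] equivariantD(3)[OF A])
  qed
  show "slice l r (extend_op l A (\<Sum>q<l. swap_op n p q t - bar_op n p q t)) =
      slice l r (\<Sum>q<l. swap_op n p q (extend_op l A t) - bar_op n p q (extend_op l A t))"
    unfolding slice_extend_op slice_swap_bar_mixed[OF p r]
    by (simp add: linear_sum so_op_in so slice_extend_op)
qed

end

section \<open>Isotypic projections commute with the operators of the Brauer algebra\<close>

lemma slice_swap_head: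
  assumes "p < l" "q < l" "l \<le> n" "length r = n - l"
  shows "slice l r (swap_op n p q t) = swap_op l p q (slice l r t)"
  using assms by (auto simp: slice_def swap_op_def fun_eq_iff nth_append list_update_append)

lemma slice_bar_head:
  assumes "p < l" "q < l" "l \<le> n" "length r = n - l"
  shows "slice l r (bar_op n p q t) = bar_op l p q (slice l r t)"
  using assms by (auto simp: slice_def bar_op_def fun_eq_iff nth_append list_update_append)

text \<open>Among the first \<open>l\<close> factors a swap need not commute with every element of
  the centralizer algebra. It does commute with isotypic projections, being equivariant and
  self-adjoint.\<close>

lemma extend_iso_proj_swap_head:
  fixes t :: "'N::finite tensor"
  assumes t: "t \<in> tensors n" and pq: "p < l" "q < l" "l \<le> n"
  shows "extend_op l (iso_proj l E) (swap_op n p q t) = swap_op n p q (extend_op l (iso_proj l E) t)"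
proof (rule slice_eqI[of l n])
  note P = equivariant_iso_proj[of l E]
  show "extend_op l (iso_proj l E) (swap_op n p q t) \<in> tensors n" "swap_op n p q (extend_op l (iso_proj l E) t) \<in> tensors n"
    by (simp_all add: extend_op_in[OF P] swap_op_in)
  fix r :: "'N list" assume r: "length r = n - l"
  show "slice l r (extend_op l (iso_proj l E) (swap_op n p q t)) = slice l r (swap_op n p q (extend_op l (iso_proj l E) t))"
    unfolding slice_extend_op[OF P] slice_swap_head[OF pq r]
    by (rule iso_proj_commute[OF equivariant_swap_op cinner_swap_op slice_in]) (fact pq)+
qed (fact pq)

lemma extend_iso_proj_bar_head:
  fixes t :: "'N::finite tensor"
  assumes t: "t \<in> tensors n" and pq: "p < l" "q < l" "l \<le> n" "p \<noteq> q"
  shows "extend_op l (iso_proj l E) (bar_op n p q t) = bar_op n p q (extend_op l (iso_proj l E) t)"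
proof (rule slice_eqI[of l n])
  note P = equivariant_iso_proj[of l E]
  show "extend_op l (iso_proj l E) (bar_op n p q t) \<in> tensors n" "bar_op n p q (extend_op l (iso_proj l E) t) \<in> tensors n"
    by (simp_all add: extend_op_in[OF P] bar_op_in)
  fix r :: "'N list" assume r: "length r = n - l"
  show "slice l r (extend_op l (iso_proj l E) (bar_op n p q t)) = slice l r (bar_op n p q (extend_op l (iso_proj l E) t))"
    unfolding slice_extend_op[OF P] slice_bar_head[OF pq(1-3) r]
    by (rule iso_proj_commute[OF equivariant_bar_op cinner_bar_op slice_in]) (fact pq)+
qed (fact pq)

text \<open>Positions count from 0, so this is the operator of the Jucys-Murphy element
  \<open>x\<close> with index \<open>p + 1\<close>.\<close>

definition x_op :: "nat \<Rightarrow> nat \<Rightarrow> 'N::finite tensor \<Rightarrow> 'N tensor"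
  where "x_op n p t = ((of_nat CARD('N) - 1) / 2) *\<^sub>C t + (\<Sum>q<p. swap_op n p q t - bar_op n p q t)"

lemma x_op_in: "t \<in> tensors n \<Longrightarrow> x_op n p t \<in> tensors n"
  unfolding x_op_def
  by (intro complex_vector.subspace_add[OF subspace_tensors] complex_vector.subspace_scale[OF subspace_tensors]
      complex_vector.subspace_sum[OF subspace_tensors] complex_vector.subspace_diff[OF subspace_tensors]
      swap_op_in bar_op_in)

lemma swap_op_add: "swap_op n p q (t + s) = swap_op n p q t + swap_op n p q s"
  and swap_op_scaleC: "swap_op n p q (c *\<^sub>C t) = c *\<^sub>C swap_op n p q t"
  by (simp_all add: swap_op_def fun_eq_iff scaleC_apply algebra_simps)

lemma tensor_act_diff: "tensor_act g (t - s) = tensor_act g t - tensor_act g s"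
  using tensor_act_add[of g "t - s" s] by simp

lemma equivariant_x_op:
  assumes p: "p < n"
  shows "equivariant n n (x_op n p :: 'N::finite tensor \<Rightarrow> 'N tensor)"
proof -
  have add: "x_op n p (t + s) = x_op n p t + x_op n p s" for t s :: "'N tensor"
  proof -
    have "(\<Sum>q<p. swap_op n p q (t + s) - bar_op n p q (t + s)) =
        (\<Sum>q<p. (swap_op n p q t - bar_op n p q t) + (swap_op n p q s - bar_op n p q s))"
      by (rule sum.cong[OF refl]) (simp only: swap_op_add bar_op_add add_diff_add)
    then show ?thesis
      unfolding x_op_def by (simp only: sum.distrib complex_vector.scale_right_distrib add_ac)
  qed
  have scale: "x_op n p (c *\<^sub>C t) = c *\<^sub>C x_op n p t" for t :: "'N tensor" and c
    unfolding x_op_def swap_op_scaleC bar_op_scaleC complex_vector.scale_right_distrib complex_vector.scale_sum_right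
      complex_vector.scale_right_diff_distrib complex_vector.scale_left_commute[of c] by (rule refl)
  have act: "x_op n p (tensor_act g t) = tensor_act g (x_op n p t)"
    if g: "g \<in> orthogonal_group" and t: "t \<in> tensors n" for g and t :: "'N tensor"
  proof -
    have "tensor_act g (swap_op n p q t) = swap_op n p q (tensor_act g t)"
      "tensor_act g (bar_op n p q t) = bar_op n p q (tensor_act g t)" if "q < p" for q
      using that p g t equivariantD(3)[OF equivariant_swap_op[of p n q] g t] tensor_act_bar_op[OF g, of p n q t] by simp_all
    then have "(\<Sum>q<p. tensor_act g (swap_op n p q t - bar_op n p q t)) =
        (\<Sum>q<p. swap_op n p q (tensor_act g t) - bar_op n p q (tensor_act g t))"
      by (intro sum.cong[OF refl]) (simp only: lessThan_iff tensor_act_diff)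
    then show ?thesis
      unfolding x_op_def tensor_act_add tensor_act_scaleC tensor_act_sum by simp
  qed
  show ?thesis
    unfolding equivariant_def linear_on_def by (auto simp: add scale act x_op_in)
qed

text \<open>For \<open>p < l\<close> every term acts inside the first \<open>l\<close> factors.
  Otherwise the terms with \<open>q \<ge> l\<close> act behind them, while those with
  \<open>q < l\<close> must be taken together, since their sum is what acts on slices through
  so(N).\<close>

lemma extend_iso_proj_x_op:
  fixes t :: "'N::finite tensor"
  assumes t: "t \<in> tensors n" and p: "p < n" and l: "l \<le> n"
  shows "extend_op l (iso_proj l E) (x_op n p t) = x_op n p (extend_op l (iso_proj l E) t)"
proof -
  note P = equivariant_iso_proj[of l E]
  let ?P = "extend_op l (iso_proj l E) :: 'N tensor \<Rightarrow> 'N tensor"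
  let ?d = "\<lambda>t q. swap_op n p q t - bar_op n p q t :: 'N tensor"
  have "?P (\<Sum>q<p. ?d t q) = (\<Sum>q<p. ?d (?P t) q)"
  proof (cases "p < l")
    case True
    have "?P (?d t q) = ?d (?P t) q" if "q < p" for q
      unfolding extend_op_diff[OF P]
      using True that l by (simp only: extend_iso_proj_swap_head[OF t] extend_iso_proj_bar_head[OF t])
    then show ?thesis unfolding extend_op_sum[OF P] by (intro sum.cong[OF refl]) (simp only: lessThan_iff)
  next
    case False
    have split: "(\<Sum>q<p. h q) = (\<Sum>q<l. h q) + (\<Sum>q\<in>{l..<p}. h q)" for h :: "nat \<Rightarrow> 'N tensor"
    proof -
      have "{..<p} = {..<l} \<union> {l..<p}" using False by auto
      then have "sum h {..<p} = sum h ({..<l} \<union> {l..<p})" by (rule arg_cong)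
      also have "\<dots> = sum h {..<l} + sum h {l..<p}" by (rule sum.union_disjoint) auto
      finally show ?thesis .
    qed
    have "?P (?d t q) = ?d (?P t) q" if "q \<in> {l..<p}" for q
      unfolding extend_op_diff[OF P]
      using False that p by (simp add: extend_op_swap_tail[OF P t] extend_op_bar_tail[OF P t])
    then have tail: "(\<Sum>q\<in>{l..<p}. ?P (?d t q)) = (\<Sum>q\<in>{l..<p}. ?d (?P t) q)"
      by (rule sum.cong[OF refl])
    have head: "?P (\<Sum>q<l. ?d t q) = (\<Sum>q<l. ?d (?P t) q)"
      by (rule extend_op_mixed[OF P t _ p]) (use False in simp)
    have "?P (\<Sum>q<p. ?d t q) = ?P (\<Sum>q<l. ?d t q) + (\<Sum>q\<in>{l..<p}. ?P (?d t q))"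
      by (simp only: split extend_op_add[OF P] extend_op_sum[OF P, of _ "{l..<p}"])
    also have "\<dots> = (\<Sum>q<p. ?d (?P t) q)" unfolding head tail by (rule split[symmetric])
    finally show ?thesis .
  qed
  then show ?thesis
    by (simp only: x_op_def extend_op_add[OF P] extend_op_scaleC[OF P])
qed

lemma swap_op_swap_op: "p < n \<Longrightarrow> q < n \<Longrightarrow> t \<in> tensors n \<Longrightarrow> swap_op n p q (swap_op n p q t) = t"
  by (rule tensors_eqI[OF swap_op_in])
    (auto simp: swap_op_def nth_list_update list_eq_iff_nth_eq intro!: arg_cong[of _ _ t])

section \<open>The canonical basis\<close>

lemma scaleC_fun_apply: "(c *\<^sub>C f) x = c *\<^sub>C f x"
  by (simp add: scaleC_fun_def)

lemma extend_op_self: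
  assumes A: "equivariant l l A" and t: "t \<in> tensors l"
  shows "extend_op l A t = A t"
proof (rule tensors_eqI[OF extend_op_in[OF A t] equivariantD(2)[OF A t]])
  have s: "slice l [] t = t" using t by (auto simp: slice_def tensors_def fun_eq_iff)
  show "extend_op l A t is = A t is" if "length is = l" for "is"
    using that by (simp add: extend_op_slice s)
qed

lemma mult_module_tensors: "f \<in> mult_module n D \<Longrightarrow> f h \<in> tensors n"
  unfolding mult_module_def
  by (cases "h \<in> weyl_module D") (simp_all add: HomD(2,4) complex_vector.subspace_0[OF subspace_tensors])

lemma mult_module_fixed:
  assumes f: "f \<in> mult_module n D"
  shows "extend_op n (iso_proj n D) \<circ> f = f"
proof
  fix h
  note P = equivariant_iso_proj[of n D]
  have fh: "f h \<in> weyl_space n D"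
  proof (cases "h \<in> weyl_module D")
    case True
    then show ?thesis by (rule weyl_spaceI[OF f[unfolded mult_module_def]])
  next
    case False
    then show ?thesis
      using HomD(4)[OF f[unfolded mult_module_def]] complex_vector.subspace_0[OF subspace_weyl_space] by simp
  qed
  then show "(extend_op n (iso_proj n D) \<circ> f) h = f h"
    by (simp only: o_apply extend_op_self[OF P subsetD[OF weyl_space_subset fh]] iso_proj_id)
qed

text \<open>The projection belongs to the centralizer algebra and is the identity on
  \<open>mult_module l E\<close>. An isomorphism of modules transports this to every copy, and the
  fixed vectors form a subspace, which then contains the span of all copies.\<close>

lemma restriction_component_fixed:
  assumes "f \<in> restriction_component n D l E"
  shows "extend_op l (iso_proj l E) \<circ> f = f"
proof -
  note P = equivariant_iso_proj[of l E]
  let ?P = "extend_op l (iso_proj l E) :: 'a tensor \<Rightarrow> 'a tensor"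
  let ?S = "{f :: 'a mult. ?P \<circ> f = f}"
  have "complex_vector.subspace ?S"
    unfolding complex_vector.subspace_def
  proof (intro conjI ballI allI CollectI)
    show "?P \<circ> 0 = (0 :: 'a mult)"
    proof
      fix h :: "'a weyl"
      show "(?P \<circ> 0) h = 0 h" by (simp only: o_apply zero_fun_apply[of h] extend_op_0[OF P])
    qed
    fix f assume "f \<in> ?S"
    then have "?P \<circ> f = f" by (rule CollectD)
    then have f: "?P (f h) = f h" for h by (metis o_apply)
    show "?P \<circ> (f + g) = f + g" if "g \<in> ?S" for g
    proof
      fix h
      have "?P \<circ> g = g" using that by (rule CollectD)
      then have "?P (g h) = g h" by (metis o_apply)
      then show "(?P \<circ> (f + g)) h = (f + g) h"
        by (simp only: o_apply plus_fun_apply[of f g h] extend_op_add[OF P] f)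
    qed
    show "?P \<circ> (c *\<^sub>C f) = c *\<^sub>C f" for c
    proof
      fix h show "(?P \<circ> (c *\<^sub>C f)) h = (c *\<^sub>C f) h"
        by (simp only: o_apply scaleC_fun_apply[of c f h] extend_op_scaleC[OF P] f)
    qed
  qed
  moreover have "X \<subseteq> ?S"
    if iso: "isomorphic_modules (centralizer_algebra l) (centralizer_act l) (mult_module l E) (centralizer_act l) X" for X
  proof
    fix x assume x: "x \<in> X"
    obtain \<phi> where \<phi>: "\<phi> \<in> Hom (centralizer_algebra l) (centralizer_act l) (mult_module l E) (centralizer_act l) X"
      "bij_betw \<phi> (mult_module l E) X"
      using iso unfolding isomorphic_modules_def by (elim bexE)
    obtain f0 where f0: "f0 \<in> mult_module l E" "x = \<phi> f0"
      using \<phi>(2) x unfolding bij_betw_def by (elim conjE) (drule sym, simp only:, elim imageE, simp)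
    have "centralizer_act l (iso_proj l E) x = \<phi> (centralizer_act l (iso_proj l E) f0)"
      unfolding f0(2) by (rule HomD(3)[OF \<phi>(1) iso_proj_centralizer f0(1), symmetric])
    also have "centralizer_act l (iso_proj l E) f0 = f0"
      unfolding centralizer_act_def by (rule mult_module_fixed[OF f0(1)])
    finally show "x \<in> ?S" by (simp only: centralizer_act_def f0(2) mem_Collect_eq)
  qed
  ultimately have "restriction_component n D l E \<subseteq> ?S"
    unfolding restriction_component_def isotypic_component_def
    by (intro complex_vector.span_minimal Union_least) (elim CollectE conjE)
  from subsetD[OF this assms] show ?thesis by (rule CollectD)
qed

text \<open>The fixed-point equation puts every slice of \<open>t\<close> into the component of
  \<open>E\<close>, where the projection to another type vanishes.\<close>

lemma fixed_other:
  assumes y: "young_diagram E" "young_diagram E'" "E \<noteq> E'" and l: "l \<le> n" and t: "t \<in> tensors n"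
    and fix_t: "extend_op l (iso_proj l E) t = t"
  shows "extend_op l (iso_proj l E') t = 0"
proof (rule slice_eqI[OF l extend_op_in[OF equivariant_iso_proj t]])
  show "0 \<in> tensors n" by (rule complex_vector.subspace_0[OF subspace_tensors])
  fix r :: "'a list"
  have "slice l r t = iso_proj l E (slice l r t)"
    using arg_cong[OF fix_t, of "slice l r"] by (simp only: slice_extend_op[OF equivariant_iso_proj])
  then have "slice l r t \<in> weyl_space l E" using iso_proj_in[of l E "slice l r t"] by simp
  then show "slice l r (extend_op l (iso_proj l E') t) = slice l r 0"
    by (simp only: slice_extend_op[OF equivariant_iso_proj] iso_proj_other[OF y] slice_0)
qed

text \<open>This covers the empty diagram at the bottom of a path, which enters the theorem for
  \<open>k = 1\<close>. Every tensor of order 0 is obtained by evaluating an element of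
  \<open>weyl_module {}\<close> at the polytabloid \<open>e\<close> of the empty tableau.\<close>

lemma weyl_space_0: "(tensors 0 :: 'N::finite tensor set) \<subseteq> weyl_space 0 {}"
proof
  fix u :: "'N tensor" assume u: "u \<in> tensors 0"
  define e where "e = polytabloid 0 (\<lambda>_. (0, 0))"
  define r where "r = tabloid 0 (\<lambda>_::nat. (0::nat, 0::nat))"
  have S0: "symmetric_group 0 = {id}" by (auto simp: symmetric_group_def)
  have "bij_betw (\<lambda>_. (0, 0)) {1..card ({} :: diagram)} {}" by (simp add: bij_betw_def)
  then have e: "e \<in> specht {}"
    unfolding e_def specht_def by (intro complex_vector.span_base image_eqI[of _ _ "\<lambda>_. (0, 0)"]) simp_all
  have "u \<in> traceless 0" using u by (simp add: traceless_iff)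
  then have h: "weyl_elem {} r u \<in> weyl_module {}" by (intro weyl_elem_in) simp
  \<comment> \<open>Evaluation at \<open>e\<close> intertwines the two group actions; it is cut off
    to 0 outside the module as \<open>Hom\<close> requires.\<close>
  define f where "f h = (if h \<in> weyl_module {} then h e else 0)" for h :: "'N weyl"
  note W = complex_vector.subspace_add[OF subspace_weyl_module] complex_vector.subspace_scale[OF subspace_weyl_module]
  have "f \<in> Hom orthogonal_group weyl_act (weyl_module {}) tensor_act (tensors 0)"
    unfolding Hom_def
  proof (intro CollectI conjI ballI allI impI image_subsetI)
    show "linear_on (weyl_module {}) f"
    proof -
      have "(c *\<^sub>C h) e = c *\<^sub>C h e" for c and h :: "'N weyl" by (rule scaleC_fun_apply)
      then show ?thesis unfolding linear_on_def f_def by (simp add: W)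
    qed
    fix h :: "'N weyl" assume h: "h \<in> weyl_module {}"
    show "f h \<in> tensors 0"
      using weyl_moduleD(2)[OF h e] h traceless_subset by (auto simp: f_def)
    show "f (weyl_act g h) = tensor_act g (f h)" if "g \<in> orthogonal_group" for g
      using weyl_act_in[OF that h] h by (simp add: f_def weyl_act_def)
  qed (simp add: f_def)
  from weyl_spaceI[OF this h] have "weyl_elem {} r u e \<in> weyl_space 0 {}"
    using h by (simp only: f_def if_True)
  moreover have "weyl_elem {} r u e = u"
  proof -
    have "column_group 0 (\<lambda>_::nat. (0::nat, 0::nat)) = {id}" by (auto simp: column_group_def S0)
    then have "e r = 1" by (simp add: e_def r_def polytabloid_def o_def)
    then have "weyl_elem {} r u e = 1 *\<^sub>C perm_op 0 id u" using e by (simp add: weyl_elem_def S0)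
    then show ?thesis using perm_op_id[OF u] by (simp add: complex_vector.scale_one)
  qed
  ultimately show "u \<in> weyl_space 0 {}" by simp
qed

text \<open>The slices of the result have two types at once. They are multiples of contractions of
  slices of order \<open>l + 2\<close>, hence of type \<open>E\<close>; and they are fixed by the
  projection to \<open>E'\<close>, because the operator acts behind the first \<open>l\<close>
  factors.\<close>

lemma bar_op_adjacent_eq_0:
  fixes t :: "'N::finite tensor"
  assumes t: "t \<in> tensors n" and l: "l + 2 \<le> n"
    and y: "young_diagram E" "young_diagram E'" "E \<noteq> E'"
    and E: "extend_op (l + 2) (iso_proj (l + 2) E) t = t" and E': "extend_op l (iso_proj l E') t = t"
  shows "bar_op n l (l + 1) t = 0"
proof (rule slice_eqI[of l n])
  let ?b = "bar_op n l (l + 1) t"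
  show "l \<le> n" using l by simp
  show "?b \<in> tensors n" by (rule bar_op_in)
  show "0 \<in> tensors n" by (rule complex_vector.subspace_0[OF subspace_tensors])
  fix r :: "'N list" assume r: "length r = n - l"
  have "length r = Suc (Suc (n - l - 2))" using r l by simp
  \<comment> \<open>\<open>b\<close> and \<open>c\<close> are the labels at positions
    \<open>l\<close> and \<open>l + 1\<close>, between which the bar element acts.\<close>
  then obtain b c r' where r': "r = b # c # r'" by (auto simp: length_Suc_conv)
  have "slice (l + 2) r' t = iso_proj (l + 2) E (slice (l + 2) r' t)"
    using arg_cong[OF E, of "slice (l + 2) r'"] by (simp only: slice_extend_op[OF equivariant_iso_proj])
  then have "slice (l + 2) r' t \<in> weyl_space (l + 2) E" using iso_proj_in[of "l + 2" E "slice (l + 2) r' t"] by simp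
  then have c_in: "contract_last (slice (l + 2) r' t) \<in> weyl_space l E"
    by (rule equivariant_weyl_space[OF equivariant_contract_last])
  have "slice l r ?b = of_bool (b = c) *\<^sub>C contract_last (slice (l + 2) r' t)"
    using l r by (auto simp: slice_def bar_op_def contract_last_def fun_eq_iff scaleC_apply r' nth_append
        list_update_append)
  then have sb: "slice l r ?b \<in> weyl_space l E"
    using complex_vector.subspace_scale[OF subspace_weyl_space c_in] by simp
  have "?b = extend_op l (iso_proj l E') ?b"
    using extend_op_bar_tail[OF equivariant_iso_proj[of l E'] t, of l "l + 1"] E' l by simp
  then have "slice l r ?b = iso_proj l E' (slice l r ?b)"
    using slice_extend_op[OF equivariant_iso_proj[of l E'], of r ?b] by simp
  then show "slice l r ?b = slice l r 0"
    by (simp only: iso_proj_other[OF y sb] slice_0)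
qed

subsection \<open>Relations in the Brauer algebra\<close>

text \<open>Moving the swap to the right renames \<open>p\<close> to \<open>p + 1\<close> in every
  term with \<open>q < p\<close>. The additional term \<open>q = p\<close> of the second element,
  applied after the swap, gives \<open>t\<close> from the transposition and
  \<open>bar_op n p (p + 1) t\<close> from the bar element.\<close>

lemma exchange_relation:
  fixes t :: "'N::finite tensor"
  assumes p: "p + 1 < n" and t: "t \<in> tensors n"
  shows "swap_op n p (p + 1) (x_op n p t) - x_op n (p + 1) (swap_op n p (p + 1) t) = bar_op n p (p + 1) t - t"
proof -
  let ?s = "swap_op n p (p + 1) :: 'N tensor \<Rightarrow> 'N tensor"
  have sw: "?s (swap_op n p q t) = swap_op n (p + 1) q (?s t)" if q: "q < p" for q
  proof
    fix "is" :: "'N list"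
    show "?s (swap_op n p q t) is = swap_op n (p + 1) q (?s t) is"
      using p q by (cases "length is = n")
        (auto simp: swap_op_def nth_list_update list_eq_iff_nth_eq intro!: arg_cong[of _ _ t])
  qed
  have ba: "?s (bar_op n p q t) = bar_op n (p + 1) q (?s t)" if q: "q < p" for q
  proof
    fix "is" :: "'N list"
    show "?s (bar_op n p q t) is = bar_op n (p + 1) q (?s t) is"
    proof (cases "length is = n")
      case True
      have "is[p := is ! (p + 1), p + 1 := is ! p, p := a, q := a] =
          is[p + 1 := a, q := a, p := is[p + 1 := a, q := a] ! (p + 1), p + 1 := is[p + 1 := a, q := a] ! p]" for a
        using p q True by (auto simp: nth_list_update list_eq_iff_nth_eq)
      then show ?thesis using p q True by (simp add: swap_op_def bar_op_def nth_list_update)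
    qed (simp add: swap_op_def bar_op_def)
  qed
  have last: "bar_op n (p + 1) p (?s t) = bar_op n p (p + 1) t"
  proof
    fix "is" :: "'N list"
    show "bar_op n (p + 1) p (?s t) is = bar_op n p (p + 1) t is"
    proof (cases "length is = n")
      case True
      have "is[p + 1 := a, p := a, p := is[p + 1 := a, p := a] ! (p + 1), p + 1 := is[p + 1 := a, p := a] ! p] =
          is[p := a, p + 1 := a]" for a
        using p True by (auto simp: nth_list_update list_eq_iff_nth_eq)
      then show ?thesis using p True by (simp add: swap_op_def bar_op_def eq_commute)
    qed (simp add: swap_op_def bar_op_def)
  qed
  have tt: "swap_op n (p + 1) p (?s t) = t"
  proof -
    have "swap_op n (p + 1) p (?s t) = ?s (?s t)"
    proof
      fix "is" :: "'N list"
      show "swap_op n (p + 1) p (?s t) is = ?s (?s t) is"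
        using p list_update_swap[of p "p + 1" "is"] by (simp add: swap_op_def)
    qed
    then show ?thesis using swap_op_swap_op[of p n "p + 1" t] p t by simp
  qed
  let ?c = "(of_nat CARD('N) - 1) / 2 :: complex"
  have lin: "linear_on UNIV ?s" by (simp add: linear_on_def swap_op_add swap_op_scaleC)
  have diff: "?s (a - b) = ?s a - ?s b" for a b using swap_op_add[of n p "p + 1" "a - b" b] by simp
  have "?s (\<Sum>q<p. swap_op n p q t - bar_op n p q t) = (\<Sum>q<p. ?s (swap_op n p q t - bar_op n p q t))"
    by (rule linear_on_sum[OF lin complex_vector.subspace_UNIV]) simp
  also have "\<dots> = (\<Sum>q<p. swap_op n (p + 1) q (?s t) - bar_op n (p + 1) q (?s t))"
    by (rule sum.cong[OF refl]) (simp only: diff sw ba lessThan_iff)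
  finally have "?s (x_op n p t) = ?c *\<^sub>C ?s t + (\<Sum>q<p. swap_op n (p + 1) q (?s t) - bar_op n (p + 1) q (?s t))"
    by (simp only: x_op_def swap_op_add swap_op_scaleC)
  moreover have "x_op n (p + 1) (?s t) =
      ?c *\<^sub>C ?s t + ((\<Sum>q<p. swap_op n (p + 1) q (?s t) - bar_op n (p + 1) q (?s t)) + (t - bar_op n p (p + 1) t))"
    unfolding x_op_def Suc_eq_plus1[symmetric] sum.lessThan_Suc by (simp only: Suc_eq_plus1 tt last)
  ultimately show ?thesis by (simp only: add_diff_cancel_left diff_add_eq_diff_diff_swap) (simp add: algebra_simps)
qed

lemma brauer_op_add: "brauer_op n (a + b) t = brauer_op n a t + brauer_op n b t"
  and brauer_op_diff: "brauer_op n (a - b) t = brauer_op n a t - brauer_op n b t"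
  and brauer_op_scaleC: "brauer_op n (c *\<^sub>C a) t = c *\<^sub>C brauer_op n a t"
  by (simp_all add: brauer_op_def fun_eq_iff scaleC_apply algebra_simps sum.distrib sum_subtractf sum_distrib_left)

lemma brauer_op_sum: "brauer_op n (\<Sum>x\<in>X. a x) t = (\<Sum>x\<in>X. brauer_op n (a x) t)"
proof -
  have "linear_on UNIV (\<lambda>a. brauer_op n a t)" by (simp add: linear_on_def brauer_op_add brauer_op_scaleC)
  from linear_on_sum[OF this complex_vector.subspace_UNIV] show ?thesis by simp
qed

lemma brauer_op_s:
  assumes "p + 1 < n"
  shows "brauer_op n (brauer_s n (p + 1)) t = swap_op n p (p + 1) t"
proof -
  have k: "p + 1 \<in> {1..n}" "p + 1 + 1 \<in> {1..n}" using assms by auto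
  have "Transposition.transpose (p + 1) (p + 1 + 1) permutes {1..n}" by (rule permutes_swap_id[OF k])
  then show ?thesis
    unfolding brauer_s_def by (simp only: brauer_op_perm_eq perm_op_transpose[OF k] add_diff_cancel_right')
qed

lemma brauer_op_x:
  fixes t :: "'N::finite tensor"
  assumes p: "p < n" and t: "t \<in> tensors n"
  shows "brauer_op n (brauer_x n CARD('N) (p + 1)) t = x_op n p t"
proof -
  have "brauer_op n (brauer_perm n (Transposition.transpose (p + 1) l) - brauer_bar n (p + 1) l) t =
      swap_op n p (l - 1) t - bar_op n p (l - 1) t" if l: "l \<in> {1..<p + 1}" for l
  proof -
    have k: "p + 1 \<in> {1..n}" "l \<in> {1..n}" "p + 1 \<noteq> l" using p l by auto
    have "Transposition.transpose (p + 1) l permutes {1..n}" by (rule permutes_swap_id[OF k(1,2)])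
    then show ?thesis
      by (simp only: brauer_op_diff brauer_op_perm_eq perm_op_transpose[OF k(1,2)] brauer_op_bar_eq[OF k] add_diff_cancel_right')
  qed
  then have "(\<Sum>l\<in>{1..<p + 1}. brauer_op n (brauer_perm n (Transposition.transpose (p + 1) l) - brauer_bar n (p + 1) l) t) =
      (\<Sum>l\<in>{1..<p + 1}. swap_op n p (l - 1) t - bar_op n p (l - 1) t)"
    by (rule sum.cong[OF refl])
  also have "\<dots> = (\<Sum>q<p. swap_op n p q t - bar_op n p q t)"
    by (rule sum.reindex_bij_witness[where i = "\<lambda>q. q + 1" and j = "\<lambda>l. l - 1"]) auto
  finally show ?thesis
    unfolding brauer_x_def brauer_op_add brauer_op_scaleC brauer_op_sum x_op_def
    by (simp only: brauer_op_perm_eq[OF permutes_id] perm_op_id[OF t])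
qed

subsection \<open>Coefficients in a basis of eigenvectors\<close>

text \<open>Applying the identity minus \<open>Q\<close> to the expansion of \<open>y\<close> leaves
  a vanishing combination of the basis vectors that \<open>Q\<close> kills, with unchanged
  coefficients.\<close>

lemma representation_eq_0:
  fixes Q :: "'a::complex_vector \<Rightarrow> 'a"
  assumes B: "complex_vector.independent B" and y: "y \<in> complex_vector.span B"
    and lin: "linear_on UNIV Q" and QB: "\<And>b. b \<in> B \<Longrightarrow> Q b = b \<or> Q b = 0" and Qy: "Q y = y"
    and b: "b \<in> B" "Q b = 0"
  shows "complex_vector.representation B y b = 0"
proof (rule ccontr)
  let ?r = "complex_vector.representation B y"
  assume nz: "?r b \<noteq> 0"
  let ?F = "{b. ?r b \<noteq> 0}"
  let ?Z = "{b \<in> ?F. Q b = 0}"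
  have finF: "finite ?F" by (rule complex_vector.finite_representation)
  have FB: "?F \<subseteq> B" using complex_vector.representation_ne_zero by blast
  have ye: "(\<Sum>b\<in>?F. ?r b *\<^sub>C b) = y" by (rule complex_vector.sum_nonzero_representation_eq[OF B y])
  have "Q (\<Sum>b\<in>?F. ?r b *\<^sub>C b) = (\<Sum>b\<in>?F. ?r b *\<^sub>C Q b)"
    by (subst linear_on_sum[OF lin complex_vector.subspace_UNIV]) (simp_all add: linear_onD(2)[OF lin])
  then have "(\<Sum>b\<in>?F. ?r b *\<^sub>C b) = (\<Sum>b\<in>?F. ?r b *\<^sub>C Q b)" by (simp only: ye Qy)
  then have "(\<Sum>b\<in>?F. ?r b *\<^sub>C b - ?r b *\<^sub>C Q b) = 0" by (simp only: sum_subtractf right_minus_eq)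
  moreover have "(\<Sum>b\<in>?F. ?r b *\<^sub>C b - ?r b *\<^sub>C Q b) = (\<Sum>b\<in>?Z. ?r b *\<^sub>C b)"
  proof (rule sum.mono_neutral_cong_right[OF finF])
    show "\<forall>c\<in>?F - ?Z. ?r c *\<^sub>C c - ?r c *\<^sub>C Q c = 0"
    proof
      fix c assume c: "c \<in> ?F - ?Z"
      then have "Q c = c" using QB[of c] FB by blast
      then show "?r c *\<^sub>C c - ?r c *\<^sub>C Q c = 0" by simp
    qed
  qed auto
  ultimately have sum0: "(\<Sum>b\<in>?Z. ?r b *\<^sub>C b) = 0" by simp
  have F0: "finite ?Z" by (rule finite_subset[OF _ finF]) blast
  have F0B: "?Z \<subseteq> B" using FB by blast
  have "b \<in> ?Z" using nz b by simp
  from complex_vector.independentD[OF B F0 F0B sum0 this] show False using nz by simp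
qed

lemma representation_expand:
  assumes B: "complex_vector.independent B" and y: "y \<in> complex_vector.span B" and F: "finite F"
    and zero: "\<And>b. b \<in> B \<Longrightarrow> b \<notin> F \<Longrightarrow> complex_vector.representation B y b = 0"
  shows "y = (\<Sum>b\<in>F. complex_vector.representation B y b *\<^sub>C b)"
proof -
  let ?r = "complex_vector.representation B y"
  have "(\<Sum>b | ?r b \<noteq> 0. ?r b *\<^sub>C b) = (\<Sum>b\<in>F. ?r b *\<^sub>C b)"
  proof (rule sum.mono_neutral_left[OF F])
    show "{b. ?r b \<noteq> 0} \<subseteq> F" using zero complex_vector.representation_ne_zero by blast
  qed auto
  then show ?thesis using complex_vector.sum_nonzero_representation_eq[OF B y] by simp
qed

lemma independent_pair_eq_0:
  assumes B: "complex_vector.independent B" and b: "b \<in> B" "b' \<in> B" "b \<noteq> b'" and z: "c *\<^sub>C b + d *\<^sub>C b' = 0"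
  shows "c = 0"
proof -
  let ?u = "\<lambda>x. if x = b then c else d"
  have sum0: "(\<Sum>x\<in>{b, b'}. ?u x *\<^sub>C x) = 0" using b z by simp
  have "finite {b, b'}" "{b, b'} \<subseteq> B" "b \<in> {b, b'}" using b by auto
  from complex_vector.independentD[OF B this(1,2) sum0 this(3)] show ?thesis by simp
qed

subsection \<open>Paths\<close>

lemma paths_young: "\<Lambda> \<in> \<L> n N D \<Longrightarrow> l \<le> n \<Longrightarrow> young_diagram (\<Lambda> l)"
  by (auto simp: paths_def young_diagrams_def PiE_iff)

lemma paths_0: "\<Lambda> \<in> \<L> n N D \<Longrightarrow> \<Lambda> 0 = {}"
proof -
  assume "\<Lambda> \<in> \<L> n N D"
  then have "\<Lambda> 0 \<in> \<O> 0 N" by (simp add: paths_def PiE_iff)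
  then have "finite (\<Lambda> 0)" "card (\<Lambda> 0) = 0" by (auto simp: young_diagrams_def young_diagram_def)
  then show ?thesis by simp
qed

text \<open>Paths are told apart at the levels strictly between 0 and \<open>n\<close> alone: at 0
  all are empty, at \<open>n\<close> all equal \<open>D\<close>, and above \<open>n\<close> all are
  \<open>undefined\<close>.\<close>

lemma paths_agree:
  assumes L: "\<Lambda> \<in> \<L> n N D" "\<Lambda>' \<in> \<L> n N D" and eq: "\<And>l. l \<in> {1..<n} \<Longrightarrow> l \<noteq> k \<Longrightarrow> \<Lambda>' l = \<Lambda> l" and l: "l \<noteq> k"
  shows "\<Lambda>' l = \<Lambda> l"
proof -
  consider "l = 0" | "l \<in> {1..<n}" | "l = n" | "n < l" by fastforce
  then show ?thesis
  proof cases
    case 1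
    then show ?thesis using paths_0[OF L(1)] paths_0[OF L(2)] by simp
  next
    case 2
    then show ?thesis using eq l by blast
  next
    case 3
    then show ?thesis using L by (simp add: paths_def)
  next
    case 4
    then show ?thesis using L by (simp add: paths_def PiE_iff extensional_def)
  qed
qed

text \<open>
  If \<open>X\<close> lies between \<open>D\<close> and \<open>E \<noteq> D\<close>, then it arises from \<open>D\<close> by toggling one of the two boxes in the
  symmetric difference of \<open>D\<close> and \<open>E\<close>.
\<close>

lemma between_diagrams:
  assumes ne: "D \<noteq> E" and X: "differ_by_box D X" "differ_by_box X E" and Y: "differ_by_box D Y" "differ_by_box Y E"
    and Z: "differ_by_box D Z" "differ_by_box Z E" and XY: "X \<noteq> Y"
  shows "Z = X \<or> Z = Y"
proof -
  define sd :: "diagram \<Rightarrow> diagram \<Rightarrow> diagram" where "sd A B = (A - B) \<union> (B - A)" for A B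
  have box: "\<exists>b c. W = sd D {b} \<and> sd D E = {b, c}" if W: "differ_by_box D W" "differ_by_box W E" for W
  proof -
    have toggle: "\<exists>b. B = sd A {b}" if AB: "differ_by_box A B" for A B
    proof -
      obtain b where "b \<notin> A \<and> B = insert b A \<or> b \<notin> B \<and> A = insert b B"
        using AB unfolding differ_by_box_def by blast
      then have "B = sd A {b}" by (auto simp: sd_def)
      then show ?thesis by blast
    qed
    obtain b where b: "W = sd D {b}" using toggle[OF W(1)] by blast
    obtain c where c: "E = sd W {c}" using toggle[OF W(2)] by blast
    have "b \<noteq> c" using ne b c unfolding sd_def by blast
    then have "sd D E = {b, c}" unfolding c b sd_def by blast
    then show ?thesis using b by blast
  qed
  obtain x x' where x: "X = sd D {x}" "sd D E = {x, x'}" using box[OF X] by blast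
  obtain y y' where y: "Y = sd D {y}" "sd D E = {y, y'}" using box[OF Y] by blast
  obtain z z' where z: "Z = sd D {z}" "sd D E = {z, z'}" using box[OF Z] by blast
  have "z = x \<or> z = y" using x y z XY by (auto simp: doubleton_eq_iff)
  then show ?thesis using x(1) y(1) z(1) by blast
qed

lemma paths_between:
  assumes L: "\<Lambda> \<in> \<L> n N D" "\<Lambda>' \<in> \<L> n N D" "\<Lambda>'' \<in> \<L> n N D" and k: "1 \<le> k" "k < n"
    and ne: "\<Lambda> (k - 1) \<noteq> \<Lambda> (k + 1)" "\<Lambda> \<noteq> \<Lambda>'"
    and eq: "\<And>l. l \<noteq> k \<Longrightarrow> \<Lambda>' l = \<Lambda> l" "\<And>l. l \<noteq> k \<Longrightarrow> \<Lambda>'' l = \<Lambda> l"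
  shows "\<Lambda>'' = \<Lambda> \<or> \<Lambda>'' = \<Lambda>'"
proof -
  have d: "differ_by_box (M (k - 1)) (M k)" "differ_by_box (M k) (M (k + 1))" if "M \<in> \<L> n N D" for M
    using that k by (auto simp: paths_def dest: spec[of _ "k - 1"])
  have ext: "M = M'" if "M k = M' k" "\<And>l. l \<noteq> k \<Longrightarrow> M l = \<Lambda> l" "\<And>l. l \<noteq> k \<Longrightarrow> M' l = \<Lambda> l" for M M' :: path
  proof
    fix l show "M l = M' l" using that by (cases "l = k") simp_all
  qed
  have "\<Lambda> k \<noteq> \<Lambda>' k" using ne(2) ext[of \<Lambda> \<Lambda>'] eq by blast
  moreover have o: "\<Lambda>' (k - 1) = \<Lambda> (k - 1)" "\<Lambda>' (k + 1) = \<Lambda> (k + 1)"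
    "\<Lambda>'' (k - 1) = \<Lambda> (k - 1)" "\<Lambda>'' (k + 1) = \<Lambda> (k + 1)"
    using eq k by simp_all
  ultimately have "\<Lambda>'' k = \<Lambda> k \<or> \<Lambda>'' k = \<Lambda>' k"
    using between_diagrams[OF ne(1) d[OF L(1)] d[OF L(2), unfolded o] d[OF L(3), unfolded o]] by blast
  then show ?thesis using ext[of \<Lambda>'' \<Lambda>] ext[of \<Lambda>'' \<Lambda>'] eq by blast
qed

subsection \<open>Matrix elements\<close>

lemma brauer_act_s:
  assumes "p + 1 < n"
  shows "brauer_act n (brauer_s n (p + 1)) f = swap_op n p (p + 1) \<circ> f"
  by (rule ext) (simp only: brauer_act_def o_apply brauer_op_s[OF assms])

lemma brauer_act_x:
  fixes f :: "'N::finite mult"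
  assumes "p < n" "f \<in> mult_module n D"
  shows "brauer_act n (brauer_x n CARD('N) (p + 1)) f = x_op n p \<circ> f"
  by (rule ext) (simp only: brauer_act_def o_apply brauer_op_x[OF assms(1) mult_module_tensors[OF assms(2)]])

lemma mult_module_compose: "equivariant n n Q \<Longrightarrow> f \<in> mult_module n D \<Longrightarrow> Q \<circ> f \<in> mult_module n D"
  unfolding mult_module_def by (rule Hom_compose[OF _ _ order_refl])

lemma equivariant_compose_linear:
  assumes Q: "equivariant n n Q" and f: "\<And>h. f h \<in> tensors n" "\<And>h. g h \<in> tensors n"
  shows "Q \<circ> (c *\<^sub>C f + d *\<^sub>C g) = c *\<^sub>C (Q \<circ> f) + d *\<^sub>C (Q \<circ> g)"
proof
  fix h
  have "Q (c *\<^sub>C f h + d *\<^sub>C g h) = c *\<^sub>C Q (f h) + d *\<^sub>C Q (g h)"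
    by (simp only: linear_onD[OF equivariantD(1)[OF Q]] complex_vector.subspace_scale[OF subspace_tensors] f)
  then show "(Q \<circ> (c *\<^sub>C f + d *\<^sub>C g)) h = (c *\<^sub>C (Q \<circ> f) + d *\<^sub>C (Q \<circ> g)) h"
    by (simp only: o_apply plus_fun_apply[of "c *\<^sub>C f" "d *\<^sub>C g"] plus_fun_apply[of "c *\<^sub>C (Q \<circ> f)" "d *\<^sub>C (Q \<circ> g)"]
        scaleC_fun_apply[of c f] scaleC_fun_apply[of d g] scaleC_fun_apply[of c "Q \<circ> f"] scaleC_fun_apply[of d "Q \<circ> g"])
qed

context
  fixes n :: nat and D :: diagram and v :: "path \<Rightarrow> 'N::finite mult"
  assumes D: "D \<in> \<O> n CARD('N)" and cb: "canonical_basis n D v"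
begin

lemma basis_inj: "inj_on v (\<L> n CARD('N) D)"
  and basis_independent: "complex_vector.independent (v ` \<L> n CARD('N) D)"
  and basis_span: "complex_vector.span (v ` \<L> n CARD('N) D) = mult_module n D"
  and basis_component: "\<Lambda> \<in> \<L> n CARD('N) D \<Longrightarrow> k \<in> {1..<n} \<Longrightarrow> v \<Lambda> \<in> restriction_component n D k (\<Lambda> k)"
  using cb unfolding canonical_basis_def by blast+

lemma basis_in_mult: "\<Lambda> \<in> \<L> n CARD('N) D \<Longrightarrow> v \<Lambda> \<in> mult_module n D"
  unfolding basis_span[symmetric] by (intro complex_vector.span_base imageI)

lemma basis_tensors: "\<Lambda> \<in> \<L> n CARD('N) D \<Longrightarrow> v \<Lambda> h \<in> tensors n"
  by (rule mult_module_tensors[OF basis_in_mult])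

lemma basis_nonzero: "\<Lambda> \<in> \<L> n CARD('N) D \<Longrightarrow> v \<Lambda> \<noteq> 0"
  using complex_vector.dependent_zero[of "v ` \<L> n CARD('N) D"] basis_independent by (metis imageI)

text \<open>The defining property of the basis gives this for 0 < \<open>l\<close> <
  \<open>n\<close>. At level \<open>n\<close> it holds because the vector belongs to the
  multiplicity module of \<open>D\<close>, and at level 0 because every tensor of order 0 has the
  type of the empty diagram.\<close>

lemma basis_fixed:
  assumes L: "\<Lambda> \<in> \<L> n CARD('N) D" and l: "l \<le> n"
  shows "extend_op l (iso_proj l (\<Lambda> l)) (v \<Lambda> h) = v \<Lambda> h"
proof -
  consider "l = 0" | "l \<in> {1..<n}" | "l = n" using l by fastforce
  then show ?thesis
  proof cases
    case 1
    note P = equivariant_iso_proj[of 0 "{}"]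
    show ?thesis
      unfolding 1 paths_0[OF L]
    proof (rule slice_eqI[of 0 n])
      fix r :: "'N list"
      have "slice 0 r (v \<Lambda> h) \<in> weyl_space 0 {}" by (rule subsetD[OF weyl_space_0 slice_in])
      then show "slice 0 r (extend_op 0 (iso_proj 0 {}) (v \<Lambda> h)) = slice 0 r (v \<Lambda> h)"
        by (simp only: slice_extend_op[OF P] iso_proj_id)
    qed (simp_all add: extend_op_in[OF P] basis_tensors[OF L])
  next
    case 2
    show ?thesis
      using fun_cong[OF restriction_component_fixed[OF basis_component[OF L 2]], of h] by (simp only: o_apply)
  next
    case 3
    have "\<Lambda> n = D" using L by (simp add: paths_def)
    then show ?thesis
      using fun_cong[OF mult_module_fixed[OF basis_in_mult[OF L]], of h] 3 by (simp only: o_apply)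
  qed
qed

text \<open>The projection of level \<open>l\<close> to the type \<open>\<Lambda> l\<close> fixes or
  kills each basis vector, according to whether its path passes through
  \<open>\<Lambda> l\<close>.\<close>

lemma coefficient_eq_0:
  assumes L: "\<Lambda> \<in> \<L> n CARD('N) D" and L': "\<Lambda>' \<in> \<L> n CARD('N) D" and l: "l \<le> n" and ne: "\<Lambda>' l \<noteq> \<Lambda> l"
    and y: "y \<in> mult_module n D" and fix_y: "\<And>h. extend_op l (iso_proj l (\<Lambda> l)) (y h) = y h"
  shows "complex_vector.representation (v ` \<L> n CARD('N) D) y (v \<Lambda>') = 0"
proof -
  note P = equivariant_iso_proj[of l "\<Lambda> l"]
  let ?Q = "\<lambda>f :: 'N mult. extend_op l (iso_proj l (\<Lambda> l)) \<circ> f"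
  have "linear_on UNIV ?Q"
    unfolding linear_on_def
  proof (intro conjI ballI allI)
    fix f g :: "'N mult"
    show "?Q (f + g) = ?Q f + ?Q g"
      by (rule ext) (simp only: o_apply plus_fun_apply[of f g] plus_fun_apply[of "?Q f" "?Q g"] extend_op_add[OF P])
    show "?Q (c *\<^sub>C f) = c *\<^sub>C ?Q f" for c
      by (rule ext) (simp only: o_apply scaleC_fun_apply[of c f] scaleC_fun_apply[of c "?Q f"] extend_op_scaleC[OF P])
  qed
  moreover have fixed: "?Q (v M) = v M" if "M \<in> \<L> n CARD('N) D" "M l = \<Lambda> l" for M
    by (rule ext) (simp only: o_apply that(2)[symmetric] basis_fixed[OF that(1) l])
  moreover have other: "?Q (v M) = 0" if "M \<in> \<L> n CARD('N) D" "M l \<noteq> \<Lambda> l" for M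
  proof
    fix h
    have "extend_op l (iso_proj l (\<Lambda> l)) (v M h) = 0"
      by (rule fixed_other[OF paths_young[OF that(1) l] paths_young[OF L l] that(2) l basis_tensors[OF that(1)] basis_fixed[OF that(1) l]])
    then show "?Q (v M) h = 0 h" by (simp only: o_apply zero_fun_apply[of h])
  qed
  moreover have "?Q y = y" by (rule ext) (simp only: o_apply fix_y)
  moreover have "y \<in> complex_vector.span (v ` \<L> n CARD('N) D)" unfolding basis_span by (rule y)
  ultimately show ?thesis
    using L' ne by (intro representation_eq_0[OF basis_independent, of y ?Q]) blast+
qed

text \<open>The image is fixed by the projections of all levels that fix \<open>v \<Lambda>\<close>,
  because they commute with \<open>x_op\<close>. Any other path differs from
  \<open>\<Lambda>\<close> at some level, so its coefficient vanishes.\<close>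

lemma x_eigenvector:
  assumes L: "\<Lambda> \<in> \<L> n CARD('N) D" and p: "p < n"
  shows "x_op n p \<circ> v \<Lambda> = x_eigenvalue n v (p + 1) \<Lambda> *\<^sub>C v \<Lambda>"
proof -
  let ?y = "x_op n p \<circ> v \<Lambda>"
  have y: "?y \<in> mult_module n D" by (rule mult_module_compose[OF equivariant_x_op[OF p] basis_in_mult[OF L]])
  have "complex_vector.representation (v ` \<L> n CARD('N) D) ?y b = 0"
    if "b \<in> v ` \<L> n CARD('N) D" "b \<notin> {v \<Lambda>}" for b
  proof -
    obtain M where M: "M \<in> \<L> n CARD('N) D" "b = v M" using \<open>b \<in> v ` \<L> n CARD('N) D\<close> by blast
    have "M \<noteq> \<Lambda>" using M \<open>b \<notin> {v \<Lambda>}\<close> by blast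
    then obtain l where l: "M l \<noteq> \<Lambda> l" by blast
    have "l \<le> n"
    proof (rule ccontr)
      assume "\<not> l \<le> n"
      then show False using l M(1) L by (simp add: paths_def PiE_iff extensional_def)
    qed
    show ?thesis
      unfolding M(2)
      by (rule coefficient_eq_0[OF L M(1) \<open>l \<le> n\<close> l y])
        (simp only: o_apply extend_iso_proj_x_op[OF basis_tensors[OF L] p \<open>l \<le> n\<close>] basis_fixed[OF L \<open>l \<le> n\<close>])
  qed
  then have "?y = (\<Sum>b\<in>{v \<Lambda>}. complex_vector.representation (v ` \<L> n CARD('N) D) ?y b *\<^sub>C b)"
    by (intro representation_expand[OF basis_independent]) (simp_all only: basis_span y finite.intros)
  then obtain c where c: "?y = c *\<^sub>C v \<Lambda>" by (simp only: sum.insert finite.emptyI empty_iff simp_thms sum.empty add_0_right)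
  have "x_eigenvalue n v (p + 1) \<Lambda> = c"
    unfolding x_eigenvalue_def brauer_act_x[OF p basis_in_mult[OF L]]
  proof (rule the_equality)
    show "?y = c *\<^sub>C v \<Lambda>" by (fact c)
    fix c' assume "?y = c' *\<^sub>C v \<Lambda>"
    then have "c' *\<^sub>C v \<Lambda> = c *\<^sub>C v \<Lambda>" by (simp only: c)
    then show "c' = c" using basis_nonzero[OF L] by (simp only: complex_vector.scale_cancel_right simp_thms)
  qed
  then show ?thesis using c by simp
qed

text \<open>By independence a basis vector lies in the span of a part of the basis only if it
  belongs to that part; injectivity of \<open>v\<close> then identifies the path.\<close>

lemma local_space_agree:
  assumes L: "\<Lambda>' \<in> \<L> n CARD('N) D" and loc: "v \<Lambda>' \<in> local_space n D v \<Lambda> k" and l: "l \<noteq> k"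
  shows "\<Lambda>' l = \<Lambda> l"
proof -
  let ?M = "{M \<in> \<L> n CARD('N) D. \<forall>l. l \<noteq> k \<longrightarrow> M l = \<Lambda> l}"
  have "v \<Lambda>' \<in> v ` ?M"
  proof (rule ccontr)
    assume "v \<Lambda>' \<notin> v ` ?M"
    then have "v ` ?M \<subseteq> v ` \<L> n CARD('N) D - {v \<Lambda>'}" by blast
    from subsetD[OF complex_vector.span_mono[OF this] loc[unfolded local_space_def]]
    have "v \<Lambda>' \<in> complex_vector.span (v ` \<L> n CARD('N) D - {v \<Lambda>'})" .
    moreover have "v \<Lambda>' \<in> v ` \<L> n CARD('N) D" using L by (rule imageI)
    ultimately show False using basis_independent unfolding complex_vector.dependent_def by (elim notE) (rule bexI)
  qed
  then obtain M where M: "M \<in> ?M" "v \<Lambda>' = v M" by (rule imageE)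
  then have "\<Lambda>' = M" using basis_inj L by (simp add: inj_on_eq_iff)
  then show ?thesis using M(1) l by simp
qed

lemma s_expansion:
  assumes k: "1 \<le> k" "k < n" and L: "\<Lambda> \<in> \<L> n CARD('N) D" "\<Lambda>' \<in> \<L> n CARD('N) D"
    and ne: "\<Lambda> (k - 1) \<noteq> \<Lambda> (k + 1)" "\<Lambda> \<noteq> \<Lambda>'" and eq: "\<And>l. l \<noteq> k \<Longrightarrow> \<Lambda>' l = \<Lambda> l"
  shows "swap_op n (k - 1) k \<circ> v \<Lambda> = s_coeff n D v k \<Lambda> \<Lambda> *\<^sub>C v \<Lambda> + s_coeff n D v k \<Lambda> \<Lambda>' *\<^sub>C v \<Lambda>'"
proof -
  let ?y = "swap_op n (k - 1) k \<circ> v \<Lambda>"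
  have kk: "k - 1 < n" "k - 1 + 1 = k" "k - 1 + 1 < n" using k by auto
  have y: "?y \<in> mult_module n D"
    by (rule mult_module_compose[OF equivariant_swap_op[OF kk(1) k(2)] basis_in_mult[OF L(1)]])
  have act: "brauer_act n (brauer_s n k) (v \<Lambda>) = ?y"
    using brauer_act_s[OF kk(3), of "v \<Lambda>"] by (simp only: kk(2))
  have "complex_vector.representation (v ` \<L> n CARD('N) D) ?y b = 0"
    if "b \<in> v ` \<L> n CARD('N) D" "b \<notin> {v \<Lambda>, v \<Lambda>'}" for b
  proof -
    obtain M where M: "M \<in> \<L> n CARD('N) D" "b = v M" using \<open>b \<in> v ` \<L> n CARD('N) D\<close> by blast
    have "\<exists>l. l \<in> {1..<n} \<and> l \<noteq> k \<and> M l \<noteq> \<Lambda> l"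
    proof (rule ccontr)
      assume "\<not> ?thesis"
      then have "M l = \<Lambda> l" if "l \<noteq> k" for l
        using paths_agree[OF L(1) M(1), of k l] that by blast
      then have "M = \<Lambda> \<or> M = \<Lambda>'" by (intro paths_between[OF L M(1) k ne eq]) simp_all
      then show False using M(2) \<open>b \<notin> {v \<Lambda>, v \<Lambda>'}\<close> by blast
    qed
    then obtain l where l: "l \<in> {1..<n}" "l \<noteq> k" "M l \<noteq> \<Lambda> l" by blast
    have ln: "l \<le> n" using l(1) by simp
    \<comment> \<open>The positions \<open>k - 1\<close> and \<open>k\<close>, counted from 0, both
      lie behind the first \<open>l\<close> factors if \<open>l < k\<close>, and both among them if
      \<open>l > k\<close>. Only the level \<open>l = k\<close> separates them.\<close>
    have "extend_op l (iso_proj l (\<Lambda> l)) (swap_op n (k - 1) k (v \<Lambda> h)) =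
        swap_op n (k - 1) k (extend_op l (iso_proj l (\<Lambda> l)) (v \<Lambda> h))" for h
    proof (cases "l < k")
      case True
      then show ?thesis
        using k by (intro extend_op_swap_tail[OF equivariant_iso_proj basis_tensors[OF L(1)]]) auto
    next
      case False
      then show ?thesis
        using k l by (intro extend_iso_proj_swap_head[OF basis_tensors[OF L(1)]]) auto
    qed
    then show ?thesis
      unfolding M(2)
      by (intro coefficient_eq_0[OF L(1) M(1) ln l(3) y]) (simp only: o_apply basis_fixed[OF L(1) ln])
  qed
  then have "?y = (\<Sum>b\<in>{v \<Lambda>, v \<Lambda>'}. complex_vector.representation (v ` \<L> n CARD('N) D) ?y b *\<^sub>C b)"
    by (intro representation_expand[OF basis_independent]) (simp_all only: basis_span y finite.intros)
  moreover have "v \<Lambda> \<noteq> v \<Lambda>'" using basis_inj L ne(2) by (simp add: inj_on_eq_iff)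
  ultimately show ?thesis
    unfolding s_coeff_def act by simp
qed

end

theorem corollary3p3:
  fixes n k :: nat and D :: diagram and \<Lambda> \<Lambda>' :: path and v :: "path \<Rightarrow> 'N::finite mult"
  assumes "n \<ge> 1"
    and "D \<in> \<O> n CARD('N)"
    and "canonical_basis n D v"
    and "\<Lambda> \<in> \<L> n CARD('N) D" and "\<Lambda>' \<in> \<L> n CARD('N) D"
    and "k \<in> {1..n - 1}"
    and "\<Lambda> (k - 1) \<noteq> \<Lambda> (k + 1)"
    and "v \<Lambda>' \<in> local_space n D v \<Lambda> k"
    and "\<Lambda> \<noteq> \<Lambda>'"
  shows "s_coeff n D v k \<Lambda> \<Lambda>' * s_coeff n D v k \<Lambda>' \<Lambda> =
    1 - (x_eigenvalue n v (k + 1) \<Lambda> - x_eigenvalue n v k \<Lambda>) powi (-2)"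
proof -
  note cb = assms(2,3) and L = assms(4,5)
  have k: "1 \<le> k" "k < n" using assms(1,6) by auto
  \<comment> \<open>The position of the factor with index \<open>k\<close>, counted from 0.\<close>
  define p where "p = k - 1"
  have p: "p + 1 = k" "p + 1 < n" "p < n" using k by (auto simp: p_def)
  have kp: "k - 1 = p" by (simp add: p_def)
  have eq: "\<Lambda>' l = \<Lambda> l" if "l \<noteq> k" for l
    by (rule local_space_agree[OF cb L(2) assms(8) that])
  have ne': "\<Lambda>' (k - 1) \<noteq> \<Lambda>' (k + 1)" using assms(7) eq[of "k - 1"] eq[of "k + 1"] k by simp
  let ?w = "v \<Lambda>" and ?w' = "v \<Lambda>'"
  let ?s = "swap_op n p (p + 1) :: 'N tensor \<Rightarrow> 'N tensor"
  define a where "a = x_eigenvalue n v k \<Lambda>"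
  define b where "b = x_eigenvalue n v (k + 1) \<Lambda>"
  define b' where "b' = x_eigenvalue n v (k + 1) \<Lambda>'"
  define \<alpha> where "\<alpha> = s_coeff n D v k \<Lambda> \<Lambda>"
  define \<beta> where "\<beta> = s_coeff n D v k \<Lambda> \<Lambda>'"
  define \<alpha>' where "\<alpha>' = s_coeff n D v k \<Lambda>' \<Lambda>'"
  define \<beta>' where "\<beta>' = s_coeff n D v k \<Lambda>' \<Lambda>"
  have sw: "?s \<circ> ?w = \<alpha> *\<^sub>C ?w + \<beta> *\<^sub>C ?w'"
    unfolding \<alpha>_def \<beta>_def p(1) by (rule s_expansion[OF cb k L assms(7,9) eq, unfolded kp])
  have sw': "?s \<circ> ?w' = \<beta>' *\<^sub>C ?w + \<alpha>' *\<^sub>C ?w'"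
    unfolding \<alpha>'_def \<beta>'_def p(1)
    by (subst add.commute) (rule s_expansion[OF cb k L(2,1) ne' assms(9)[symmetric] eq[symmetric], unfolded kp])
  have xw: "x_op n p \<circ> ?w = a *\<^sub>C ?w" "x_op n (p + 1) \<circ> ?w = b *\<^sub>C ?w" "x_op n (p + 1) \<circ> ?w' = b' *\<^sub>C ?w'"
    using x_eigenvector[OF cb L(1) p(3)] x_eigenvector[OF cb L(1) p(2)] x_eigenvector[OF cb L(2) p(2)]
    by (simp_all only: p(1) a_def b_def b'_def)
  note T = basis_tensors[OF cb L(1)] basis_tensors[OF cb L(2)]
  note s_eqv = equivariant_swap_op[OF p(3,2)] and y_eqv = equivariant_x_op[OF p(2)]
  have indep: "c = 0" if "c *\<^sub>C ?w + d *\<^sub>C ?w' = 0" for c d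
  proof (rule independent_pair_eq_0[OF basis_independent[OF cb] _ _ _ that])
    show "?w \<in> v ` \<L> n CARD('N) D" "?w' \<in> v ` \<L> n CARD('N) D" by (rule imageI, fact)+
    show "?w \<noteq> ?w'" using basis_inj[OF cb] L assms(9) by (simp add: inj_on_eq_iff)
  qed
  have bar: "bar_op n p (p + 1) (?w h) = 0" for h
  proof (rule bar_op_adjacent_eq_0[OF T(1)])
    have kp: "p + 2 = k + 1" "p = k - 1" using p by auto
    show "p + 2 \<le> n" using p by simp
    show "young_diagram (\<Lambda> (k + 1))" "young_diagram (\<Lambda> (k - 1))"
      using k by (intro paths_young[OF L(1)]; simp)+
    show "\<Lambda> (k + 1) \<noteq> \<Lambda> (k - 1)" using assms(7) by simp
    show "extend_op (p + 2) (iso_proj (p + 2) (\<Lambda> (k + 1))) (?w h) = ?w h"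
      unfolding kp(1) using k by (intro basis_fixed[OF cb L(1)]) simp
    show "extend_op p (iso_proj p (\<Lambda> (k - 1))) (?w h) = ?w h"
      unfolding kp(2) using k by (intro basis_fixed[OF cb L(1)]) simp
  qed
  \<comment> \<open>With the bar term gone, the exchange relation involves only operators whose
    action on the two basis vectors is known, so it becomes an equation between
    coefficients.\<close>
  have "(?s \<circ> (x_op n p \<circ> ?w)) - (x_op n (p + 1) \<circ> (?s \<circ> ?w)) = - ?w"
  proof
    fix h
    show "((?s \<circ> (x_op n p \<circ> ?w)) - (x_op n (p + 1) \<circ> (?s \<circ> ?w))) h = (- ?w) h"
      using exchange_relation[OF p(2) T(1), of h]
      by (simp only: minus_apply[of "?s \<circ> (x_op n p \<circ> ?w)"] uminus_apply[of ?w] o_apply bar diff_0)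
  qed
  moreover have "?s \<circ> (x_op n p \<circ> ?w) = a *\<^sub>C (\<alpha> *\<^sub>C ?w + \<beta> *\<^sub>C ?w')"
    using equivariant_compose_linear[where f = ?w and g = ?w and c = a and d = 0, OF s_eqv T(1) T(1)]
    by (simp only: xw(1) sw complex_vector.scale_zero_left add_0_right)
  moreover have "x_op n (p + 1) \<circ> (?s \<circ> ?w) = \<alpha> *\<^sub>C (b *\<^sub>C ?w) + \<beta> *\<^sub>C (b' *\<^sub>C ?w')"
    unfolding sw equivariant_compose_linear[where f = ?w and g = ?w', OF y_eqv T] xw ..
  ultimately have "(a * \<alpha> - \<alpha> * b + 1) *\<^sub>C ?w + (a * \<beta> - \<beta> * b') *\<^sub>C ?w' = 0"
    by (simp add: complex_vector.scale_left_distrib complex_vector.scale_right_distrib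
        complex_vector.scale_left_diff_distrib algebra_simps)
  then have "a * \<alpha> - \<alpha> * b + 1 = 0" by (rule indep)
  \<comment> \<open>This equation also shows that the two eigenvalues differ, so the inverse taken
    below is a genuine one.\<close>
  then have ab: "\<alpha> * (b - a) = 1" by (simp add: algebra_simps)
  have "?s \<circ> (?s \<circ> ?w) = ?w"
  proof
    fix h show "(?s \<circ> (?s \<circ> ?w)) h = ?w h"
      using swap_op_swap_op[OF p(3,2) T(1)] by simp
  qed
  then have "\<alpha> *\<^sub>C (\<alpha> *\<^sub>C ?w + \<beta> *\<^sub>C ?w') + \<beta> *\<^sub>C (\<beta>' *\<^sub>C ?w + \<alpha>' *\<^sub>C ?w') = ?w"
    unfolding sw equivariant_compose_linear[where f = ?w and g = ?w', OF s_eqv T] sw' .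
  then have "(\<alpha> * \<alpha> + \<beta> * \<beta>' - 1) *\<^sub>C ?w + (\<alpha> * \<beta> + \<beta> * \<alpha>') *\<^sub>C ?w' = 0"
    by (simp add: complex_vector.scale_left_distrib complex_vector.scale_right_distrib
        complex_vector.scale_left_diff_distrib algebra_simps)
  then have "\<alpha> * \<alpha> + \<beta> * \<beta>' - 1 = 0" by (rule indep)
  then have "\<beta> * \<beta>' = 1 - \<alpha> * \<alpha>" by (simp add: algebra_simps)
  also have "\<alpha> = inverse (b - a)" using ab by (metis inverse_unique mult.commute)
  finally show ?thesis
    by (simp add: \<beta>_def \<beta>'_def a_def b_def power_int_minus power2_eq_square inverse_mult_distrib)
qed

end
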